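(* Let $n\in\{3,4,5,7,8,9,11,12,13,15,16,17,19,20,21,24,25,27,28,32,33,35,36,40,44,45,48,60,84\}$ and consider a Bravais $\ell$-colouring of $\mathcal{M}_n=\mathbb{Z}[\xi_n]$ induced by $(q)$. The colour preserving group $K$ is trivial, that is $K=T_{(q)}$, except for those values of $\ell$ listed below. An entry "$\ell:P$" in the line of $n$ means that an $\ell$-colouring of $\mathcal{M}_n$ yields $K=T_{(q)}\rtimes P_n$ with $P_n=P$; for entries marked with an asterisk, "$\ell^*:P$", see the specifications (i)–(iii) following the list. $n=3$: $3:D_3$; $4:C_2$. $n=4$: $2:D_4$; $4:D_2$. $n=5$: $5:D_5$; $16:C_2$. $n=8$: $2:D_8$; $4:D_4$; $8:C_2$; $16:C_2$. $n=12$: $4:C_4$; $9:C_3$; $16:C_2$. $n=7$: $7:D_7$; $8:C_2$; $64^*:C_2$. $n=9$: $3:D_9$; $9:C_3$; $27:C_3$; $64:C_2$. $n=15$: $16:C_2$; $25:C_5$; $81:C_3$; $256^*:C_2$. $n=16$: $2:D_{16}$; $4:D_8$; $8:C_4$; $16:C_4$; $32:C_2$; $64:C_2$; $128:C_2$; $256:C_2$. $n=20$: $5:C_5$; $16:C_4$; $25^*:C_5$; $256:C_2$. $n=24$: $4:C_8$; $9:C_3$; $16:C_4$; $81^*:C_3$; $256:C_2$. $n=11$: $11:D_{11}$; $1024:C_2$. $n=13$: $13:D_{13}$; $4096:C_2$. $n=21$: $7:C_7$; $49^*:C_7$; $64:C_2$; $729:C_3$; $4096^*:C_2$. $n=28$: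 $8:C_4$; $49:C_7$; $64^*:C_4$; $512^*:C_2$; $4096^*:C_2$. $n=36$: $9:C_9$; $64:C_4$; $729:C_3$; $4096:C_2$. $n=17$: $17:D_{17}$; $256:C_2$; $65536^*:C_2$. $n=32$: $2:D_{32}$; $4:D_{16}$; $8:C_8$; $16:C_8$; $32:C_4$; $64:C_4$; $128:C_4$; $256:C_4$; $2^i:C_2$ for $i=9,10,11,12,13,14,15,16$. $n=40$: $16:C_8$; $25:C_5$; $256:C_4$; $625^*:C_5$; $4096:C_2$; $65536:C_2$. $n=48$: $4:C_{16}$; $16:C_8$; $64:C_4$; $81:C_3$; $256:C_4$; $6561^*:C_3$; $1024:C_2$; $4096:C_2$; $16384:C_2$; $65536:C_2$. $n=60$: $16:C_4$; $25:C_5$; $81:C_3$; $256^*:C_4$; $625^*:C_5$; $4096^*:C_2$; $6561^*:C_3$; $65536^*:C_2$. $n=19$: $19:D_{19}$; $262144:C_2$. $n=27$: $3:D_{27}$; $9:C_9$; $27:C_9$; $3^i:C_3$ for $i=4,5,6,7,8,9$; $262144:C_2$. $n=25$: $5:D_{25}$; $5^i:C_5$ for $i=2,3,4,5$; $1048576:C_2$. $n=33$: $3:D_{27}$; $9:C_9$; $27:C_9$; $3^i:C_3$ for $i=4,5,6,7,8,9$; $1048576:C_2$. $n=44$: $121:C_{11}$; $1024:C_4$; $1048576:C_2$. $n=35$: $2401:C_7$; $4096:C_2$; $15625:C_5$; $16777216^*:C_2$. $n=45$: $81:C_9$; $4096:C_2$; $6561:C_3$; $15625:C_5$; $531441:C_3$;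 $16777216^*:C_2$. $n=84$: $49:C_7$; $64:C_4$; $729:C_3$; $2401^*:C_7$; $4096^*:C_4$; $531441^*:C_3$; $262144^*:C_2$; $16777216^*:C_2$. Specifications for certain cases with an asterisk: (i) For $n=7,15,17,21,33,35,45$, $(2)$ splits into two distinct primes in $\mathcal{M}_n$; write $(2)=(q_2)(\overline{q}_2)$. The colourings induced by $2$, $q_2$, or $\overline{q}_2$ yield $P_n=C_2$. However, $K$ is trivial for the colourings induced by $q_2^2$ or $\overline{q}_2^{\,2}$. (ii) For primes $p=3,5,7$, $(1-\xi_p)$ may split depending on $n$. When it does, it splits into two distinct primes in $\mathcal{M}_n$, and we write $(1-\xi_p)=(q_p)(\overline{q}_p)$. Whenever $(1-\xi_p)$ splits, the colourings induced by $1-\xi_p$, $q_p$, or $\overline{q}_p$ yield $P_n=C_p$, while the colourings induced by $q_p^2$ or $\overline{q}_p^{\,2}$ yield a trivial $K$. For $n=48,60,84$, $(1-\xi_3)$ splits; for $n=40,60$, $(1-\xi_5)$ splits; and for $n=21,84$, $(1-\xi_7)$ splits; all in the way just described. (iii) For $n=28,60,84$, $(1-\xi_4)$ splits into two distinct primes in $\mathcal{M}_n$; write $(1-\xi_4)=(q_4)(\overline{q}_4)$, and $(2)=(1-\xi_4)(1-\xi_4)=(q_4)(\overline{q}_4)(q_4)(\overline{q}_4)$. For the following triples $(i,j,\ell)$, $q_4^i(1-\xi_4)^j$ or $\overline{q}_4^{\,i}(1-\xi_4)^j$ induces an $\ell$-colouring: $(0,1,2^{\phi(n)/2})$ and $(1,0,2^{\phi(n)/4})$,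 with $P_n=C_4$; $(0,2,2^{\phi(n)})$, $(2,0,2^{\phi(n)/2})$ and $(1,1,2^{3\phi(n)/4})$, with $P_n=C_2$; and $(4,0,2^{\phi(n)})$, $(2,1,2^{\phi(n)})$ and $(3,0,2^{3\phi(n)/4})$, with trivial $K$.
   Context: For a positive integer $m$, $\xi_m=e^{2\pi i/m}$; $\phi$ is Euler's totient function. $\mathcal{M}_n=\mathbb{Z}[\xi_n]$; for the listed $n$ it has class number one and is a principal ideal domain. $(q)=q\mathcal{M}_n$ is the ideal generated by $q$. For non-zero $q\in\mathcal{M}_n$ with $\ell=[\mathcal{M}_n:(q)]$, the Bravais (ideal) $\ell$-colouring $c$ of $\mathcal{M}_n$ induced by $q$ (or by $(q)$) assigns to every element of $\mathcal{M}_n$ a colour in $\{1,\dots,\ell\}$: $c(z)=1$ for $z\in(q)$, and $c(z)=i$ for $z\in(q)+t_i$, where $(q)+t_2,\dots,(q)+t_\ell$ are the other cosets of $(q)$. Let $N=\mathrm{lcm}(2,n)$. The symmetry group of the uncoloured module is $G=\mathcal{M}_n\rtimes D_N$, where $\mathcal{M}_n$ acts by translations and the dihedral group $D_N$ (of order $2N$) is generated by multiplication by $\xi_N$ and by complex conjugation. The colour symmetry group is $H=\{h\in G:\ \exists\,\pi\in S_\ell\ \forall x\in\mathcal{M}_n:\ c(h(x))=\pi(c(x))\}$, where $S_\ell$ is the symmetric group on $\ell$ letters, and the colour preserving group is $K=\{k\in H:\ \forall x\in\mathcal{M}_n:\ c(k(x))=c(x)\}$. $T_{(q)}\cong(q)$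 is the group of translations $x\mapsto x+t$ with $t\in(q)$; $K$ always contains $T_{(q)}$ and is called trivial if $K=T_{(q)}$. In general $K=T_{(q)}\rtimes P_n$, where $P_n$ is its group of symmetries fixing the origin. Let $R_k(x)=\xi_k x$ be the $k$-fold rotation about the origin and $S(x)=\overline{x}$ the reflection along the real line. $C_k=\langle R_k\rangle$ is the cyclic group of order $k$ and $D_k=\langle R_k,S\rangle$ the dihedral group of order $2k$. The overline denotes complex conjugation.
   Formalization: Corrected: 64:C_2 added for n=24, 81:C_3 for n=36; n=33 line is 121:C_11, 243:C_3, 1024:C_2, 59049*:C_3, 1048576*:C_2; in (i) for n=17,33 and in (ii) for n=84, p=3 the two distinct primes are not complex conjugates; ℓ=1 (q a unit, K=G) is excluded. *)

theory Defs
  imports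
    Complex_Main
    "HOL-Computational_Algebra.Polynomial"
    "HOL-Number_Theory.Totient"
    "HOL-Combinatorics.Permutations"
    "HOL-Algebra.Bij"
    "HOL-Algebra.Generated_Groups"
    "HOL-Algebra.Ideal_Product"
begin

section \<open>The modules \<open>\<int>[\<xi>\<^sub>n]\<close>\<close>

definition xi :: "nat \<Rightarrow> complex" where
  "xi m = exp (2 * of_real pi * \<i> / of_nat m)"

definition cyclotomic_module :: "nat \<Rightarrow> complex set" where
  "cyclotomic_module n = range (\<lambda>p :: int poly. poly (map_poly of_int p) (xi n))"

definition cyclotomic_ring :: "nat \<Rightarrow> complex ring" where
  "cyclotomic_ring n = \<lparr>carrier = cyclotomic_module n, mult = (*), one = 1, zero = 0, add = (+)\<rparr>"

definition principal_ideal :: "nat \<Rightarrow> complex \<Rightarrow> complex set" where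
  "principal_ideal n q = PIdl\<^bsub>cyclotomic_ring n\<^esub> q"

text \<open>The cardinality is 0 if there are infinitely many cosets, that is, if \<open>q = 0\<close>.\<close>

definition ideal_index :: "nat \<Rightarrow> complex \<Rightarrow> nat" where
  "ideal_index n q = card (a_rcosets\<^bsub>cyclotomic_ring n\<^esub> (principal_ideal n q))"

definition splits_into :: "nat \<Rightarrow> complex \<Rightarrow> complex \<Rightarrow> complex \<Rightarrow> bool" where
  "splits_into n a q q' \<longleftrightarrow>
     q \<in> cyclotomic_module n \<and> q' \<in> cyclotomic_module n \<and>
     primeideal (principal_ideal n q) (cyclotomic_ring n) \<and>
     primeideal (principal_ideal n q') (cyclotomic_ring n) \<and>
     principal_ideal n q \<noteq> principal_ideal n q' \<and>
     principal_ideal n a = principal_ideal n q \<cdot>\<^bsub>cyclotomic_ring n\<^esub> principal_ideal n q'"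

text \<open>Being divisible by two different primes; in particular a proper power of one prime
  does not split.\<close>

definition splits :: "nat \<Rightarrow> complex \<Rightarrow> bool" where
  "splits n a \<longleftrightarrow>
     (\<exists>I J. primeideal I (cyclotomic_ring n) \<and> primeideal J (cyclotomic_ring n) \<and> I \<noteq> J \<and>
            a \<in> I \<and> a \<in> J)"


section \<open>Groups of symmetries\<close>

text \<open>Symmetries are represented as maps of the whole plane. Since the modules considered span
  the plane over the reals, such a map is determined by its restriction to the module.\<close>

abbreviation plane :: "(complex \<Rightarrow> complex) monoid" where
  "plane \<equiv> BijGroup UNIV"

definition rotation :: "nat \<Rightarrow> complex \<Rightarrow> complex" where
  "rotation k = (\<lambda>x. xi k * x)"

definition cyc :: "nat \<Rightarrow> (complex \<Rightarrow> complex) set" where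
  "cyc k = generate plane {rotation k}"

definition dih :: "nat \<Rightarrow> (complex \<Rightarrow> complex) set" where
  "dih k = generate plane {rotation k, cnj}"

definition translation_group :: "complex set \<Rightarrow> (complex \<Rightarrow> complex) set" where
  "translation_group A = {\<lambda>x. x + t | t. t \<in> A}"

definition module_symmetries :: "nat \<Rightarrow> (complex \<Rightarrow> complex) set" where
  "module_symmetries n = translation_group (cyclotomic_module n) <#>\<^bsub>plane\<^esub> dih (lcm 2 n)"

definition internal_semidirect :: "('a, 'b) monoid_scheme \<Rightarrow> 'a set \<Rightarrow> 'a set \<Rightarrow> 'a set \<Rightarrow> bool" where
  "internal_semidirect A K N P \<longleftrightarrow>
     subgroup K A \<and> N \<lhd> A\<lparr>carrier := K\<rparr> \<and> subgroup P (A\<lparr>carrier := K\<rparr>) \<and>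
     N \<inter> P = {\<one>\<^bsub>A\<^esub>} \<and> N <#>\<^bsub>A\<^esub> P = K"


section \<open>Bravais colourings\<close>

text \<open>The representatives \<open>t 2, \<dots>, t l\<close> enumerate the cosets other than \<open>(q)\<close> itself; the
  colours of points outside the module are irrelevant.\<close>

definition bravais_colouring :: "nat \<Rightarrow> complex \<Rightarrow> nat \<Rightarrow> (complex \<Rightarrow> nat) \<Rightarrow> bool" where
  "bravais_colouring n q l c \<longleftrightarrow>
     q \<in> cyclotomic_module n \<and> q \<noteq> 0 \<and> l = ideal_index n q \<and>
     (\<exists>t. t 1 = 0 \<and>
          bij_betw (\<lambda>i. principal_ideal n q +>\<^bsub>cyclotomic_ring n\<^esub> t i) {1..l}
                   (a_rcosets\<^bsub>cyclotomic_ring n\<^esub> (principal_ideal n q)) \<and>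
          (\<forall>i\<in>{1..l}. t i \<in> cyclotomic_module n \<and>
             (\<forall>z \<in> principal_ideal n q +>\<^bsub>cyclotomic_ring n\<^esub> t i. c z = i)))"

definition colour_symmetries :: "nat \<Rightarrow> nat \<Rightarrow> (complex \<Rightarrow> nat) \<Rightarrow> (complex \<Rightarrow> complex) set" where
  "colour_symmetries n l c =
     {h \<in> module_symmetries n.
        \<exists>\<pi>. \<pi> permutes {1..l} \<and> (\<forall>x \<in> cyclotomic_module n. c (h x) = \<pi> (c x))}"

definition colour_preserving :: "nat \<Rightarrow> nat \<Rightarrow> (complex \<Rightarrow> nat) \<Rightarrow> (complex \<Rightarrow> complex) set" where
  "colour_preserving n l c =
     {k \<in> colour_symmetries n l c. \<forall>x \<in> cyclotomic_module n. c (k x) = c x}"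

definition origin_fixing :: "nat \<Rightarrow> nat \<Rightarrow> (complex \<Rightarrow> nat) \<Rightarrow> (complex \<Rightarrow> complex) set" where
  "origin_fixing n l c = {k \<in> colour_preserving n l c. k 0 = 0}"

definition trivial_K :: "nat \<Rightarrow> complex \<Rightarrow> nat \<Rightarrow> (complex \<Rightarrow> nat) \<Rightarrow> bool" where
  "trivial_K n q l c \<longleftrightarrow> colour_preserving n l c = translation_group (principal_ideal n q)"

definition yields :: "nat \<Rightarrow> complex \<Rightarrow> nat \<Rightarrow> (complex \<Rightarrow> nat) \<Rightarrow> (complex \<Rightarrow> complex) set \<Rightarrow> bool" where
  "yields n q l c P \<longleftrightarrow>
     origin_fixing n l c = P \<and>
     internal_semidirect plane (colour_preserving n l c)
       (translation_group (principal_ideal n q)) (origin_fixing n l c)"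

definition induces_trivial :: "nat \<Rightarrow> complex \<Rightarrow> bool" where
  "induces_trivial n q \<longleftrightarrow>
     (\<exists>l c. bravais_colouring n q l c) \<and>
     (\<forall>l c. bravais_colouring n q l c \<longrightarrow> trivial_K n q l c)"

definition induces_group :: "nat \<Rightarrow> complex \<Rightarrow> (complex \<Rightarrow> complex) set \<Rightarrow> bool" where
  "induces_group n q P \<longleftrightarrow>
     (\<exists>l c. bravais_colouring n q l c) \<and>
     (\<forall>l c. bravais_colouring n q l c \<longrightarrow> yields n q l c P)"


section \<open>The table of exceptional numbers of colours\<close>

datatype entry =
    Entry nat "(complex \<Rightarrow> complex) set"  (infix \<open>\<rhd>\<close> 50)
  | Starred nat "(complex \<Rightarrow> complex) set"  (infix \<open>\<rhd>\<^sup>*\<close> 50)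

fun colours :: "entry \<Rightarrow> nat" where
  "colours (l \<rhd> P) = l"
| "colours (l \<rhd>\<^sup>* P) = l"

text \<open>
  Three lines differ from the printed source, where they are false:
  \<^item> \<open>n = 24\<close>: \<open>64 \<rhd> cyc 2\<close> is missing. The only prime \<open>P\<close> over 2 has norm 4 and
    \<open>(2) = P\<^sup>4\<close>, so rotation by \<open>\<pi>\<close> preserves the 64 colours induced by \<open>P\<^sup>3\<close>.
  \<^item> \<open>n = 36\<close>: \<open>81 \<rhd> cyc 3\<close> is missing. The only prime \<open>P\<close> over 3 has norm 9 and
    \<open>(1 - \<xi>\<^sub>3) = P\<^sup>3\<close>, so rotation by \<open>2\<pi>/3\<close> preserves the 81 colours induced by \<open>P\<^sup>2\<close>.
  \<^item> \<open>n = 33\<close>: the line for \<open>n = 27\<close> is repeated, but for its last entry. For \<open>n = 33\<close> the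
    relevant primes are one over 11 of norm \<open>11\<^sup>2\<close>, two over 3 of norm \<open>3\<^sup>5\<close> and two over 2 of
    norm \<open>2\<^sup>1\<^sup>0\<close>.
\<close>

definition exception_table :: "(nat \<times> entry list) list" where
  "exception_table = [
    (3, [3 \<rhd> dih 3, 4 \<rhd> cyc 2]),
    (4, [2 \<rhd> dih 4, 4 \<rhd> dih 2]),
    (5, [5 \<rhd> dih 5, 16 \<rhd> cyc 2]),
    (8, [2 \<rhd> dih 8, 4 \<rhd> dih 4, 8 \<rhd> cyc 2, 16 \<rhd> cyc 2]),
    (12, [4 \<rhd> cyc 4, 9 \<rhd> cyc 3, 16 \<rhd> cyc 2]),
    (7, [7 \<rhd> dih 7, 8 \<rhd> cyc 2, 64 \<rhd>\<^sup>* cyc 2]),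
    (9, [3 \<rhd> dih 9, 9 \<rhd> cyc 3, 27 \<rhd> cyc 3, 64 \<rhd> cyc 2]),
    (15, [16 \<rhd> cyc 2, 25 \<rhd> cyc 5, 81 \<rhd> cyc 3, 256 \<rhd>\<^sup>* cyc 2]),
    (16, [2 \<rhd> dih 16, 4 \<rhd> dih 8, 8 \<rhd> cyc 4, 16 \<rhd> cyc 4, 32 \<rhd> cyc 2,
      64 \<rhd> cyc 2, 128 \<rhd> cyc 2, 256 \<rhd> cyc 2]),
    (20, [5 \<rhd> cyc 5, 16 \<rhd> cyc 4, 25 \<rhd>\<^sup>* cyc 5, 256 \<rhd> cyc 2]),
    (24, [4 \<rhd> cyc 8, 9 \<rhd> cyc 3, 16 \<rhd> cyc 4, 64 \<rhd> cyc 2, 81 \<rhd>\<^sup>* cyc 3,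
      256 \<rhd> cyc 2]),
    (11, [11 \<rhd> dih 11, 1024 \<rhd> cyc 2]),
    (13, [13 \<rhd> dih 13, 4096 \<rhd> cyc 2]),
    (21, [7 \<rhd> cyc 7, 49 \<rhd>\<^sup>* cyc 7, 64 \<rhd> cyc 2, 729 \<rhd> cyc 3,
      4096 \<rhd>\<^sup>* cyc 2]),
    (28, [8 \<rhd> cyc 4, 49 \<rhd> cyc 7, 64 \<rhd>\<^sup>* cyc 4, 512 \<rhd>\<^sup>* cyc 2,
      4096 \<rhd>\<^sup>* cyc 2]),
    (36, [9 \<rhd> cyc 9, 64 \<rhd> cyc 4, 81 \<rhd> cyc 3, 729 \<rhd> cyc 3, 4096 \<rhd> cyc 2]),
    (17, [17 \<rhd> dih 17, 256 \<rhd> cyc 2, 65536 \<rhd>\<^sup>* cyc 2]),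
    (32, [2 \<rhd> dih 32, 4 \<rhd> dih 16, 8 \<rhd> cyc 8, 16 \<rhd> cyc 8, 32 \<rhd> cyc 4,
      64 \<rhd> cyc 4, 128 \<rhd> cyc 4, 256 \<rhd> cyc 4, 512 \<rhd> cyc 2,
      1024 \<rhd> cyc 2, 2048 \<rhd> cyc 2, 4096 \<rhd> cyc 2, 8192 \<rhd> cyc 2,
      16384 \<rhd> cyc 2, 32768 \<rhd> cyc 2, 65536 \<rhd> cyc 2]),
    (40, [16 \<rhd> cyc 8, 25 \<rhd> cyc 5, 256 \<rhd> cyc 4, 625 \<rhd>\<^sup>* cyc 5,
      4096 \<rhd> cyc 2, 65536 \<rhd> cyc 2]),
    (48, [4 \<rhd> cyc 16, 16 \<rhd> cyc 8, 64 \<rhd> cyc 4, 81 \<rhd> cyc 3, 256 \<rhd> cyc 4,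
      6561 \<rhd>\<^sup>* cyc 3, 1024 \<rhd> cyc 2, 4096 \<rhd> cyc 2, 16384 \<rhd> cyc 2,
      65536 \<rhd> cyc 2]),
    (60, [16 \<rhd> cyc 4, 25 \<rhd> cyc 5, 81 \<rhd> cyc 3, 256 \<rhd>\<^sup>* cyc 4,
      625 \<rhd>\<^sup>* cyc 5, 4096 \<rhd>\<^sup>* cyc 2, 6561 \<rhd>\<^sup>* cyc 3,
      65536 \<rhd>\<^sup>* cyc 2]),
    (19, [19 \<rhd> dih 19, 262144 \<rhd> cyc 2]),
    (27, [3 \<rhd> dih 27, 9 \<rhd> cyc 9, 27 \<rhd> cyc 9, 81 \<rhd> cyc 3, 243 \<rhd> cyc 3,
      729 \<rhd> cyc 3, 2187 \<rhd> cyc 3, 6561 \<rhd> cyc 3, 19683 \<rhd> cyc 3,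
      262144 \<rhd> cyc 2]),
    (25, [5 \<rhd> dih 25, 25 \<rhd> cyc 5, 125 \<rhd> cyc 5, 625 \<rhd> cyc 5, 3125 \<rhd> cyc 5,
      1048576 \<rhd> cyc 2]),
    (33, [121 \<rhd> cyc 11, 243 \<rhd> cyc 3, 1024 \<rhd> cyc 2, 59049 \<rhd>\<^sup>* cyc 3,
      1048576 \<rhd>\<^sup>* cyc 2]),
    (44, [121 \<rhd> cyc 11, 1024 \<rhd> cyc 4, 1048576 \<rhd> cyc 2]),
    (35, [2401 \<rhd> cyc 7, 4096 \<rhd> cyc 2, 15625 \<rhd> cyc 5, 16777216 \<rhd>\<^sup>* cyc 2]),
    (45, [81 \<rhd> cyc 9, 4096 \<rhd> cyc 2, 6561 \<rhd> cyc 3, 15625 \<rhd> cyc 5,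
      531441 \<rhd> cyc 3, 16777216 \<rhd>\<^sup>* cyc 2]),
    (84, [49 \<rhd> cyc 7, 64 \<rhd> cyc 4, 729 \<rhd> cyc 3, 2401 \<rhd>\<^sup>* cyc 7,
      4096 \<rhd>\<^sup>* cyc 4, 531441 \<rhd>\<^sup>* cyc 3, 262144 \<rhd>\<^sup>* cyc 2,
      16777216 \<rhd>\<^sup>* cyc 2])]"

definition entries :: "nat \<Rightarrow> entry set" where
  "entries n = {e. \<exists>es. (n, es) \<in> set exception_table \<and> e \<in> set es}"

text \<open>
  For a starred number of colours, the following \<open>q\<close> may induce a colouring that does not
  follow the entry. Since \<open>splits_into\<close> is symmetric in its last two arguments, \<open>r\<close> stands for
  either of the two prime factors.
\<close>

definition specified_deviation :: "nat \<Rightarrow> complex \<Rightarrow> bool" where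
  "specified_deviation n q \<longleftrightarrow>
     (n \<in> {7,15,17,21,33,35,45} \<and>
       (\<exists>r r'. splits_into n 2 r r' \<and> principal_ideal n q = principal_ideal n (r ^ 2))) \<or>
     (\<exists>p\<in>{3,5,7}. p dvd n \<and>
       (\<exists>r r'. splits_into n (1 - xi p) r r' \<and> principal_ideal n q = principal_ideal n (r ^ 2))) \<or>
     (n \<in> {28,60,84} \<and>
       (\<exists>r r'. splits_into n (1 - xi 4) r r' \<and>
         (\<exists>(i, j) \<in> {(2,0), (4,0), (2,1), (3,0)}.
            principal_ideal n q = principal_ideal n (r ^ i * (1 - xi 4) ^ j))))"

definition triples_C4 :: "nat \<Rightarrow> (nat \<times> nat \<times> nat) set" where
  "triples_C4 n = {(0, 1, 2 ^ (totient n div 2)), (1, 0, 2 ^ (totient n div 4))}"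

definition triples_C2 :: "nat \<Rightarrow> (nat \<times> nat \<times> nat) set" where
  "triples_C2 n =
     {(0, 2, 2 ^ totient n), (2, 0, 2 ^ (totient n div 2)), (1, 1, 2 ^ (3 * totient n div 4))}"

definition triples_trivial :: "nat \<Rightarrow> (nat \<times> nat \<times> nat) set" where
  "triples_trivial n =
     {(4, 0, 2 ^ totient n), (2, 1, 2 ^ totient n), (3, 0, 2 ^ (3 * totient n div 4))}"

end

theory Submission
  imports
    Defs
    "Jordan_Normal_Form.Char_Poly"
    "HOL-Algebra.Sylow"
    "HOL-Algebra.QuotRing"
    "HOL-Algebra.Multiplicative_Group"
begin

text \<open>
  Write \<open>M\<close> for \<open>\<int>[\<xi>\<^sub>n]\<close> and \<open>N\<close> for \<open>lcm 2 n\<close>. A symmetry \<open>x \<mapsto> z x + t\<close> moves every point of \<open>M\<close> by a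
  multiple of \<open>q\<close> just if \<open>t \<in> (q)\<close> and \<open>q\<close> divides \<open>1 - z\<close>; for \<open>x \<mapsto> z cnj x + t\<close>, \<open>q\<close> must also divide
  \<open>1 - \<xi>\<^sub>n\<^sup>2\<close>. So \<open>K\<close> is determined by the group of those \<open>N\<close>-th roots of unity that are congruent to 1
  modulo \<open>q\<close>. If these are the \<open>k\<close>-th roots of unity, then \<open>P\<^sub>n\<close> is \<open>D\<^sub>k\<close> if \<open>n\<close> divides \<open>2 k\<close>, and \<open>C\<^sub>k\<close>
  otherwise (\<open>yields_point_group\<close>). The theorem is thereby one about the factorizations of the \<open>1 - z\<close>.

  If \<open>K\<close> is not trivial, then \<open>q\<close> divides \<open>1 - \<xi>\<^sub>p\<close> for some prime number \<open>p\<close> dividing \<open>N\<close>. Let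
  \<open>N = p\<^sup>a m\<close> with \<open>m\<close> prime to \<open>p\<close>, let \<open>f\<close> be the order of \<open>p\<close> modulo \<open>m\<close> and \<open>lam = 1 - \<xi>\<^bsub>p^a\<^esub>\<close>. Then
  \<open>1 - \<xi>\<^bsub>p^s\<^esub>\<close> is an associate of \<open>lam\<close> to the power \<open>p\<^bsup>a-s\<^esup>\<close> (\<open>one_minus_xi_prime_power\<close>), and \<open>lam\<close> is
  factored by counting residues. On the one hand, the index of \<open>(lam)\<close> is at most \<open>p\<^bsup>\<phi>(m)\<^esup>\<close>, since modulo
  \<open>lam\<close> the ring is generated, as an additive group, by \<open>\<phi>(m)\<close> of the \<open>m\<close>-th roots of unity
  (\<open>module_index_lam\<close>). On the other hand, the index of a proper ideal containing \<open>lam\<close> is at least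
  \<open>p\<^sup>f\<close>: it is a power of \<open>p\<close>, and congruent to 1 modulo \<open>m\<close> because multiplication by \<open>\<xi>\<^sub>m\<close> acts freely
  on the non-zero residues (\<open>ideal_index_ge\<close>). Hence \<open>lam\<close> is prime if \<open>f = \<phi>(m)\<close>; and if \<open>2 f = \<phi>(m)\<close>,
  any two non-units \<open>r\<close>, \<open>r'\<close> such that \<open>r r'\<close> is an associate of \<open>lam\<close> are distinct primes of norm \<open>p\<^sup>f\<close>.
  For the \<open>n\<close> considered one of these two cases always applies, and \<open>r\<close>, \<open>r'\<close> are obtained from twelve
  explicit factorizations in small subfields.

  An element whose norm is a power of \<open>p\<close> is then an associate of \<open>lam\<^sup>J\<close>, or of \<open>r\<^sup>i r'\<^sup>j\<close> with \<open>i + j = J\<close>,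
  and has norm \<open>p\<^bsup>fJ\<^esup>\<close>. The roots of unity congruent to 1 modulo it are the \<open>p\<^sup>s\<close>-th ones for the largest
  \<open>s\<close> such that \<open>J\<close>, or \<open>max i j\<close>, does not exceed \<open>p\<^bsup>a-s\<^esup>\<close>, and only 1 if there is no such \<open>s > 0\<close>. It
  remains to compare with the table
  (\<open>entries_eq_table_line\<close>). The starred entries are those for which \<open>J \<ge> 2\<close> and there are two primes; the
  exponents \<open>i\<close> and \<open>j\<close> may then be unbalanced, which accounts for the deviations.
\<close>

section \<open>Roots of unity\<close>

lemma xi_power: "xi m ^ j = cis (2 * pi * of_nat j / of_nat m)"
proof -
  have "xi m = cis (2 * pi / of_nat m)"
    by (simp add: xi_def cis_conv_exp mult_ac)
  then show ?thesis by (simp add: DeMoivre mult_ac)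
qed

lemma xi_power_self: "m > 0 \<Longrightarrow> xi m ^ m = 1"
  by (simp add: xi_power)

lemma xi_mult_power: "a > 0 \<Longrightarrow> xi (a * b) ^ a = xi b"
  using xi_power[of "a * b" a] xi_power[of b 1] by simp

lemma xi_power_eq_1_iff:
  assumes "m > 0"
  shows "xi m ^ j = 1 \<longleftrightarrow> m dvd j"
proof
  assume "m dvd j"
  then show "xi m ^ j = 1"
    using assms by (auto simp: power_mult xi_power_self)
next
  assume "xi m ^ j = 1"
  then have "xi m ^ (j mod m) = 1"
    by (metis assms mult_1 mult_div_mod_eq power_add power_mult power_one xi_power_self)
  then have "cis (2 * pi * real (j mod m) / real m) = cis (2 * pi * real 0 / real m)"
    by (simp add: xi_power)
  then have "j mod m = 0"
    using bij_betw_imp_inj_on[OF bij_betw_roots_unity[OF assms]] assms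
    by (elim inj_onD) auto
  then show "m dvd j" by auto
qed

lemma root_of_unity_is_power:
  assumes "m > 0" "z ^ m = 1"
  shows "\<exists>j<m. z = xi m ^ j"
  using bij_betw_imp_surj_on[OF bij_betw_roots_unity[OF assms(1)]] assms(2)
  by (force simp: xi_power)

lemma cnj_root_of_unity:
  assumes "m > 0" "z ^ m = 1"
  shows "cnj z = z ^ (m - 1)" and "z * cnj z = 1"
proof -
  have "norm z = 1" using power_eq_1_iff[OF assms(2)] assms(1) by simp
  then show 1: "z * cnj z = 1" using complex_norm_square[of z] by simp
  have 2: "z ^ (m - 1) * z = 1" using power_minus_mult[of m z] assms by simp
  have "cnj z = (z ^ (m - 1) * z) * cnj z" using 2 by simp
  also have "\<dots> = z ^ (m - 1)" using 1 by (simp add: mult.assoc)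
  finally show "cnj z = z ^ (m - 1)" .
qed

lemma xi_2: "xi 2 = -1" and xi_4: "xi 4 = \<i>"
  using xi_power[of 2 1] xi_power[of 4 1]
  by (simp_all add: cis.ctr complex_eq_iff)

lemma root_of_unity_sum_0:
  fixes z :: complex
  assumes "z ^ m = 1" "z \<noteq> 1"
  shows "(\<Sum>i<m. z ^ i) = 0"
  using assms by (simp add: geometric_sum)

lemma root_of_unity_power_mod:
  fixes z :: "'a :: monoid_mult"
  assumes "z ^ m = 1"
  shows "z ^ (k mod m) = z ^ k"
proof -
  have "z ^ k = z ^ (m * (k div m) + k mod m)" by simp
  also have "\<dots> = z ^ (k mod m)" unfolding power_add power_mult assms by simp
  finally show ?thesis by simp
qed

text \<open>\<open>\<xi>\<^bsub>ab\<^esub> = \<xi>\<^bsub>ab\<^esub>\<^bsup>x+y\<^esup>\<close> for a multiple \<open>x\<close> of \<open>a\<close> and a multiple \<open>y\<close> of \<open>b\<close> with \<open>x + y \<equiv> 1\<close>.\<close>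

lemma xi_coprime_product:
  assumes "coprime a b" "a > 0" "b > 0"
  shows "\<exists>u v. xi (a * b) = xi a ^ u * xi b ^ v"
proof -
  obtain x y where xy: "[x = 0] (mod a)" "[x = 1] (mod b)" "[y = 1] (mod a)" "[y = 0] (mod b)"
    using binary_chinese_remainder_nat[OF assms(1)] by blast
  then obtain v u where v: "x = a * v" and u: "y = b * u"
    by (auto simp: cong_0_iff elim!: dvdE)
  have "[x + y = 1] (mod a)" "[x + y = 1] (mod b)"
    using cong_add[OF xy(1) xy(3)] cong_add[OF xy(2) xy(4)] by simp_all
  then have "[x + y = 1] (mod (a * b))"
    using assms(1) by (simp add: coprime_cong_mult_nat)
  moreover have "xi (a * b) ^ (a * b) = 1"
    using assms by (simp add: xi_power_self)
  ultimately have "xi (a * b) ^ (x + y) = xi (a * b) ^ 1"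
    by (metis cong_def root_of_unity_power_mod)
  moreover have "xi (a * b) ^ (x + y) = (xi (b * a) ^ b) ^ u * (xi (a * b) ^ a) ^ v"
    by (simp add: power_add u v power_mult mult.commute)
  ultimately have "xi (a * b) = xi a ^ u * xi b ^ v"
    using assms by (simp add: xi_mult_power)
  then show ?thesis by blast
qed


section \<open>The ring \<open>\<int>[\<xi>\<^sub>n]\<close> and divisibility\<close>

lemma in_module_iff: "z \<in> cyclotomic_module n \<longleftrightarrow> (\<exists>p. z = poly (of_int_poly p) (xi n))"
  by (auto simp: cyclotomic_module_def)

lemma module_of_int [simp]: "of_int k \<in> cyclotomic_module n"
  unfolding in_module_iff by (rule exI[of _ "[:k:]"]) (simp add: of_int_hom.map_poly_pCons_hom)

lemma module_0 [simp]: "0 \<in> cyclotomic_module n"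
  and module_1 [simp]: "1 \<in> cyclotomic_module n"
  and module_of_nat [simp]: "of_nat j \<in> cyclotomic_module n"
  and module_numeral [simp]: "numeral w \<in> cyclotomic_module n"
  using module_of_int[of 0 n] module_of_int[of 1 n] module_of_int[of "int j" n]
    module_of_int[of "numeral w" n] by simp_all

lemma module_add [simp]: "x \<in> cyclotomic_module n \<Longrightarrow> y \<in> cyclotomic_module n \<Longrightarrow>
    x + y \<in> cyclotomic_module n"
  unfolding in_module_iff by (metis of_int_poly_hom.hom_add poly_add)

lemma module_mult [simp]: "x \<in> cyclotomic_module n \<Longrightarrow> y \<in> cyclotomic_module n \<Longrightarrow>
    x * y \<in> cyclotomic_module n"
  unfolding in_module_iff by (metis of_int_poly_hom.hom_mult poly_mult)

lemma module_uminus [simp]: "x \<in> cyclotomic_module n \<Longrightarrow> - x \<in> cyclotomic_module n"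
  using module_mult[of "of_int (-1)" n x] module_of_int by fastforce

lemma module_diff [simp]: "x \<in> cyclotomic_module n \<Longrightarrow> y \<in> cyclotomic_module n \<Longrightarrow>
    x - y \<in> cyclotomic_module n"
  using module_add[of x n "- y"] by simp

lemma module_power [simp]: "x \<in> cyclotomic_module n \<Longrightarrow> x ^ k \<in> cyclotomic_module n"
  by (induction k) auto

lemma module_sum: "(\<And>i. i \<in> A \<Longrightarrow> f i \<in> cyclotomic_module n) \<Longrightarrow> sum f A \<in> cyclotomic_module n"
  by (induction A rule: infinite_finite_induct) auto

lemma module_xi_self [simp]: "xi n \<in> cyclotomic_module n"
  unfolding in_module_iff by (rule exI[of _ "[:0, 1:]"]) simp

lemma module_induct [consumes 1, case_names of_int xi add mult]:
  assumes "z \<in> cyclotomic_module n" and "\<And>k. P (of_int k)" "P (xi n)"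
    "\<And>x y. x \<in> cyclotomic_module n \<Longrightarrow> y \<in> cyclotomic_module n \<Longrightarrow> P x \<Longrightarrow> P y \<Longrightarrow> P (x + y)"
    "\<And>x y. x \<in> cyclotomic_module n \<Longrightarrow> y \<in> cyclotomic_module n \<Longrightarrow> P x \<Longrightarrow> P y \<Longrightarrow> P (x * y)"
  shows "P z"
proof -
  obtain p where z: "z = poly (of_int_poly p) (xi n)" using assms(1) in_module_iff by auto
  have "P (poly (of_int_poly p) (xi n))"
  proof (induction p)
    case 0
    then show ?case using assms(2)[of 0] by simp
  next
    case (pCons a p)
    have "poly (of_int_poly p) (xi n) \<in> cyclotomic_module n" using in_module_iff by auto
    then show ?case using pCons assms(2-5) by (simp add: of_int_hom.map_poly_pCons_hom)
  qed
  then show ?thesis using z by simp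
qed

text \<open>For odd \<open>n\<close>, \<open>-\<xi>\<^sub>n\<close> generates the \<open>2 n\<close>-th roots of unity.\<close>

lemma module_xi:
  assumes "n > 0" "d dvd lcm 2 n"
  shows "xi d \<in> cyclotomic_module n"
proof -
  have "xi (lcm 2 n) \<in> cyclotomic_module n"
  proof (cases "even n")
    case True
    then show ?thesis by (simp add: lcm_proj2_if_dvd)
  next
    case False
    then obtain k where k: "n = 2 * k + 1" by (auto elim: oddE)
    have "lcm 2 n = 2 * n" using False by (simp add: lcm_coprime)
    moreover have "xi (2 * n) = - (xi n ^ (k + 1))"
    proof -
      have "2 * pi * of_nat (k + 1) / real n = pi + 2 * pi * of_nat 1 / real (2 * n)"
        using assms(1) k by (simp add: field_simps)
      then have "xi n ^ (k + 1) = cis pi * xi (2 * n) ^ 1"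
        unfolding xi_power cis_mult by simp
      then show ?thesis by simp
    qed
    ultimately show ?thesis by simp
  qed
  moreover obtain e where "lcm 2 n = e * d" using assms(2) by (metis dvdE mult.commute)
  ultimately show ?thesis using assms(1) xi_mult_power[of e d]
    by (metis lcm_eq_0_iff module_power mult_is_0 neq0_conv zero_neq_numeral)
qed

lemma module_cnj:
  assumes "n > 0" "z \<in> cyclotomic_module n"
  shows "cnj z \<in> cyclotomic_module n"
  using assms(2)
proof (induction rule: module_induct)
  case xi
  then show ?case using cnj_root_of_unity(1)[OF assms(1) xi_power_self[OF assms(1)]] by simp
qed auto

lemma carrier_cyclotomic_ring [simp]:
  "carrier (cyclotomic_ring n) = cyclotomic_module n"
  "x \<otimes>\<^bsub>cyclotomic_ring n\<^esub> y = x * y" "x \<oplus>\<^bsub>cyclotomic_ring n\<^esub> y = x + y"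
  "\<one>\<^bsub>cyclotomic_ring n\<^esub> = 1" "\<zero>\<^bsub>cyclotomic_ring n\<^esub> = 0"
  by (simp_all add: cyclotomic_ring_def)

lemma cring_cyclotomic_ring: "cring (cyclotomic_ring n)"
proof (rule cringI)
  show "abelian_group (cyclotomic_ring n)"
    by (rule abelian_groupI) (auto simp: add_ac intro!: bexI[of _ "- _"])
  show "Group.comm_monoid (cyclotomic_ring n)"
    by (rule comm_monoidI) (auto simp: mult_ac)
qed (auto simp: algebra_simps)

lemma in_principal_ideal_iff:
  "b \<in> principal_ideal n a \<longleftrightarrow> (\<exists>x\<in>cyclotomic_module n. b = a * x)"
  by (auto simp: principal_ideal_def cgenideal_def mult.commute)

lemma ideal_principal: "a \<in> cyclotomic_module n \<Longrightarrow> ideal (principal_ideal n a) (cyclotomic_ring n)"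
  unfolding principal_ideal_def
  by (rule cring.cgenideal_ideal[OF cring_cyclotomic_ring]) simp

lemma principal_ideal_refl [simp]: "a \<in> principal_ideal n a"
  by (auto simp: in_principal_ideal_iff intro: bexI[of _ 1])

lemma principal_idealI: "x \<in> cyclotomic_module n \<Longrightarrow> b = a * x \<Longrightarrow> b \<in> principal_ideal n a"
  by (auto simp: in_principal_ideal_iff)

lemma principal_ideal_trans:
  "c \<in> principal_ideal n b \<Longrightarrow> b \<in> principal_ideal n a \<Longrightarrow> c \<in> principal_ideal n a"
  by (auto simp: in_principal_ideal_iff mult.assoc)

lemma principal_ideal_eq_iff:
  "principal_ideal n a = principal_ideal n b \<longleftrightarrow> a \<in> principal_ideal n b \<and> b \<in> principal_ideal n a"
  using principal_ideal_trans principal_ideal_refl by blast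

lemma principal_ideal_mult_mono:
  "a \<in> principal_ideal n c \<Longrightarrow> b \<in> principal_ideal n d \<Longrightarrow> a * b \<in> principal_ideal n (c * d)"
  unfolding in_principal_ideal_iff by (metis module_mult mult.assoc mult.left_commute)

lemma principal_ideal_power_mono:
  "a \<in> principal_ideal n c \<Longrightarrow> a ^ k \<in> principal_ideal n (c ^ k)"
  by (induction k) (auto intro: principal_ideal_mult_mono)

lemma principal_ideal_le_power: "a \<in> cyclotomic_module n \<Longrightarrow> i \<le> j \<Longrightarrow> a ^ j \<in> principal_ideal n (a ^ i)"
  by (auto intro!: principal_idealI[of "a ^ (j - i)"] simp flip: power_add)

lemma principal_ideal_cancel:
  "c \<noteq> 0 \<Longrightarrow> c * a \<in> principal_ideal n (c * b) \<longleftrightarrow> a \<in> principal_ideal n b"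
  by (auto simp: in_principal_ideal_iff mult.assoc)

lemma ideal_closed:
  assumes "ideal I (cyclotomic_ring n)"
  shows "I \<subseteq> cyclotomic_module n" "0 \<in> I"
    "x \<in> I \<Longrightarrow> y \<in> I \<Longrightarrow> x + y \<in> I" "x \<in> I \<Longrightarrow> y \<in> I \<Longrightarrow> x - y \<in> I"
    "x \<in> I \<Longrightarrow> y \<in> cyclotomic_module n \<Longrightarrow> x * y \<in> I"
    "x \<in> I \<Longrightarrow> y \<in> cyclotomic_module n \<Longrightarrow> y * x \<in> I" "x \<in> I \<Longrightarrow> - x \<in> I"
proof -
  interpret ideal I "cyclotomic_ring n" by fact
  show sub: "I \<subseteq> cyclotomic_module n" using a_subset by simp
  show "0 \<in> I" using additive_subgroup.zero_closed[OF is_additive_subgroup] by simp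
  show add: "x + y \<in> I" if "x \<in> I" "y \<in> I" for x y
    using additive_subgroup.a_closed[OF is_additive_subgroup that] by simp
  show mult: "y * x \<in> I" if "x \<in> I" "y \<in> cyclotomic_module n" for x y
    using I_l_closed that by auto
  then show "x * y \<in> I" if "x \<in> I" "y \<in> cyclotomic_module n" for x y
    using that by (simp add: mult.commute)
  have um: "- x \<in> I" if "x \<in> I" for x
    using mult[OF that, of "-1"] by simp
  then show "x \<in> I \<Longrightarrow> - x \<in> I" .
  show "x - y \<in> I" if "x \<in> I" "y \<in> I" using add[OF that(1) um[OF that(2)]] by simp
qed

lemma ideal_sum:
  assumes "ideal I (cyclotomic_ring n)" "\<And>i. i \<in> A \<Longrightarrow> f i \<in> I"
  shows "sum f A \<in> I"
  using assms(2) by (induction A rule: infinite_finite_induct) (auto intro: ideal_closed(2,3)[OF assms(1)])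

lemma proper_ideal_iff: 
  assumes "ideal I (cyclotomic_ring n)"
  shows "I = cyclotomic_module n \<longleftrightarrow> 1 \<in> I"
  using ideal_closed[OF assms] by (metis module_1 mult_1 subsetI subset_antisym)

lemma ideal_prod_principal:
  assumes "a \<in> cyclotomic_module n" "b \<in> cyclotomic_module n"
  shows "principal_ideal n a \<cdot>\<^bsub>cyclotomic_ring n\<^esub> principal_ideal n b = principal_ideal n (a * b)"
proof
  show "principal_ideal n a \<cdot>\<^bsub>cyclotomic_ring n\<^esub> principal_ideal n b \<subseteq> principal_ideal n (a * b)"
  proof
    fix z assume "z \<in> principal_ideal n a \<cdot>\<^bsub>cyclotomic_ring n\<^esub> principal_ideal n b"
    then show "z \<in> principal_ideal n (a * b)"
    proof (induction rule: ideal_prod.induct)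
      case (prod i j)
      then show ?case using principal_ideal_mult_mono by simp
    next
      case (sum s1 s2)
      then show ?case using ideal_closed(3)[OF ideal_principal, of "a * b"] assms by simp
    qed
  qed
  show "principal_ideal n (a * b) \<subseteq> principal_ideal n a \<cdot>\<^bsub>cyclotomic_ring n\<^esub> principal_ideal n b"
  proof
    fix z assume "z \<in> principal_ideal n (a * b)"
    then obtain x where x: "x \<in> cyclotomic_module n" "z = a * (b * x)"
      by (auto simp: in_principal_ideal_iff mult.assoc)
    then show "z \<in> principal_ideal n a \<cdot>\<^bsub>cyclotomic_ring n\<^esub> principal_ideal n b"
      using ideal_prod.prod[of a "principal_ideal n a" "b * x" "principal_ideal n b" "cyclotomic_ring n"]
      by (auto intro: principal_idealI)
  qed
qed

section \<open>The index of an ideal\<close>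

definition residue_class :: "nat \<Rightarrow> complex set \<Rightarrow> complex \<Rightarrow> complex set" where
  "residue_class n I x = {y \<in> cyclotomic_module n. y - x \<in> I}"

definition module_index :: "nat \<Rightarrow> complex set \<Rightarrow> nat" where
  "module_index n I = card (residue_class n I ` cyclotomic_module n)"

lemma a_r_coset_eq_residue_class:
  assumes "ideal I (cyclotomic_ring n)" "x \<in> cyclotomic_module n"
  shows "I +>\<^bsub>cyclotomic_ring n\<^esub> x = residue_class n I x"
proof -
  have "y = y - x + x" for y by simp
  then show ?thesis
    using ideal_closed[OF assms(1)] assms(2)
    unfolding residue_class_def a_r_coset_def' by (auto intro!: bexI[of _ "_ - x"])
qed

lemma a_rcosets_eq_residue_classes:
  assumes "ideal I (cyclotomic_ring n)"
  shows "a_rcosets\<^bsub>cyclotomic_ring n\<^esub> I = residue_class n I ` cyclotomic_module n"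
  unfolding A_RCOSETS_def' using a_r_coset_eq_residue_class[OF assms] by auto

lemma ideal_index_eq_module_index:
  "q \<in> cyclotomic_module n \<Longrightarrow> ideal_index n q = module_index n (principal_ideal n q)"
  by (simp add: ideal_index_def module_index_def a_rcosets_eq_residue_classes ideal_principal)

lemma residue_class_eq_iff:
  assumes "ideal I (cyclotomic_ring n)" "x \<in> cyclotomic_module n" "y \<in> cyclotomic_module n"
  shows "residue_class n I x = residue_class n I y \<longleftrightarrow> x - y \<in> I"
proof
  assume "residue_class n I x = residue_class n I y"
  moreover have "x \<in> residue_class n I x"
    using assms ideal_closed(2)[OF assms(1)] by (simp add: residue_class_def)
  ultimately show "x - y \<in> I" by (auto simp: residue_class_def)
next
  assume xy: "x - y \<in> I"
  have "z - x \<in> I \<longleftrightarrow> z - y \<in> I" for z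
    using ideal_closed(3)[OF assms(1) _ xy, of "z - x"] ideal_closed(4)[OF assms(1) _ xy, of "z - y"]
    by auto
  then show "residue_class n I x = residue_class n I y" by (simp add: residue_class_def)
qed

lemma module_index_pos_iff:
  "0 < module_index n I \<longleftrightarrow> finite (residue_class n I ` cyclotomic_module n)"
  unfolding module_index_def by (metis card_gt_0_iff empty_iff image_is_empty module_0)

lemma obtain_transversal:
  obtains S where "S \<subseteq> cyclotomic_module n" "inj_on (residue_class n I) S"
    "residue_class n I ` S = residue_class n I ` cyclotomic_module n"
  by (metis subset_image_inj subset_refl)

text \<open>The residue classes modulo \<open>I\<close> map onto those modulo \<open>J\<close>; if the map is injective, the class of an
  element of \<open>J\<close> modulo \<open>I\<close> is that of 0.\<close>

lemma module_index_mono: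
  assumes I: "ideal I (cyclotomic_ring n)" and J: "ideal J (cyclotomic_ring n)" and "I \<subseteq> J"
    and fin: "0 < module_index n I"
  shows "0 < module_index n J" "module_index n J \<le> module_index n I"
    and "module_index n J = module_index n I \<Longrightarrow> I = J"
proof -
  let ?M = "cyclotomic_module n" and ?I = "residue_class n I" and ?J = "residue_class n J"
  define f where "f C = ?J (SOME x. x \<in> ?M \<and> C = ?I x)" for C
  have f: "f (?I x) = ?J x" if x: "x \<in> ?M" for x
  proof -
    have "\<exists>y. y \<in> ?M \<and> ?I x = ?I y" using x by blast
    from someI_ex[OF this] obtain y where
      y: "y \<in> ?M" "?I x = ?I y" "f (?I x) = ?J y" unfolding f_def by blast
    then have "y - x \<in> I" using x residue_class_eq_iff[OF I] by metis
    then show ?thesis using \<open>I \<subseteq> J\<close> x y residue_class_eq_iff[OF J] by auto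
  qed
  have im: "?J ` ?M = f ` (?I ` ?M)"
    using f by (auto simp: image_image)
  have fin: "finite (?I ` ?M)" using fin by (simp add: module_index_pos_iff)
  then show "0 < module_index n J" using im by (simp add: module_index_pos_iff)
  show "module_index n J \<le> module_index n I"
    unfolding module_index_def im using fin by (rule card_image_le)
  show "I = J" if "module_index n J = module_index n I"
  proof
    have inj: "inj_on f (?I ` ?M)"
      using that fin im by (intro eq_card_imp_inj_on) (simp_all add: module_index_def)
    show "J \<subseteq> I"
    proof
      fix x assume x: "x \<in> J"
      then have xM: "x \<in> ?M" using ideal_closed(1)[OF J] by auto
      have "f (?I x) = f (?I 0)"
        using x xM by (simp add: f residue_class_eq_iff[OF J])
      then have "?I x = ?I 0" using inj xM by (auto dest: inj_onD)
      then show "x \<in> I" using xM by (simp add: residue_class_eq_iff[OF I])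
    qed
  qed fact
qed

lemma module_index_1_iff:
  assumes I: "ideal I (cyclotomic_ring n)"
  shows "module_index n I = 1 \<longleftrightarrow> 1 \<in> I"
proof
  assume "module_index n I = 1"
  then obtain C where "residue_class n I ` cyclotomic_module n = {C}"
    by (auto simp: module_index_def card_1_singleton_iff)
  then have "residue_class n I 1 = residue_class n I 0" by (metis image_eqI module_0 module_1 singletonD)
  then show "1 \<in> I" by (simp add: residue_class_eq_iff[OF I])
next
  assume "1 \<in> I"
  then have "I = cyclotomic_module n" using proper_ideal_iff[OF I] by simp
  then have "residue_class n I x = cyclotomic_module n" if "x \<in> cyclotomic_module n" for x
    using that by (auto simp: residue_class_def)
  then have "residue_class n I ` cyclotomic_module n = {cyclotomic_module n}"
    using module_0[of n] by blast
  then show "module_index n I = 1" by (simp add: module_index_def)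
qed

text \<open>The residues modulo \<open>a b\<close> are the \<open>r + a s\<close> for residues \<open>r\<close> modulo \<open>a\<close> and \<open>s\<close> modulo \<open>b\<close>.\<close>

lemma module_index_mult:
  assumes a: "a \<in> cyclotomic_module n" "a \<noteq> 0" and b: "b \<in> cyclotomic_module n"
    and pos: "0 < module_index n (principal_ideal n a)" "0 < module_index n (principal_ideal n b)"
  shows "module_index n (principal_ideal n (a * b)) =
         module_index n (principal_ideal n a) * module_index n (principal_ideal n b)"
proof -
  let ?M = "cyclotomic_module n" and ?P = "principal_ideal n"
  let ?A = "residue_class n (?P a)" and ?B = "residue_class n (?P b)"
    and ?C = "residue_class n (?P (a * b))"
  note iff = residue_class_eq_iff[OF ideal_principal]
  have ab: "a * b \<in> ?M" using a b by simp
  obtain S where S: "S \<subseteq> ?M" "inj_on ?A S" "?A ` S = ?A ` ?M" by (rule obtain_transversal)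
  obtain T where T: "T \<subseteq> ?M" "inj_on ?B T" "?B ` T = ?B ` ?M" by (rule obtain_transversal)
  have "bij_betw (\<lambda>(r, s). ?C (r + a * s)) (S \<times> T) (?C ` ?M)"
    unfolding bij_betw_def
  proof
    show "inj_on (\<lambda>(r, s). ?C (r + a * s)) (S \<times> T)"
    proof (rule inj_onI, clarify)
      fix r s r' s' assume el: "r \<in> S" "s \<in> T" "r' \<in> S" "s' \<in> T"
        and eq: "?C (r + a * s) = ?C (r' + a * s')"
      have M: "r \<in> ?M" "s \<in> ?M" "r' \<in> ?M" "s' \<in> ?M" using el S T by auto
      have "(r + a * s) - (r' + a * s') \<in> ?P (a * b)"
        using eq M a ab by (subst (asm) iff) auto
      then obtain x where x: "x \<in> ?M" "(r + a * s) - (r' + a * s') = a * b * x"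
        by (auto simp: in_principal_ideal_iff)
      have "r - r' = a * (b * x - s + s')" using x(2) by (simp add: algebra_simps)
      then have "r - r' \<in> ?P a" using M x b by (intro principal_idealI[of "b * x - s + s'"]) simp_all
      then have "?A r = ?A r'" using M a by (subst iff) auto
      then have rr: "r = r'" using el S by (auto dest: inj_onD)
      then have "a * (s - s') = a * (b * x)" using x(2) by (simp add: algebra_simps)
      then have "s - s' = b * x" using a by simp
      then have "?B s = ?B s'" using M b x by (subst iff) (auto intro: principal_idealI)
      then have "s = s'" using el T by (auto dest: inj_onD)
      then show "r = r' \<and> s = s'" using rr by simp
    qed
    show "(\<lambda>(r, s). ?C (r + a * s)) ` (S \<times> T) = ?C ` ?M"
    proof
      show "(\<lambda>(r, s). ?C (r + a * s)) ` (S \<times> T) \<subseteq> ?C ` ?M"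
        using S(1) T(1) a by (auto intro!: imageI module_add module_mult)
      show "?C ` ?M \<subseteq> (\<lambda>(r, s). ?C (r + a * s)) ` (S \<times> T)"
      proof
        fix D assume "D \<in> ?C ` ?M"
        then obtain z where z: "z \<in> ?M" "D = ?C z" by auto
        obtain r where r: "r \<in> S" "?A z = ?A r" using S(3) z(1) by (metis imageE image_eqI)
        then have "z - r \<in> ?P a" using z S a by (subst (asm) iff) auto
        then obtain y where y: "y \<in> ?M" "z - r = a * y" by (auto simp: in_principal_ideal_iff)
        obtain s where s: "s \<in> T" "?B y = ?B s" using T(3) y(1) by (metis imageE image_eqI)
        then have "y - s \<in> ?P b" using y T b by (subst (asm) iff) auto
        then obtain x where x: "x \<in> ?M" "y - s = b * x" by (auto simp: in_principal_ideal_iff)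
        have "z - (r + a * s) = a * (y - s)" using y by (simp add: algebra_simps)
        then have "z - (r + a * s) = (a * b) * x" using x by simp
        then have "z - (r + a * s) \<in> ?P (a * b)" using x(1) by (auto intro: principal_idealI)
        moreover have "r + a * s \<in> ?M"
          using r(1) s(1) S(1) T(1) a(1) by (intro module_add module_mult) auto
        ultimately have "?C z = ?C (r + a * s)" using z ab by (subst iff) auto
        then show "D \<in> (\<lambda>(r, s). ?C (r + a * s)) ` (S \<times> T)" using z r s by auto
      qed
    qed
  qed
  then have "module_index n (?P (a * b)) = card (S \<times> T)"
    by (simp add: module_index_def bij_betw_same_card)
  moreover have "card S = module_index n (?P a)" "card T = module_index n (?P b)"
    using S T by (simp_all add: module_index_def card_image flip: S(3) T(3))
  ultimately show ?thesis by (simp add: card_cartesian_product)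
qed

lemma module_index_power:
  assumes "a \<in> cyclotomic_module n" "a \<noteq> 0" "0 < module_index n (principal_ideal n a)"
  shows "module_index n (principal_ideal n (a ^ k)) = module_index n (principal_ideal n a) ^ k"
proof (induction k)
  case 0
  then show ?case
    by (simp add: module_index_1_iff[unfolded One_nat_def] ideal_principal)
next
  case (Suc k)
  then show ?case using assms by (simp add: module_index_mult)
qed

text \<open>As \<open>p\<close> lies in \<open>I\<close>, the coefficients of an integer combination may be taken from \<open>{0..<p}\<close>.\<close>

lemma module_index_le_of_generators:
  assumes I: "ideal I (cyclotomic_ring n)" and p: "of_nat p \<in> I" "p > 0"
    and B: "finite B" "B \<subseteq> cyclotomic_module n"
    and gen: "\<And>z. z \<in> cyclotomic_module n \<Longrightarrow> \<exists>c :: complex \<Rightarrow> int. z - (\<Sum>b\<in>B. of_int (c b) * b) \<in> I"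
  shows "0 < module_index n I" "module_index n I \<le> p ^ card B"
proof -
  let ?M = "cyclotomic_module n" and ?F = "B \<rightarrow>\<^sub>E {..<p}"
  let ?f = "\<lambda>c. residue_class n I (\<Sum>b\<in>B. of_nat (c b) * b)"
  have sub: "residue_class n I ` ?M \<subseteq> ?f ` ?F"
  proof
    fix C assume "C \<in> residue_class n I ` ?M"
    then obtain z where z: "z \<in> ?M" "C = residue_class n I z" by auto
    obtain c :: "complex \<Rightarrow> int" where c: "z - (\<Sum>b\<in>B. of_int (c b) * b) \<in> I" using gen[OF z(1)] by auto
    define d where "d = (\<lambda>b\<in>B. nat (c b mod int p))"
    have d: "d \<in> ?F" using p(2) by (auto simp: d_def nat_less_iff)
    have "of_int (c b) * b - of_nat (d b) * b \<in> I" if "b \<in> B" for b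
    proof -
      have "int (d b) = c b mod int p" using that p(2) by (simp add: d_def)
      then have "c b = int p * (c b div int p) + int (d b)" by simp
      then have "of_int (c b) * b - of_nat (d b) * b = of_nat p * (of_int (c b div int p) * b)"
        by (metis (no_types, lifting) add_diff_cancel_right' left_diff_distrib mult.assoc of_int_add
            of_int_mult of_int_of_nat_eq)
      also have "\<dots> \<in> I" using that B by (intro ideal_closed(5)[OF I p(1)]) auto
      finally show ?thesis .
    qed
    then have "(\<Sum>b\<in>B. of_int (c b) * b - of_nat (d b) * b) \<in> I"
      by (intro ideal_sum[OF I])
    from ideal_closed(3)[OF I c this]
    have "z - (\<Sum>b\<in>B. of_nat (d b) * b) \<in> I" by (simp add: sum_subtractf)
    moreover have "(\<Sum>b\<in>B. of_nat (d b) * b) \<in> ?M" using B by (intro module_sum) auto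
    ultimately have "C = ?f d" using z by (simp add: residue_class_eq_iff[OF I])
    then show "C \<in> ?f ` ?F" using d by blast
  qed
  have fin: "finite ?F" using B by (simp add: finite_PiE)
  show "0 < module_index n I"
    using sub fin by (simp add: module_index_pos_iff finite_subset)
  have "module_index n I \<le> card (?f ` ?F)"
    unfolding module_index_def using sub fin by (intro card_mono) auto
  also have "\<dots> \<le> card ?F" using fin by (rule card_image_le)
  also have "\<dots> = p ^ card B" using B by (simp add: card_PiE)
  finally show "module_index n I \<le> p ^ card B" .
qed

text \<open>By Sylow's theorem, another prime divisor \<open>r\<close> of the order would give a subgroup of order \<open>r\<close>; the order
  of its elements would divide both \<open>r\<close> and \<open>p\<close>.\<close>

lemma (in group) order_prime_power_of_exponent:
  assumes fin: "finite (carrier G)" and p: "Factorial_Ring.prime (p :: nat)"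
    and exp: "\<And>x. x \<in> carrier G \<Longrightarrow> x [^] p = \<one>"
  shows "\<exists>k. order G = p ^ k"
proof -
  have only_p: "r = p" if r: "Factorial_Ring.prime r" "r dvd order G" for r
  proof -
    obtain m where "order G = r ^ 1 * m" using r(2) by auto
    then obtain H where H: "subgroup H G" "card H = r ^ 1"
      using sylow_thm[OF r(1) is_group _ fin] by blast
    then obtain x where x: "x \<in> H" "x \<noteq> \<one>"
      using r(1) by (metis One_nat_def card_le_Suc0_iff_eq card.infinite not_less_eq_eq not_prime_0
          power_one_right prime_ge_2_nat numeral_2_eq_2 le_SucI subgroup.one_closed)
    interpret H: group "G\<lparr>carrier := H\<rparr>" using H(1) by (rule subgroup.subgroup_is_group) (rule is_group)
    have xG: "x \<in> carrier G" using x(1) H(1) subgroup.mem_carrier by metis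
    have "x [^] r = \<one>"
      using H.pow_order_eq_1[of x] x H(2) by (simp add: order_def flip: nat_pow_consistent)
    then have "ord x dvd r" using xG by (simp add: pow_eq_id)
    moreover have "ord x dvd p" using exp[OF xG] xG by (simp add: pow_eq_id)
    moreover have "ord x \<noteq> 1" using x xG ord_eq_1 by auto
    ultimately show "r = p" using r(1) p by (metis prime_nat_iff)
  qed
  have pos: "order G > 0" using fin by (simp add: order_gt_0_iff_finite)
  then obtain m where m: "order G = p ^ multiplicity p (order G) * m" "\<not> p dvd m"
    using multiplicity_decompose'[of "order G" p] p by (metis neq0_conv not_prime_unit)
  have "m = 1"
    using m only_p prime_factor_nat[of m] by (metis dvd_mult)
  then show ?thesis using m by (metis mult_1_right)
qed

lemma quotient_add_pow:
  assumes I: "ideal I (cyclotomic_ring n)" and x: "x \<in> cyclotomic_module n"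
  shows "(I +>\<^bsub>cyclotomic_ring n\<^esub> x) [^]\<^bsub>add_monoid (FactRing (cyclotomic_ring n) I)\<^esub> (k :: nat) =
    I +>\<^bsub>cyclotomic_ring n\<^esub> (of_nat k * x)"
proof (induction k)
  interpret I: ideal I "cyclotomic_ring n" by fact
  interpret Q: ring "FactRing (cyclotomic_ring n) I" by (rule I.quotient_is_ring)
  {
    case 0
    then show ?case by (simp add: FactRing_def I.a_rcos_const ideal_closed(2)[OF I])
  next
    case (Suc k)
    have "(I +>\<^bsub>cyclotomic_ring n\<^esub> x) [^]\<^bsub>add_monoid (FactRing (cyclotomic_ring n) I)\<^esub> Suc k =
        (I +>\<^bsub>cyclotomic_ring n\<^esub> (of_nat k * x)) <+>\<^bsub>cyclotomic_ring n\<^esub> (I +>\<^bsub>cyclotomic_ring n\<^esub> x)"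
      using Suc by (simp add: FactRing_def)
    also have "\<dots> = I +>\<^bsub>cyclotomic_ring n\<^esub> (of_nat k * x + x)"
      using x I.a_rcos_sum[of "of_nat k * x" x] by simp
    finally show ?case by (simp add: algebra_simps)
  }
qed

lemma carrier_quotient_add_monoid:
  assumes I: "ideal I (cyclotomic_ring n)"
  shows "carrier (add_monoid (FactRing (cyclotomic_ring n) I)) = residue_class n I ` cyclotomic_module n"
    and "order (add_monoid (FactRing (cyclotomic_ring n) I)) = module_index n I"
    and "\<one>\<^bsub>add_monoid (FactRing (cyclotomic_ring n) I)\<^esub> = I"
    and "group (add_monoid (FactRing (cyclotomic_ring n) I))"
  using abelian_group.a_group[OF ring.is_abelian_group[OF ideal.quotient_is_ring[OF I]]]
  by (simp_all add: FactRing_def order_def a_rcosets_eq_residue_classes[OF I] module_index_def)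

text \<open>This is Lagrange's theorem for the class of 1 in the additive group of the quotient.\<close>

lemma module_index_in_ideal:
  assumes I: "ideal I (cyclotomic_ring n)" and fin: "0 < module_index n I"
  shows "of_nat (module_index n I) \<in> I"
proof -
  interpret group "add_monoid (FactRing (cyclotomic_ring n) I)" by (rule carrier_quotient_add_monoid(4)[OF I])
  have "residue_class n I 1 \<in> carrier (add_monoid (FactRing (cyclotomic_ring n) I))"
    unfolding carrier_quotient_add_monoid(1)[OF I] by simp
  from pow_order_eq_1[OF this] have "(I +>\<^bsub>cyclotomic_ring n\<^esub> 1)
      [^]\<^bsub>add_monoid (FactRing (cyclotomic_ring n) I)\<^esub> module_index n I = I"
    by (simp only: a_r_coset_eq_residue_class[OF I module_1] carrier_quotient_add_monoid(2,3)[OF I])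
  then have "I +>\<^bsub>cyclotomic_ring n\<^esub> (of_nat (module_index n I) * 1) = I"
    by (simp only: quotient_add_pow[OF I module_1])
  then show ?thesis
    using a_r_coset_eq_residue_class[OF I, of "of_nat (module_index n I)"] ideal_closed(2,7)[OF I]
    by (force simp: residue_class_def)
qed

text \<open>The quotient by an ideal containing \<open>p\<close> is a vector space over the field with \<open>p\<close> elements.\<close>

lemma module_index_prime_power:
  assumes I: "ideal I (cyclotomic_ring n)" and p: "of_nat p \<in> I" "Factorial_Ring.prime p"
    and fin: "0 < module_index n I"
  shows "\<exists>k. module_index n I = p ^ k"
proof -
  interpret I: ideal I "cyclotomic_ring n" by fact
  have "\<exists>k. order (add_monoid (FactRing (cyclotomic_ring n) I)) = p ^ k"
  proof (rule group.order_prime_power_of_exponent[OF carrier_quotient_add_monoid(4)[OF I] _ p(2)])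
    show "finite (carrier (add_monoid (FactRing (cyclotomic_ring n) I)))"
      using fin by (simp add: carrier_quotient_add_monoid(1)[OF I, simplified] module_index_pos_iff)
    fix C assume "C \<in> carrier (add_monoid (FactRing (cyclotomic_ring n) I))"
    then obtain x where x: "x \<in> cyclotomic_module n" "C = I +>\<^bsub>cyclotomic_ring n\<^esub> x"
      by (auto simp: carrier_quotient_add_monoid(1)[OF I, simplified] a_r_coset_eq_residue_class[OF I])
    have "I +>\<^bsub>cyclotomic_ring n\<^esub> (of_nat p * x) = I"
      using x ideal_closed(5)[OF I p(1)] by (simp add: I.a_rcos_const)
    then show "C [^]\<^bsub>add_monoid (FactRing (cyclotomic_ring n) I)\<^esub> p =
        \<one>\<^bsub>add_monoid (FactRing (cyclotomic_ring n) I)\<^esub>"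
      using quotient_add_pow[OF I x(1), of p] x(2) carrier_quotient_add_monoid(3)[OF I] by simp
  qed
  then show ?thesis using carrier_quotient_add_monoid(2)[OF I] by simp
qed

text \<open>Writing \<open>m\<close> as \<open>(1 - z) + \<dots> + (1 - z\<^sup>m\<^sup>-\<^sup>1)\<close> shows it divisible by \<open>1 - z\<close>.\<close>

lemma one_minus_root_of_unity_dvd:
  assumes "z ^ m = 1" "z \<noteq> 1" "z \<in> cyclotomic_module n"
  shows "of_nat m \<in> principal_ideal n (1 - z)"
proof -
  have "of_nat m = (\<Sum>i<m. 1 - z ^ i)"
    using root_of_unity_sum_0[OF assms(1,2)] by (simp add: sum_subtractf)
  also have "\<dots> = (\<Sum>i<m. (1 - z) * (\<Sum>j<i. z ^ j))"
    by (simp add: one_diff_power_eq)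
  also have "\<dots> = (1 - z) * (\<Sum>i<m. \<Sum>j<i. z ^ j)"
    by (simp add: sum_distrib_left)
  finally show ?thesis using assms(3)
    by (intro principal_idealI[of "\<Sum>i<m. \<Sum>j<i. z ^ j"]) (auto intro!: module_sum)
qed

text \<open>Multiplication by \<open>\<xi>\<^sub>m\<close> acts on the non-zero residues, and freely so: \<open>\<xi>\<^sub>m\<^sup>d x \<equiv> x\<close> with
  \<open>0 < d < m\<close> implies \<open>m x \<equiv> 0\<close>, whereas \<open>p x \<equiv> 0\<close>.\<close>

lemma dvd_module_index_minus_1:
  assumes n: "n > 0" and I: "ideal I (cyclotomic_ring n)" and p: "of_nat p \<in> I" 
    and m: "m dvd lcm 2 n" "coprime p m" and fin: "0 < module_index n I"
  shows "m dvd module_index n I - 1"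
proof -
  let ?M = "cyclotomic_module n" and ?C = "residue_class n I"
  define w where "w = xi m"
  have "lcm 2 n \<noteq> 0" using n by (simp add: lcm_eq_0_iff)
  then have m0: "m > 0" using m(1) by (metis dvd_0_left gr0I)
  have w: "w \<in> ?M" "w ^ m = 1" using module_xi[OF n m(1)] xi_power_self[OF m0] by (simp_all add: w_def)
  \<comment> \<open>the orbits of \<open>w\<close> on the non-zero classes; \<open>X\<close> is the disjoint union of orbits of length \<open>m\<close>\<close>
  define X where "X = ?C ` (?M - I)"
  define r where "r = {(?C x, ?C (w ^ j * x)) | x j. x \<in> ?M - I}"
  note iff = residue_class_eq_iff[OF I]
  have cong: "w ^ j * x - w ^ j * y \<in> I" if "x - y \<in> I" for x y j
    using ideal_closed(6)[OF I that, of "w ^ j"] w by (simp add: right_diff_distrib)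
  have winv: "w ^ (j * (m - 1)) * (w ^ j * x) = x" for x j
  proof -
    have "j * (m - 1) + j = m * j" using m0 by (cases m) auto
    then have "w ^ (j * (m - 1)) * w ^ j = 1"
      using w(2) by (metis power_add power_mult power_one)
    then show ?thesis by (simp flip: mult.assoc)
  qed
  have wI: "w ^ j * x \<in> ?M - I" if "x \<in> ?M - I" for x j
  proof -
    have "w ^ (j * (m - 1)) * (w ^ j * x) \<in> I" if "w ^ j * x \<in> I"
      by (rule ideal_closed(6)[OF I that]) (use w in simp)
    then have "w ^ j * x \<notin> I" using that unfolding winv by blast
    then show ?thesis using that w(1) by simp
  qed

  have equivX: "equiv X r"
  proof (rule equivI)
    show "r \<subseteq> X \<times> X" using wI by (auto simp: r_def X_def)
    show "refl_on X r"
    proof (rule refl_onI)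
      fix C assume "C \<in> X"
      then obtain x where "x \<in> ?M - I" "C = ?C x" by (auto simp: X_def)
      then have "(C, ?C (w ^ 0 * x)) \<in> r" unfolding r_def by blast
      then show "(C, C) \<in> r" using \<open>C = ?C x\<close> by simp
    qed
    show "sym r"
    proof (rule symI)
      fix C D assume "(C, D) \<in> r"
      then obtain x j where x: "x \<in> ?M - I" "C = ?C x" "D = ?C (w ^ j * x)" by (auto simp: r_def)
      have "C = ?C (w ^ (j * (m - 1)) * (w ^ j * x))" by (simp only: x(2) winv)
      then show "(D, C) \<in> r" using wI[OF x(1), of j] x(3) unfolding r_def by blast
    qed
    show "trans r"
    proof (rule transI)
      fix C D E assume "(C, D) \<in> r" "(D, E) \<in> r"
      then obtain x j y k where x: "x \<in> ?M - I" "C = ?C x" "D = ?C (w ^ j * x)"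
        and y: "y \<in> ?M - I" "D = ?C y" "E = ?C (w ^ k * y)" by (auto simp: r_def)
      have "y - w ^ j * x \<in> I" using x y w by (metis Diff_iff iff module_mult module_power)
      from cong[OF this, of k] have "w ^ k * y - w ^ (k + j) * x \<in> I"
        by (simp add: power_add mult.assoc)
      then have "E = ?C (w ^ (k + j) * x)" using x y w by (subst y(3), subst iff) auto
      then show "(C, E) \<in> r" using x unfolding r_def by blast
    qed
  qed
  have dvdX: "m dvd card D" if "D \<in> X // r" for D
  proof -
    obtain C where "C \<in> X" "D = r `` {C}" using \<open>D \<in> X // r\<close> by (rule quotientE)
    then obtain x where x: "x \<in> ?M - I" "D = r `` {?C x}" unfolding X_def by blast
    have "D = (\<lambda>j. ?C (w ^ j * x)) ` {..<m}"
    proof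
      show "D \<subseteq> (\<lambda>j. ?C (w ^ j * x)) ` {..<m}"
      proof
        fix E assume "E \<in> D"
        then obtain y k where y: "y \<in> ?M - I" "?C x = ?C y" "E = ?C (w ^ k * y)"
          using x by (auto simp: r_def)
        have "y - x \<in> I" using x y by (metis Diff_iff iff)
        from cong[OF this, of k] have "E = ?C (w ^ k * x)" using x y w by (subst y(3), subst iff) auto
        also have "w ^ k = w ^ (k mod m)" using root_of_unity_power_mod[OF w(2)] by simp
        finally show "E \<in> (\<lambda>j. ?C (w ^ j * x)) ` {..<m}" using m0 by auto
      qed
      show "(\<lambda>j. ?C (w ^ j * x)) ` {..<m} \<subseteq> D" using x by (auto simp: r_def)
    qed
    moreover have "inj_on (\<lambda>j. ?C (w ^ j * x)) {..<m}"
    proof (rule linorder_inj_onI', rule notI)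
      fix i j assume ij: "i \<in> {..<m}" "j \<in> {..<m}" "i < j" "?C (w ^ i * x) = ?C (w ^ j * x)"
      have "w ^ i * x - w ^ j * x \<in> I" using ij x w iff by auto
      moreover have "w ^ i * x - w ^ j * x = w ^ i * ((1 - w ^ (j - i)) * x)"
        using ij by (simp add: algebra_simps flip: power_add)
      ultimately have d: "(1 - w ^ (j - i)) * x \<in> I"
        using wI[of "(1 - w ^ (j - i)) * x" i] x w by auto
      have "(w ^ (j - i)) ^ m = 1" using w by (metis mult.commute power_mult power_one)
      moreover have "w ^ (j - i) \<noteq> 1"
        using ij m0 unfolding w_def by (subst xi_power_eq_1_iff) (auto dest: dvd_imp_le)
      ultimately have "of_nat m \<in> principal_ideal n (1 - w ^ (j - i))"
        using w by (intro one_minus_root_of_unity_dvd) auto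
      then obtain y where y: "y \<in> ?M" "of_nat m = (1 - w ^ (j - i)) * y" by (auto simp: in_principal_ideal_iff)
      have mx: "of_nat m * x \<in> I"
        using ideal_closed(6)[OF I d y(1)] unfolding y(2) by (simp add: mult_ac)
      have px: "of_nat p * x \<in> I" using ideal_closed(5)[OF I p, of x] x by simp
      obtain u v where "u * int p + v * int m = 1"
        using m(2) bezout_int[of "int p" "int m"] by auto
      then have "of_int (u * int p + v * int m) * x = x" by simp
      then have "of_int u * (of_nat p * x) + of_int v * (of_nat m * x) = x"
        by (simp add: algebra_simps)
      then have "x \<in> I"
        using ideal_closed(3)[OF I ideal_closed(6)[OF I px, of "of_int u"]
            ideal_closed(6)[OF I mx, of "of_int v"]] by simp
      then show False using x by simp
    qed
    ultimately have "card D = m" by (simp add: card_image)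
    then show ?thesis by simp
  qed
  have "?C x = ?C 0 \<longleftrightarrow> x \<in> I" if "x \<in> ?M" for x
    using iff[of x 0] that by simp
  then have Xeq: "X = ?C ` ?M - {?C 0}" unfolding X_def by blast
  then have "finite X" using fin by (simp add: module_index_pos_iff)
  then have "m dvd card X" using equiv_imp_dvd_card[OF _ equivX dvdX] by blast
  then show ?thesis
    using Xeq fin by (simp add: module_index_def)
qed

text \<open>The index \<open>p\<^sup>k\<close> is congruent to 1 modulo \<open>m\<close>, and \<open>k > 0\<close> as the ideal is proper.\<close>

lemma module_index_ge:
  assumes "n > 0" and I: "ideal I (cyclotomic_ring n)" and p: "of_nat p \<in> I" "Factorial_Ring.prime p" 
    and m: "m dvd lcm 2 n" "coprime p m" and fin: "0 < module_index n I" and proper: "1 \<notin> I"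
    and f: "\<And>k. 0 < k \<Longrightarrow> [p ^ k = 1] (mod m) \<Longrightarrow> f \<le> k"
  shows "p ^ f \<le> module_index n I"
proof -
  obtain k where k: "module_index n I = p ^ k" using module_index_prime_power[OF I p fin] by auto
  have "k > 0" using module_index_1_iff[OF I] proper k by (metis gr0I power_0)
  have "m dvd p ^ k - 1" using dvd_module_index_minus_1[OF assms(1) I p(1) m fin] k by simp
  then have "[p ^ k = 1] (mod m)"
    using p(2) by (simp add: cong_altdef_nat prime_gt_0_nat Suc_leI)
  then have "f \<le> k" using f \<open>k > 0\<close> by auto
  then show ?thesis using k power_increasing[of f k p] prime_gt_0_nat[OF p(2)] by simp
qed

section \<open>Integrality\<close>

text \<open>Multiplication by \<open>w = p(x)\<close> maps the powers \<open>1, x, \<dots>, x\<^bsup>n-1\<^esup>\<close> to integer combinations of these powers; so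
  \<open>w\<close> is an eigenvalue of an integer matrix.\<close>

lemma algebraic_int_poly_root_of_unity:
  fixes x w :: complex
  assumes n: "x ^ n = 1" "n > 0" and w: "w = poly (of_int_poly p) x"
  shows "algebraic_int w"
proof -
  \<comment> \<open>\<open>w\<close> is the combination of the \<open>x\<^sup>i\<close>, \<open>i < n\<close>, with coefficients \<open>c i\<close>, and \<open>A\<close> is a circulant matrix\<close>
  define c where "c i = (\<Sum>k | k \<le> degree p \<and> k mod n = i. Polynomial.coeff p k)" for i
  define A :: "int mat" where "A = mat n n (\<lambda>(i, j). c ((j + n - i) mod n))"
  define B :: "complex mat" where "B = map_mat of_int A"
  define v :: "complex vec" where "v = vec n (\<lambda>j. x ^ j)"
  have A: "A \<in> carrier_mat n n" and B: "B \<in> carrier_mat n n" by (simp_all add: A_def B_def)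
  have w_c: "w = (\<Sum>i<n. of_int (c i) * x ^ i)"
  proof -
    have "w = (\<Sum>k\<le>degree p. of_int (Polynomial.coeff p k) * x ^ k)"
      unfolding w by (simp add: poly_altdef)
    also have "\<dots> = (\<Sum>k\<le>degree p. of_int (Polynomial.coeff p k) * x ^ (k mod n))"
      by (simp add: root_of_unity_power_mod[OF n(1)])
    also have "\<dots> = (\<Sum>i<n. \<Sum>k | k \<in> {..degree p} \<and> k mod n = i. of_int (Polynomial.coeff p k) * x ^ (k mod n))"
      by (rule sum.group[symmetric]) (use n in auto)
    also have "\<dots> = (\<Sum>i<n. of_int (c i) * x ^ i)"
      by (intro sum.cong refl) (simp add: c_def sum_distrib_right)
    finally show ?thesis .
  qed
  have "B *\<^sub>v v = w \<cdot>\<^sub>v v"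
  proof (rule eq_vecI)
    fix i assume "i < dim_vec (w \<cdot>\<^sub>v v)"
    then have i: "i < n" by (simp add: v_def)
    have "(B *\<^sub>v v) $ i = (\<Sum>j<n. of_int (c ((j + n - i) mod n)) * x ^ j)"
      using i by (simp add: B_def A_def v_def scalar_prod_def atLeast0LessThan)
    also have "\<dots> = (\<Sum>l<n. of_int (c l) * x ^ ((l + i) mod n))"
    proof (rule sum.reindex_bij_witness[of _ "\<lambda>l. (l + i) mod n" "\<lambda>j. (j + n - i) mod n"], goal_cases)
      case (1 j)
      then have "((j + n - i) mod n + i) mod n = (j + n - i + i) mod n" by (simp add: mod_add_left_eq)
      then show ?case using 1 i by simp
    next
      case (3 l)
      have "((l + i) mod n + n - i) mod n = ((l + i) mod n + (n - i)) mod n" using i by simp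
      also have "\<dots> = (l + i + (n - i)) mod n" by (simp add: mod_add_left_eq)
      finally show ?case using 3 i by simp
    next
      case (5 j)
      then have "((j + n - i) mod n + i) mod n = (j + n - i + i) mod n" by (simp add: mod_add_left_eq)
      then show ?case using 5 i by simp
    qed (use n in auto)
    also have "\<dots> = (\<Sum>l<n. of_int (c l) * x ^ l) * x ^ i"
      by (simp add: root_of_unity_power_mod[OF n(1)] sum_distrib_right power_add mult.assoc)
    also have "\<dots> = (w \<cdot>\<^sub>v v) $ i" using i by (simp add: w_c v_def)
    finally show "(B *\<^sub>v v) $ i = (w \<cdot>\<^sub>v v) $ i" .
  qed (simp add: B_def A_def v_def)
  moreover have "v \<noteq> 0\<^sub>v n"
  proof
    assume "v = 0\<^sub>v n"
    then have "v $ 0 = 0" using n by simp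
    then show False using n by (simp add: v_def)
  qed
  ultimately have "eigenvalue B w"
    using B unfolding eigenvalue_def eigenvector_def by (intro exI[of _ v]) (auto simp: v_def)
  then have "poly (char_poly B) w = 0" using eigenvalue_root_char_poly[OF B] by simp
  then have "poly (of_int_poly (char_poly A)) w = 0"
    by (simp only: B_def of_int_hom.char_poly_hom[OF A])
  moreover have "lead_coeff (char_poly A) = 1" using degree_monic_char_poly[OF A] by simp
  ultimately show ?thesis unfolding algebraic_int_altdef_ipoly by blast
qed

lemma module_algebraic_int: "n > 0 \<Longrightarrow> z \<in> cyclotomic_module n \<Longrightarrow> algebraic_int z"
  using algebraic_int_poly_root_of_unity[OF xi_power_self] by (auto simp: in_module_iff)

text \<open>Multiplying a monic equation for \<open>w = 1 / a\<close> by \<open>a\<^sup>d\<close> expresses \<open>1\<close> as a multiple of \<open>a\<close>.\<close>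

lemma algebraic_int_inverse_polynomial:
  assumes "algebraic_int w" "a * w = 1"
  shows "\<exists>S :: int poly. a * poly (of_int_poly S) a = (1 :: complex)"
proof -
  obtain P :: "int poly" where P: "poly (of_int_poly P) w = 0" "lead_coeff P = 1"
    using assms(1) algebraic_int_altdef_ipoly by blast
  let ?Q = "reflect_poly P"
  have w: "w = inverse a" "a \<noteq> 0" using assms(2) inverse_unique[of a w] by auto
  have "of_int_poly ?Q = reflect_poly (of_int_poly P :: complex poly)"
    by (rule poly_eqI) (simp add: coeff_reflect_poly)
  then have "poly (of_int_poly ?Q) a = 0"
    using P(1) w by (simp add: poly_reflect_poly_nz)
  moreover have "Polynomial.coeff ?Q 0 = 1" using P(2) by (simp add: coeff_0_reflect_poly)
  moreover obtain c S where "?Q = pCons c S" by (rule pCons_cases)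
  ultimately have "1 + a * poly (of_int_poly S) a = 0"
    by (simp add: of_int_hom.map_poly_pCons_hom)
  then have "a * poly (of_int_poly (- S)) a = 1"
    by (simp add: hom_distribs add_eq_0_iff)
  then show ?thesis by blast
qed

lemma of_nat_not_unit:
  assumes "n > 0" "k > 1"
  shows "1 \<notin> principal_ideal n (of_nat k)"
proof
  assume "1 \<in> principal_ideal n (of_nat k)"
  then obtain w where w: "w \<in> cyclotomic_module n" "of_nat k * w = 1" by (auto simp: in_principal_ideal_iff)
  obtain S :: "int poly" where S: "of_nat k * poly (of_int_poly S) (of_nat k) = (1 :: complex)"
    using algebraic_int_inverse_polynomial[OF module_algebraic_int[OF assms(1) w(1)] w(2)] by blast
  have "poly (of_int_poly S) (of_nat k) = (of_int (poly S (int k)) :: complex)"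
    using of_int_hom.poly_map_poly[of S "int k"] by simp
  then have "(of_int (int k * poly S (int k)) :: complex) = of_int 1" using S by simp
  then have "int k * poly S (int k) = 1" by (simp only: of_int_eq_iff)
  then show False using assms(2) by (auto simp: zmult_eq_1_iff)
qed

text \<open>\<open>\<int>[a]\<close> consists of the \<open>u + v a\<close>, and \<open>a (u + v a) = 1\<close> forces \<open>v N = -1\<close> when \<open>a\<close> is
  irrational.\<close>

lemma quadratic_not_unit:
  assumes n: "n > 0" and a: "a * a = of_int t * a - of_int N" and N: "\<bar>N\<bar> \<noteq> 1"
    and irr: "\<And>u v :: int. of_int u + of_int v * a = 0 \<Longrightarrow> v = 0"
  shows "1 \<notin> principal_ideal n a"
proof
  assume "1 \<in> principal_ideal n a"
  then obtain w where w: "w \<in> cyclotomic_module n" "a * w = 1" by (auto simp: in_principal_ideal_iff)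
  obtain S :: "int poly" where S: "a * poly (of_int_poly S) a = 1"
    using algebraic_int_inverse_polynomial[OF module_algebraic_int[OF n w(1)] w(2)] by blast
  have "\<exists>u v :: int. poly (of_int_poly S) a = of_int u + of_int v * a"
  proof (induction S)
    case 0
    show ?case by (intro exI[of _ 0]) simp
  next
    case (pCons c S)
    then obtain u v :: int where "poly (of_int_poly S) a = of_int u + of_int v * a" by blast
    then have "poly (of_int_poly (pCons c S)) a = of_int c + (of_int u * a + of_int v * (a * a))"
      by (simp add: of_int_hom.map_poly_pCons_hom algebra_simps)
    also have "\<dots> = of_int (c - v * N) + of_int (u + v * t) * a"
      unfolding a by (simp add: algebra_simps)
    finally show ?case by blast
  qed
  then obtain u v :: int where "poly (of_int_poly S) a = of_int u + of_int v * a" by blast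
  then have "of_int u * a + of_int v * (a * a) = 1" using S by (simp add: algebra_simps)
  then have 1: "of_int (- v * N - 1) + of_int (u + v * t) * a = 0"
    unfolding a by (simp add: algebra_simps)
  then have "(of_int (- v * N - 1) :: complex) = 0" using irr[OF 1] by simp
  then have "- v * N - 1 = 0" by (simp only: of_int_eq_0_iff)
  then show False using N by (metis abs_1 abs_minus_cancel abs_mult abs_zmult_eq_1 add_diff_cancel_left'
        diff_eq_eq minus_mult_left mult.commute add.commute add_0)
qed


section \<open>Powers modulo a prime number\<close>

lemma prime_dvd_binomial_expansion:
  assumes p: "Factorial_Ring.prime p" and x: "x \<in> cyclotomic_module n" "y \<in> cyclotomic_module n"
  shows "(x + y) ^ p - x ^ p - y ^ p \<in> principal_ideal n (of_nat p)"
proof -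
  have p1: "p > 0" using p by (rule prime_gt_0_nat)
  have "(x + y) ^ p = (\<Sum>k\<le>p. of_nat (p choose k) * x ^ k * y ^ (p - k))" by (rule binomial_ring)
  also have "{..p} = insert 0 (insert p {0<..<p})" by auto
  also have "(\<Sum>k\<in>insert 0 (insert p {0<..<p}). of_nat (p choose k) * x ^ k * y ^ (p - k)) =
      y ^ p + (x ^ p + (\<Sum>k\<in>{0<..<p}. of_nat (p choose k) * x ^ k * y ^ (p - k)))"
    using p1 by (subst sum.insert) auto
  finally have eq: "(x + y) ^ p - x ^ p - y ^ p =
      (\<Sum>k\<in>{0<..<p}. of_nat (p choose k) * x ^ k * y ^ (p - k))" by simp
  show ?thesis unfolding eq
  proof (rule ideal_sum[OF ideal_principal])
    fix k assume k: "k \<in> {0<..<p}"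
    then have "p dvd (p choose k)" using p by (intro dvd_choose_prime) auto
    then obtain c where "p choose k = p * c" by auto
    then show "of_nat (p choose k) * x ^ k * y ^ (p - k) \<in> principal_ideal n (of_nat p)"
      using x by (intro principal_idealI[of "of_nat c * x ^ k * y ^ (p - k)"]) (simp_all add: mult.assoc)
  qed simp
qed

lemma ideal_power_diff:
  assumes "ideal I (cyclotomic_ring n)" "x - y \<in> I" "x \<in> cyclotomic_module n" "y \<in> cyclotomic_module n"
  shows "x ^ k - y ^ k \<in> I"
  unfolding power_diff_sumr2[of x k y]
  using assms by (intro ideal_closed(5)) (auto intro!: module_sum)

text \<open>Modulo \<open>p\<close>, the \<open>p\<^sup>j\<close>-th power map is a ring homomorphism.\<close>

lemma frobenius_additive:
  assumes p: "Factorial_Ring.prime p" and xy: "x \<in> cyclotomic_module n" "y \<in> cyclotomic_module n"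
  shows "(x + y) ^ (p ^ j) - x ^ (p ^ j) - y ^ (p ^ j) \<in> principal_ideal n (of_nat p)"
proof (induction j)
  case 0
  then show ?case using ideal_closed(2)[OF ideal_principal] by simp
next
  case (Suc j)
  let ?x = "x ^ (p ^ j)" and ?y = "y ^ (p ^ j)" and ?s = "(x + y) ^ (p ^ j)"
  have "?s - (?x + ?y) \<in> principal_ideal n (of_nat p)" using Suc by (simp add: algebra_simps)
  then have "?s ^ p - (?x + ?y) ^ p \<in> principal_ideal n (of_nat p)"
    using xy by (intro ideal_power_diff[OF ideal_principal]) auto
  moreover have "(?x + ?y) ^ p - ?x ^ p - ?y ^ p \<in> principal_ideal n (of_nat p)"
    using prime_dvd_binomial_expansion[OF p, of ?x n ?y] xy by auto
  ultimately have "(?s ^ p - (?x + ?y) ^ p) + ((?x + ?y) ^ p - ?x ^ p - ?y ^ p) \<in> principal_ideal n (of_nat p)"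
    by (rule ideal_closed(3)[OF ideal_principal, rotated]) simp
  moreover have "a - b + (b - c - d) = a - c - d" for a b c d :: complex by simp
  ultimately have "?s ^ p - ?x ^ p - ?y ^ p \<in> principal_ideal n (of_nat p)" by metis
  then show ?case by (simp only: power_Suc mult.commute[of p] power_mult)
qed

text \<open>The elements that are fixed modulo \<open>I\<close> by this homomorphism form a ring, so one need only look at \<open>\<xi>\<^sub>n\<close>.\<close>

lemma frobenius_fixes_module:
  assumes p: "Factorial_Ring.prime p" and I: "ideal I (cyclotomic_ring n)" "of_nat p \<in> I"
    and xi: "xi n ^ (p ^ f) - xi n \<in> I" and z: "z \<in> cyclotomic_module n"
  shows "z ^ (p ^ f) - z \<in> I"
proof -
  have frob: "(x + y) ^ (p ^ f) - x ^ (p ^ f) - y ^ (p ^ f) \<in> I"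
    if xy: "x \<in> cyclotomic_module n" "y \<in> cyclotomic_module n" for x y
  proof -
    obtain u where u: "u \<in> cyclotomic_module n" "(x + y) ^ (p ^ f) - x ^ (p ^ f) - y ^ (p ^ f) = of_nat p * u"
      using frobenius_additive[OF p xy, of f] unfolding in_principal_ideal_iff by blast
    show ?thesis unfolding u(2) using u(1) by (rule ideal_closed(5)[OF I])
  qed
  show ?thesis using z
  proof (induction rule: module_induct)
    case (of_int k)
    show ?case
    proof (induction k rule: int_induct[of _ 0])
      case base
      then show ?case using prime_gt_0_nat[OF p] ideal_closed(2)[OF I(1)] by (simp add: power_0_left)
    next
      case (step1 k)
      have "((of_int k + 1) ^ (p ^ f) - of_int k ^ (p ^ f) - 1 ^ (p ^ f)) + (of_int k ^ (p ^ f) - of_int k) \<in> I"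
        by (rule ideal_closed(3)[OF I(1) frob step1(2)]) simp_all
      then show ?case by (simp add: algebra_simps)
    next
      \<comment> \<open>descending from \<open>k\<close> to \<open>k - 1\<close> by adding 1 avoids the sign of \<open>(-1)\<^sup>q\<close>\<close>
    case (step2 k)
      have "(of_int k ^ (p ^ f) - of_int k) - ((of_int (k - 1) + 1) ^ (p ^ f) - of_int (k - 1) ^ (p ^ f) - 1 ^ (p ^ f)) \<in> I"
        by (rule ideal_closed(4)[OF I(1) step2(2) frob]) simp_all
      then show ?case by (simp add: algebra_simps)
    qed
  next
    case xi
    then show ?case using assms by simp
  next
    case (add x y)
    have "((x + y) ^ (p ^ f) - x ^ (p ^ f) - y ^ (p ^ f)) + ((x ^ (p ^ f) - x) + (y ^ (p ^ f) - y)) \<in> I"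
      using add frob by (intro ideal_closed(3)[OF I(1)]) auto
    then show ?case by (simp add: algebra_simps)
  next
    case (mult x y)
    have "(x ^ (p ^ f) - x) * y ^ (p ^ f) + x * (y ^ (p ^ f) - y) \<in> I"
      using mult ideal_closed(5)[OF I(1), of "x ^ (p ^ f) - x" "y ^ (p ^ f)"]
        ideal_closed(6)[OF I(1), of "y ^ (p ^ f) - y" x]
      by (intro ideal_closed(3)[OF I(1)]) auto
    then show ?case by (simp add: algebra_simps power_mult_distrib)
  qed
qed

section \<open>Integer combinations of roots of unity\<close>

definition int_span :: "complex set \<Rightarrow> complex set" where
  "int_span B = {\<Sum>b\<in>B. of_int (c b) * b | c. True}"

lemma int_span_iff: "z \<in> int_span B \<longleftrightarrow> (\<exists>c. z = (\<Sum>b\<in>B. of_int (c b) * b))"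
  by (auto simp: int_span_def)

lemma int_span_0: "0 \<in> int_span B"
  unfolding int_span_iff by (rule exI[of _ "\<lambda>_. 0"]) simp

lemma int_span_add: "x \<in> int_span B \<Longrightarrow> y \<in> int_span B \<Longrightarrow> x + y \<in> int_span B"
proof -
  assume "x \<in> int_span B" "y \<in> int_span B"
  then obtain c d where "x = (\<Sum>b\<in>B. of_int (c b) * b)" "y = (\<Sum>b\<in>B. of_int (d b) * b)"
    by (auto simp: int_span_iff)
  then show ?thesis unfolding int_span_iff
    by (intro exI[of _ "\<lambda>b. c b + d b"]) (simp add: sum.distrib distrib_right)
qed

lemma int_span_scale: "x \<in> int_span B \<Longrightarrow> of_int k * x \<in> int_span B"
proof -
  assume "x \<in> int_span B"
  then obtain c where "x = (\<Sum>b\<in>B. of_int (c b) * b)" by (auto simp: int_span_iff)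
  then show ?thesis unfolding int_span_iff
    by (intro exI[of _ "\<lambda>b. k * c b"]) (simp add: sum_distrib_left mult.assoc)
qed

lemma int_span_uminus: "x \<in> int_span B \<Longrightarrow> - x \<in> int_span B"
  using int_span_scale[of x B "-1"] by simp

lemma int_span_sum: "(\<And>i. i \<in> A \<Longrightarrow> f i \<in> int_span B) \<Longrightarrow> sum f A \<in> int_span B"
  by (induction A rule: infinite_finite_induct) (auto intro: int_span_0 int_span_add)

lemma int_span_base:
  assumes "finite B" "b \<in> B"
  shows "b \<in> int_span B"
  unfolding int_span_iff
  using assms by (intro exI[of _ "\<lambda>x. if x = b then 1 else 0"]) (simp add: if_distrib[of of_int] if_distrib[of "\<lambda>x. x * _"] sum.delta cong: if_cong)

lemma int_span_mult:
  assumes fin: "finite B" "finite C" and x: "x \<in> int_span B" and y: "y \<in> int_span C"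
  shows "x * y \<in> int_span ((\<lambda>(b, c). b * c) ` (B \<times> C))"
proof -
  obtain d e where "x = (\<Sum>b\<in>B. of_int (d b) * b)" "y = (\<Sum>c\<in>C. of_int (e c) * c)"
    using x y by (auto simp: int_span_iff)
  then have "x * y = (\<Sum>b\<in>B. \<Sum>c\<in>C. of_int (d b * e c) * (b * c))"
    by (simp add: sum_product mult_ac)
  also have "\<dots> \<in> int_span ((\<lambda>(b, c). b * c) ` (B \<times> C))"
    using fin by (intro int_span_sum int_span_scale int_span_base) auto
  finally show ?thesis .
qed

text \<open>With \<open>s = p\<^bsup>k-1\<^esup>\<close>, the relation \<open>1 + x\<^sup>s + \<dots> + x\<^bsup>(p-1)s\<^esup> = 0\<close> eliminates the powers of \<open>x = \<xi>\<^bsub>p^k\<^esub>\<close> with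
  exponents from \<open>\<phi>(p\<^sup>k) = (p - 1) s\<close> on.\<close>

lemma prime_power_roots_of_unity_span:
  assumes p: "Factorial_Ring.prime p" and k: "k > 0"
  shows "\<exists>B \<subseteq> {z. z ^ (p ^ k) = 1}. finite B \<and> card B \<le> totient (p ^ k) \<and>
           {z. z ^ (p ^ k) = 1} \<subseteq> int_span B"
proof -
  define x where "x = xi (p ^ k)"
  define s where "s = p ^ (k - 1)"
  have s: "p ^ k = s * p" unfolding s_def using k by (metis power_minus_mult)
  have p0: "p > 0" using p by (rule prime_gt_0_nat)
  have pk: "p ^ k > 0" using p0 by simp
  have tot: "totient (p ^ k) = s * (p - 1)" using p k by (simp add: totient_prime_power s_def)
  have x: "x ^ (p ^ k) = 1" unfolding x_def using pk by (rule xi_power_self)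
  let ?B = "(\<lambda>i. x ^ i) ` {..<totient (p ^ k)}"
  have "z \<in> int_span ?B" if "z ^ (p ^ k) = 1" for z
  proof -
    obtain j where j: "j < p ^ k" "z = x ^ j"
      using root_of_unity_is_power[OF pk \<open>z ^ (p ^ k) = 1\<close>] unfolding x_def by blast
    show ?thesis
    proof (cases "j < totient (p ^ k)")
      case True
      then show ?thesis unfolding j(2) by (intro int_span_base) auto
    next
      case False
      then obtain i where i: "j = s * (p - 1) + i" unfolding tot by (metis le_Suc_ex not_less)
      have "s * p = s * (p - 1) + s" using p0 by (cases p) auto
      then have "i < s" using j(1) i s by linarith
      have "x ^ s \<noteq> 1" unfolding x_def xi_power_eq_1_iff[OF pk]
        using p k prime_gt_1_nat[OF p] unfolding s_def
        by (metis One_nat_def Suc_pred lessI not_less power_dvd_imp_le)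
      moreover have "(x ^ s) ^ p = 1" using x s by (simp add: power_mult)
      ultimately have "(\<Sum>t<p. (x ^ s) ^ t) = 0" by (rule root_of_unity_sum_0[rotated])
      then have "(\<Sum>t<p - 1. (x ^ s) ^ t) + (x ^ s) ^ (p - 1) = 0"
        using p0 by (metis One_nat_def Suc_pred sum.lessThan_Suc)
      then have "(x ^ s) ^ (p - 1) * x ^ i = - (\<Sum>t<p - 1. (x ^ s) ^ t) * x ^ i"
        by (metis add.commute eq_neg_iff_add_eq_0)
      then have "z = - (\<Sum>t<p - 1. x ^ (s * t + i))"
        by (simp add: j(2) i sum_distrib_right power_add power_mult)
      also have "\<dots> \<in> int_span ?B"
      proof (intro int_span_uminus int_span_sum int_span_base imageI)
        fix t assume "t \<in> {..<p - 1}"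
        then have "s * (t + 1) \<le> s * (p - 1)" by (intro mult_le_mono) auto
        then show "s * t + i \<in> {..<totient (p ^ k)}" using \<open>i < s\<close> unfolding tot by simp
      qed auto
      finally show ?thesis .
    qed
  qed
  moreover have "card ?B \<le> totient (p ^ k)" by (metis card_image_le card_lessThan finite_lessThan)
  moreover have "(x ^ i) ^ (p ^ k) = 1" for i
    using x by (metis mult.commute power_mult power_one)
  then have "?B \<subseteq> {z. z ^ (p ^ k) = 1}" by blast
  ultimately show ?thesis by (intro exI[of _ ?B]) auto
qed

text \<open>For coprime \<open>a\<close> and \<open>b\<close>, the products of generators for the orders \<open>a\<close> and \<open>b\<close> are generators for the
  order \<open>a b\<close>, and \<open>\<phi>\<close> is multiplicative.\<close>

lemma roots_of_unity_span:
  assumes "m > 0"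
  shows "\<exists>B \<subseteq> {z. z ^ m = 1}. finite B \<and> card B \<le> totient m \<and> {z. z ^ m = 1} \<subseteq> int_span B"
  using assms
proof (induction m rule: less_induct)
  case (less m)
  show ?case
  proof (cases "m = 1")
    case True
    then show ?thesis
      by (intro exI[of _ "{1}"]) (auto intro: int_span_base)
  next
    case False
    then obtain p where p: "Factorial_Ring.prime p" "p dvd m" using prime_factor_nat by blast
    define k where "k = multiplicity p m"
    obtain m' where m': "m = p ^ k * m'" "\<not> p dvd m'"
      using multiplicity_decompose'[of m p] less.prems p(1) unfolding k_def
      by (metis neq0_conv not_prime_unit)
    have k: "k > 0" using m' p(2) by (cases k) auto
    have m'0: "m' > 0" using m' less.prems by (cases m') auto
    have "p ^ k > 1" using p k prime_gt_1_nat one_less_power by blast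
    then have lt: "m' < m" using m'(1) m'0 by simp
    have cop: "coprime (p ^ k) m'" using m'(2) p(1) by (simp add: prime_imp_coprime)
    obtain B where B: "B \<subseteq> {z. z ^ (p ^ k) = 1}" "finite B" "card B \<le> totient (p ^ k)"
      "{z. z ^ (p ^ k) = 1} \<subseteq> int_span B"
      using prime_power_roots_of_unity_span[OF p(1) k] by blast
    obtain C where C: "C \<subseteq> {z. z ^ m' = 1}" "finite C" "card C \<le> totient m'"
      "{z. z ^ m' = 1} \<subseteq> int_span C"
      using less.IH[OF lt m'0] by blast
    let ?D = "(\<lambda>(b, c). b * c) ` (B \<times> C)"
    have "card ?D \<le> card (B \<times> C)" using B C by (intro card_image_le) auto
    also have "\<dots> \<le> totient (p ^ k) * totient m'"
      using B C by (simp add: card_cartesian_product mult_le_mono)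
    also have "\<dots> = totient m" using m'(1) cop by (simp add: totient_mult_coprime)
    finally have "card ?D \<le> totient m" .
    moreover have "?D \<subseteq> {z. z ^ m = 1}"
    proof
      fix z assume "z \<in> ?D"
      then obtain b c where bc: "b \<in> B" "c \<in> C" "z = b * c" by auto
      then have "b ^ (p ^ k) = 1" "c ^ m' = 1" using B(1) C(1) by auto
      then have "b ^ (p ^ k * m') = 1" "c ^ (m' * p ^ k) = 1" unfolding power_mult by simp_all
      then show "z \<in> {z. z ^ m = 1}" by (simp add: bc(3) m'(1) power_mult_distrib mult.commute)
    qed
    moreover have "z \<in> int_span ?D" if "z ^ m = 1" for z
    proof -
      obtain j where j: "z = xi m ^ j" using root_of_unity_is_power[OF less.prems \<open>z ^ m = 1\<close>] by blast
      obtain u v where "xi m = xi (p ^ k) ^ u * xi m' ^ v"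
        using xi_coprime_product[OF cop] p m'0 m'(1) prime_gt_0_nat[OF p(1)] by auto
      then have z: "z = xi (p ^ k) ^ (u * j) * xi m' ^ (v * j)"
        unfolding j by (simp add: power_mult_distrib power_mult)
      have "(xi (p ^ k) ^ (u * j)) ^ (p ^ k) = 1" "(xi m' ^ (v * j)) ^ m' = 1"
        using xi_power_self[of "p ^ k"] xi_power_self[OF m'0] prime_gt_0_nat[OF p(1)]
        by (metis mult.commute power_mult power_one zero_less_power)+
      then show ?thesis unfolding z using B C by (intro int_span_mult) auto
    qed
    ultimately show ?thesis using B C by (intro exI[of _ ?D]) auto
  qed
qed

section \<open>The ideals above a prime number\<close>

text \<open>The number \<open>f\<close> is the order of \<open>p\<close> modulo \<open>m\<close>. For \<open>m = 1\<close> it is 1.\<close>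

locale prime_above =
  fixes n p a m f :: nat
  assumes n_pos: "n > 0" and p: "Factorial_Ring.prime p" and N: "lcm 2 n = p ^ a * m"
    and a_pos: "a > 0" and p_m: "\<not> p dvd m" and f_pos: "f > 0" and f_cong: "[p ^ f = 1] (mod m)"
    and f_min: "\<And>k. 0 < k \<Longrightarrow> [p ^ k = 1] (mod m) \<Longrightarrow> f \<le> k"
begin

abbreviation "M \<equiv> cyclotomic_module n"
abbreviation "PI \<equiv> principal_ideal n"

definition lam :: complex where "lam = 1 - xi (p ^ a)"

lemma p_gt_1: "p > 1" using p by (rule prime_gt_1_nat)

lemma N_pos: "lcm 2 n > 0" using n_pos by (simp add: lcm_pos_nat)

lemma m_pos: "m > 0" using N_pos N by (cases m) auto

lemma pa_pos: "p ^ a > 0" using p_gt_1 by simp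

lemma coprime_pa_m: "coprime (p ^ s) m"
  using p p_m by (simp add: prime_imp_coprime)

lemma coprime_p_m: "coprime p m"
  using p p_m by (simp add: prime_imp_coprime)

lemma root_in_M:
  assumes "z ^ lcm 2 n = 1"
  shows "z \<in> M"
proof -
  obtain j where "z = xi (lcm 2 n) ^ j" using root_of_unity_is_power[OF N_pos assms] by blast
  then show ?thesis using module_xi[OF n_pos dvd_refl] by simp
qed

lemma pa_root_in_M: "z ^ (p ^ a) = 1 \<Longrightarrow> z \<in> M"
  by (rule root_in_M) (simp add: N power_mult)

lemma m_root_in_M: "z ^ m = 1 \<Longrightarrow> z \<in> M"
  by (rule root_in_M) (simp add: N mult.commute[of _ m] power_mult)

lemma xi_pa: "xi (p ^ a) ^ (p ^ a) = 1" "xi (p ^ a) \<in> M"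
  using xi_power_self[OF pa_pos] pa_root_in_M by auto

lemma lam_in_M: "lam \<in> M" by (simp add: lam_def xi_pa)

lemma lam_nonzero: "lam \<noteq> 0"
proof
  assume "lam = 0"
  then have "xi (p ^ a) ^ 1 = 1" by (simp add: lam_def)
  then have "p ^ a dvd 1" unfolding xi_power_eq_1_iff[OF pa_pos] .
  then show False using a_pos p_gt_1 by simp
qed

lemma one_minus_power_dvd:
  assumes "z \<in> M"
  shows "1 - z ^ k \<in> PI (1 - z)"
  using assms by (intro principal_idealI[of "\<Sum>i<k. z ^ i"]) (auto simp: one_diff_power_eq intro!: module_sum)

lemma lam_dvd_one_minus:
  assumes "z ^ (p ^ a) = 1"
  shows "1 - z \<in> PI lam"
  using root_of_unity_is_power[OF pa_pos assms] one_minus_power_dvd[OF xi_pa(2)]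
  by (auto simp: lam_def)

lemma split_root:
  fixes z :: complex
  assumes "z ^ lcm 2 n = 1"
  shows "\<exists>x y. z = x * y \<and> x ^ (p ^ a) = 1 \<and> y ^ m = 1"
proof -
  obtain j where j: "z = xi (p ^ a * m) ^ j" using root_of_unity_is_power[OF N_pos assms] N by auto
  obtain u v where uv: "xi (p ^ a * m) = xi (p ^ a) ^ u * xi m ^ v"
    using xi_coprime_product[OF coprime_pa_m pa_pos m_pos] by blast
  have "((xi (p ^ a)) ^ (u * j)) ^ (p ^ a) = 1" "(xi m ^ (v * j)) ^ m = 1"
    using xi_pa(1) xi_power_self[OF m_pos] by (metis mult.commute power_mult power_one)+
  moreover have "z = xi (p ^ a) ^ (u * j) * xi m ^ (v * j)"
    unfolding j uv by (simp add: power_mult_distrib power_mult)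
  ultimately show ?thesis by blast
qed

lemma xi_n_root: "xi n ^ lcm 2 n = 1"
proof -
  obtain e where e: "lcm 2 n = n * e" by (meson dvdE dvd_lcm2)
  show ?thesis unfolding e power_mult xi_power_self[OF n_pos] by simp
qed

lemma p_in_one_minus_xi_p: "of_nat p \<in> PI (1 - xi p)"
proof (rule one_minus_root_of_unity_dvd)
  show "xi p ^ p = 1" using xi_power_self[of p] p_gt_1 by simp
  show "xi p \<noteq> 1" using xi_power_eq_1_iff[of p 1] p_gt_1 by auto
  have "p dvd p ^ a" using a_pos by simp
  then have "p dvd lcm 2 n" unfolding N by simp
  then show "xi p \<in> M" by (rule module_xi[OF n_pos])
qed

lemma xi_p_root: "xi p ^ (p ^ a) = 1"
proof -
  have "p ^ a = p * p ^ (a - 1)" using a_pos by (cases a) auto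
  then show ?thesis using xi_power_self[of p] p_gt_1 by (simp add: power_mult)
qed

lemma p_in_lam: "of_nat p \<in> PI lam"
  using p_in_one_minus_xi_p lam_dvd_one_minus[OF xi_p_root] principal_ideal_trans by blast

text \<open>\<open>(1 - \<xi>)\<^sup>q \<equiv> 1 - \<xi>\<^sup>q = 0\<close> modulo \<open>p\<close>, for \<open>q = p\<^sup>a\<close> the order of \<open>\<xi>\<close>.\<close>

lemma lam_power_in_p: "lam ^ (p ^ a) \<in> PI (of_nat p)"
proof -
  have "((1 - xi (p ^ a)) + xi (p ^ a)) ^ (p ^ a) - (1 - xi (p ^ a)) ^ (p ^ a) - xi (p ^ a) ^ (p ^ a) \<in> PI (of_nat p)"
    using xi_pa(2) by (intro frobenius_additive p) auto
  then have "- (lam ^ (p ^ a)) \<in> PI (of_nat p)" by (simp add: xi_pa lam_def)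
  then show ?thesis using ideal_closed(7)[OF ideal_principal, of "of_nat p" n] by fastforce
qed

lemma p_power_lam_power: "\<exists>k. lam ^ k \<in> PI (of_nat p ^ j)"
  using principal_ideal_power_mono[OF lam_power_in_p, of j] by (metis power_mult)

lemma p_not_unit: "1 \<notin> PI (of_nat p)"
  using of_nat_not_unit[OF n_pos p_gt_1] .

lemma lam_not_unit: "1 \<notin> PI lam"
proof
  assume "1 \<in> PI lam"
  then have "1 ^ (p ^ a) \<in> PI (lam ^ (p ^ a))" by (rule principal_ideal_power_mono)
  then show False using p_not_unit lam_power_in_p principal_ideal_trans by fastforce
qed

lemma root_congruent_m_root:
  assumes "z ^ lcm 2 n = 1"
  shows "\<exists>y. y ^ m = 1 \<and> z - y \<in> PI lam"
proof -
  obtain x y where xy: "z = x * y" "x ^ (p ^ a) = 1" "y ^ m = 1" using split_root[OF assms] by blast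
  have "(1 - x) * (- y) \<in> PI lam"
    using lam_dvd_one_minus[OF xy(2)] m_root_in_M[OF xy(3)]
    by (intro ideal_closed(5)[OF ideal_principal[OF lam_in_M]]) auto
  then show ?thesis using xy by (auto simp: algebra_simps)
qed

text \<open>Modulo \<open>lam\<close>, \<open>\<xi>\<^sub>n\<close> is a root of unity whose order divides \<open>m\<close>, which divides \<open>p\<^sup>f - 1\<close>.\<close>

lemma frobenius_fixes: "z \<in> M \<Longrightarrow> z ^ (p ^ f) - z \<in> PI lam"
proof (rule frobenius_fixes_module[OF p ideal_principal[OF lam_in_M] p_in_lam])
  obtain y where y: "y ^ m = 1" "xi n - y \<in> PI lam" using root_congruent_m_root[OF xi_n_root] by blast
  note I = ideal_principal[OF lam_in_M]
  have "y ^ (p ^ f) = y ^ 1" using f_cong y(1) by (metis cong_def root_of_unity_power_mod)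
  moreover have "xi n ^ (p ^ f) - y ^ (p ^ f) \<in> PI lam"
    using ideal_power_diff[OF I y(2)] m_root_in_M[OF y(1)] by simp
  ultimately have "xi n ^ (p ^ f) - y \<in> PI lam" by simp
  from ideal_closed(4)[OF I this y(2)] show "xi n ^ (p ^ f) - xi n \<in> PI lam" by simp
qed

text \<open>A ring in which \<open>z\<^sup>q = z\<close> for some \<open>q \<ge> 2\<close> has no nilpotent elements.\<close>

lemma lam_reduced:
  assumes "z \<in> M" "z ^ 2 \<in> PI lam"
  shows "z \<in> PI lam"
proof -
  note I = ideal_principal[OF lam_in_M]
  have "2 \<le> p ^ f" using p_gt_1 f_pos by (metis Suc_1 Suc_leI one_less_power)
  then have "z ^ (p ^ f) = z ^ 2 * z ^ (p ^ f - 2)"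
    by (metis le_add_diff_inverse power_add)
  also have "\<dots> \<in> PI lam" using ideal_closed(5)[OF I assms(2)] assms(1) by simp
  finally have "z ^ (p ^ f) - (z ^ (p ^ f) - z) \<in> PI lam"
    using ideal_closed(4)[OF I] frobenius_fixes[OF assms(1)] by blast
  then show ?thesis by simp
qed

text \<open>Modulo \<open>lam\<close>, every \<open>p\<^sup>a m\<close>-th root of unity is congruent to an \<open>m\<close>-th one, and the additive group
  generated by the latter is generated by \<open>\<phi>(m)\<close> of them.\<close>

lemma module_index_lam: "0 < module_index n (PI lam)" "module_index n (PI lam) \<le> p ^ totient m"
proof -
  note I = ideal_principal[OF lam_in_M]
  obtain B where B: "B \<subseteq> {z. z ^ m = 1}" "finite B" "card B \<le> totient m" "{z. z ^ m = 1} \<subseteq> int_span B"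
    using roots_of_unity_span[OF m_pos] by blast
  have BM: "B \<subseteq> M" using B(1) m_root_in_M by auto
  have mult_span: "x * y \<in> int_span B" if xy: "x \<in> int_span B" "y \<in> int_span B" for x y
  proof -
    obtain c d where cd: "x = (\<Sum>b\<in>B. of_int (c b) * b)" "y = (\<Sum>b\<in>B. of_int (d b) * b)"
      using xy unfolding int_span_iff by blast
    have "x * y = (\<Sum>b\<in>B. \<Sum>b'\<in>B. of_int (c b * d b') * (b * b'))"
      unfolding cd by (simp add: sum_product mult_ac)
    also have "\<dots> \<in> int_span B"
    proof (intro int_span_sum int_span_scale)
      fix b b' assume "b \<in> B" "b' \<in> B"
      then have "b ^ m = 1" "b' ^ m = 1" using B(1) by auto
      then have "(b * b') ^ m = 1" by (simp add: power_mult_distrib)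
      then show "b * b' \<in> int_span B" using B(4) by blast
    qed
    finally show ?thesis .
  qed
  have spanM: "int_span B \<subseteq> M"
  proof
    fix x assume "x \<in> int_span B"
    then obtain c where "x = (\<Sum>b\<in>B. of_int (c b) * b)" unfolding int_span_iff by blast
    then show "x \<in> M" using BM by (auto intro!: module_sum)
  qed
  have gen: "\<exists>x\<in>int_span B. z - x \<in> PI lam" if "z \<in> M" for z
    using that
  proof (induction rule: module_induct)
    case (of_int k)
    have "of_int k * 1 \<in> int_span B" using B(4) by (intro int_span_scale) auto
    then show ?case using ideal_closed(2)[OF I] by (intro bexI[of _ "of_int k"]) auto
  next
    case xi
    then show ?case using root_congruent_m_root[OF xi_n_root] B(4) by blast
  next
    case (add x y)
    then obtain u v where uv: "u \<in> int_span B" "x - u \<in> PI lam" "v \<in> int_span B" "y - v \<in> PI lam" by blast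
    then show ?case using ideal_closed(3)[OF I uv(2) uv(4)] int_span_add[OF uv(1,3)]
      by (intro bexI[of _ "u + v"]) (auto simp: algebra_simps)
  next
    case (mult x y)
    then obtain u v where uv: "u \<in> int_span B" "x - u \<in> PI lam" "v \<in> int_span B" "y - v \<in> PI lam" by blast
    have "u \<in> M" using uv(1) spanM by blast
    then have "(x - u) * y + u * (y - v) \<in> PI lam"
      using ideal_closed(3)[OF I ideal_closed(5)[OF I uv(2) mult(2)] ideal_closed(6)[OF I uv(4)]] by blast
    moreover have "(x - u) * y + u * (y - v) = x * y - u * v" by (simp add: algebra_simps)
    ultimately show ?case using mult_span[OF uv(1,3)] by (intro bexI[of _ "u * v"]) auto
  qed
  have gen': "\<exists>c :: complex \<Rightarrow> int. z - (\<Sum>b\<in>B. of_int (c b) * b) \<in> PI lam" if "z \<in> M" for z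
    using gen[OF that] by (auto simp: int_span_iff)
  have p0: "p > 0" using p_gt_1 by simp
  note bound = module_index_le_of_generators[OF I p_in_lam p0 B(2) BM gen']
  from bound(1) show "0 < module_index n (PI lam)" .
  have "module_index n (PI lam) \<le> p ^ card B" by (rule bound(2))
  also have "\<dots> \<le> p ^ totient m" using B(3) p0 by (intro power_increasing) auto
  finally show "module_index n (PI lam) \<le> p ^ totient m" .
qed

lemma dvd_lam_power:
  assumes "q \<in> M" "lam ^ k \<in> PI q"
  shows "0 < module_index n (PI q)" "q \<noteq> 0"
proof -
  have "module_index n (PI (lam ^ k)) = module_index n (PI lam) ^ k"
    by (rule module_index_power[OF lam_in_M lam_nonzero module_index_lam(1)])
  moreover have "PI (lam ^ k) \<subseteq> PI q" using assms(2) principal_ideal_trans by blast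
  ultimately show "0 < module_index n (PI q)"
    using module_index_mono(1)[OF ideal_principal ideal_principal[OF assms(1)], of "lam ^ k"]
      lam_in_M module_index_lam(1) by simp
  show "q \<noteq> 0" using assms(2) lam_nonzero by (auto simp: in_principal_ideal_iff)
qed

text \<open>The index is a multiple of \<open>q\<close>, since it annihilates the quotient.\<close>

lemma dvd_lam_power_of_index:
  assumes q: "q \<in> M" and l: "module_index n (PI q) = p ^ t"
  shows "\<exists>k. lam ^ k \<in> PI q"
proof -
  have "0 < module_index n (PI q)" using l p_gt_1 by simp
  then have "of_nat (p ^ t) \<in> PI q"
    using module_index_in_ideal[OF ideal_principal[OF q]] l by simp
  then have "of_nat p ^ t \<in> PI q" by simp
  then show ?thesis using p_power_lam_power[of t] principal_ideal_trans by blast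
qed

lemma ideal_index_ge:
  assumes I: "ideal I (cyclotomic_ring n)" and "lam \<in> I" "1 \<notin> I"
  shows "p ^ f \<le> module_index n I"
proof (rule module_index_ge[OF n_pos I _ p _ coprime_p_m])
  have sub: "PI lam \<subseteq> I" using ideal_closed(5)[OF I \<open>lam \<in> I\<close>] by (auto simp: in_principal_ideal_iff)
  show "of_nat p \<in> I" using p_in_lam sub by auto
  show "m dvd lcm 2 n" unfolding N by simp
  show "0 < module_index n I"
    by (rule module_index_mono(1)[OF ideal_principal[OF lam_in_M] I sub module_index_lam(1)])
qed (use assms f_min in auto)

end

text \<open>As \<open>p\<^sup>f\<close> is the least possible index of a proper ideal containing \<open>lam\<close>, the ideal \<open>(r)\<close> is maximal.\<close>

locale prime_factor_above = prime_above +
  fixes r :: complex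
  assumes r: "r \<in> M" and lam_r: "lam \<in> PI r" and index_r: "module_index n (PI r) = p ^ f"
begin

lemma r_nonzero: "r \<noteq> 0"
  using lam_r lam_nonzero by (auto simp: in_principal_ideal_iff)

lemma r_not_unit: "1 \<notin> PI r"
proof
  assume "1 \<in> PI r"
  then have "p ^ f = 1" using index_r module_index_1_iff[OF ideal_principal[OF r]] by simp
  then show False using p_gt_1 f_pos by simp
qed

lemma r_maximal:
  assumes I: "ideal I (cyclotomic_ring n)" and "r \<in> I" "1 \<notin> I"
  shows "I = PI r"
proof -
  have sub: "PI r \<subseteq> I" using ideal_closed(5)[OF I \<open>r \<in> I\<close>] by (auto simp: in_principal_ideal_iff)
  have pos: "0 < module_index n (PI r)" using index_r p_gt_1 by simp
  note mono = module_index_mono[OF ideal_principal[OF r] I sub pos]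
  have "p ^ f \<le> module_index n I" using lam_r sub assms by (intro ideal_index_ge) auto
  then show ?thesis using mono(2,3) index_r by simp
qed

text \<open>By maximality, the ideal \<open>J\<close> generated by \<open>r\<close> and \<open>x\<close> is \<open>(r)\<close> or contains 1.\<close>

lemma r_dvd_mult:
  assumes x: "x \<in> M" "y \<in> M" "x * y \<in> PI r"
  shows "x \<in> PI r \<or> y \<in> PI r"
proof -
  define J where "J = {r * u + x * v | u v. u \<in> M \<and> v \<in> M}"
  have J: "ideal J (cyclotomic_ring n)"
  proof (rule idealI)
    show "ring (cyclotomic_ring n)" using cring_cyclotomic_ring cring.axioms(1) by blast
    have zero: "0 \<in> J" unfolding J_def by (rule CollectI, rule exI[of _ 0], rule exI[of _ 0]) simp
    have add: "y + z \<in> J" if yz: "y \<in> J" "z \<in> J" for y z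
    proof -
      obtain u v u' v' where "y = r * u + x * v" "z = r * u' + x * v'" "u \<in> M" "v \<in> M" "u' \<in> M" "v' \<in> M"
        using yz unfolding J_def by blast
      then have "y + z = r * (u + u') + x * (v + v')" "u + u' \<in> M" "v + v' \<in> M"
        by (auto simp: algebra_simps)
      then show ?thesis unfolding J_def by blast
    qed
    have mult: "z * y \<in> J" if yz: "y \<in> J" "z \<in> M" for y z
    proof -
      obtain u v where "y = r * u + x * v" "u \<in> M" "v \<in> M" using yz(1) unfolding J_def by blast
      then have "z * y = r * (z * u) + x * (z * v)" "z * u \<in> M" "z * v \<in> M"
        using yz(2) by (auto simp: algebra_simps)
      then show ?thesis unfolding J_def by blast
    qed
    have sub: "J \<subseteq> M" using r x by (auto simp: J_def)
    show "subgroup J (add_monoid (cyclotomic_ring n))"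
    proof (rule group.subgroupI)
      show "group (add_monoid (cyclotomic_ring n))"
        using cring.axioms(1)[OF cring_cyclotomic_ring] ring.is_abelian_group abelian_group.a_group by blast
      fix y assume y: "y \<in> J"
      interpret R: cring "cyclotomic_ring n" by (rule cring_cyclotomic_ring)
      have "\<ominus>\<^bsub>cyclotomic_ring n\<^esub> y = - y" using y sub by (intro R.minus_equality) auto
      moreover have "- y \<in> J" using mult[OF y, of "-1"] by simp
      ultimately show "inv\<^bsub>add_monoid (cyclotomic_ring n)\<^esub> y \<in> J" by (simp add: a_inv_def)
    qed (use sub zero add in auto)
    show "\<And>z y. z \<in> J \<Longrightarrow> y \<in> carrier (cyclotomic_ring n) \<Longrightarrow> y \<otimes>\<^bsub>cyclotomic_ring n\<^esub> z \<in> J"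
      using mult by simp
    then show "\<And>z y. z \<in> J \<Longrightarrow> y \<in> carrier (cyclotomic_ring n) \<Longrightarrow> z \<otimes>\<^bsub>cyclotomic_ring n\<^esub> y \<in> J"
      by (simp add: mult.commute)
  qed
  have rJ: "r \<in> J" unfolding J_def by (rule CollectI, rule exI[of _ 1], rule exI[of _ 0]) simp
  have xJ: "x \<in> J" unfolding J_def by (rule CollectI, rule exI[of _ 0], rule exI[of _ 1]) simp
  show ?thesis
  proof (cases "1 \<in> J")
    case True
    then obtain u v where uv: "1 = r * u + x * v" "u \<in> M" "v \<in> M" unfolding J_def by blast
    obtain w where w: "w \<in> M" "x * y = r * w" using x(3) by (auto simp: in_principal_ideal_iff)
    have "y = (r * u + x * v) * y" using uv by simp
    also have "\<dots> = r * (u * y) + (x * y) * v" by (simp add: algebra_simps)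
    also have "\<dots> = r * (u * y + w * v)" unfolding w(2) by (simp add: algebra_simps)
    finally have "y \<in> PI r" using uv w x(2) by (intro principal_idealI[of "u * y + w * v"]) auto
    then show ?thesis ..
  next
    case False
    then show ?thesis using r_maximal[OF J rJ] xJ by blast
  qed
qed

lemma primeideal_r: "primeideal (PI r) (cyclotomic_ring n)"
proof (rule primeidealI[OF ideal_principal[OF r] cring_cyclotomic_ring])
  show "carrier (cyclotomic_ring n) \<noteq> PI r"
    by (metis carrier_cyclotomic_ring(1) module_1 r_not_unit)
  show "x \<in> PI r \<or> y \<in> PI r" if "x \<in> carrier (cyclotomic_ring n)"
    "y \<in> carrier (cyclotomic_ring n)" "x \<otimes>\<^bsub>cyclotomic_ring n\<^esub> y \<in> PI r" for x y
    using that by (intro r_dvd_mult) simp_all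
qed

text \<open>Unique factorization as far as \<open>r\<close> is concerned.\<close>

lemma dvd_r_power_mult:
  assumes "x \<in> M" "b \<in> M" "b \<noteq> 0" "r ^ A * b \<in> PI x"
  shows "\<exists>i\<le>A. \<exists>x'\<in>M. PI x = PI (r ^ i * x') \<and> b \<in> PI x'"
  using assms
proof (induction A arbitrary: x)
  case 0
  then show ?case by (intro exI[of _ 0] conjI bexI[of _ x]) simp_all
next
  case (Suc A)
  obtain y where y: "y \<in> M" "r ^ Suc A * b = x * y" using Suc.prems(4) by (auto simp: in_principal_ideal_iff)
  have "x * y \<in> PI r" unfolding y(2)[symmetric] using r Suc.prems
    by (intro principal_idealI[of "r ^ A * b"]) auto
  then consider "y \<in> PI r" | "x \<in> PI r" using r_dvd_mult Suc.prems(1) y(1) by blast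
  then show ?case
  proof cases
    case 1
    then obtain y' where y': "y' \<in> M" "y = r * y'" by (auto simp: in_principal_ideal_iff)
    have "r * (r ^ A * b) = r * (x * y')" using y(2) y'(2) by (simp add: mult_ac)
    then have "r ^ A * b = x * y'" using r_nonzero by simp
    then have "r ^ A * b \<in> PI x" using y' by (intro principal_idealI)
    then obtain i x' where "i \<le> A" "x' \<in> M" "PI x = PI (r ^ i * x')" "b \<in> PI x'"
      using Suc.IH[OF Suc.prems(1-3)] by blast
    then show ?thesis by (intro exI[of _ i]) auto
  next
    case 2
    then obtain x1 where x1: "x1 \<in> M" "x = r * x1" by (auto simp: in_principal_ideal_iff)
    have "r * (r ^ A * b) = r * (x1 * y)" using y(2) x1(2) by (simp add: mult_ac)
    then have "r ^ A * b = x1 * y" using r_nonzero by simp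
    then have "r ^ A * b \<in> PI x1" using y by (intro principal_idealI)
    then obtain i x' where i: "i \<le> A" "x' \<in> M" "PI x1 = PI (r ^ i * x')" "b \<in> PI x'"
      using Suc.IH[OF x1(1) Suc.prems(2,3)] by blast
    have "PI x = PI (r ^ Suc i * x')"
      using i(3) principal_ideal_mult_mono[OF principal_ideal_refl[of r n]]
      unfolding x1(2) principal_ideal_eq_iff by (simp add: mult.assoc)
    then show ?thesis using i by (intro exI[of _ "Suc i"]) auto
  qed
qed

lemma r_power_not_dvd: 
  assumes "b \<in> M" "b \<notin> PI r" "r ^ j * b \<in> PI (r ^ i)"
  shows "i \<le> j"
proof (rule ccontr)
  assume "\<not> i \<le> j"
  then have "r ^ i = r ^ j * (r * r ^ (i - j - 1))" by (simp flip: power_add power_Suc)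
  moreover have "r ^ j \<noteq> 0" using r_nonzero by simp
  ultimately have "b \<in> PI (r * r ^ (i - j - 1))" using assms(3) principal_ideal_cancel by metis
  moreover have "r * r ^ (i - j - 1) \<in> PI r"
    using r by (intro principal_idealI[of "r ^ (i - j - 1)"]) simp_all
  ultimately show False using assms(2) principal_ideal_trans by blast
qed

end

context prime_above
begin

text \<open>As polynomials in \<open>x\<close>, both sides have degree at most \<open>p\<close>, and they agree at 0 and at the \<open>p\<close>-th roots of
  unity.\<close>

lemma one_minus_power_p_factorization: "1 - x ^ p = (\<Prod>j<p. 1 - xi p ^ j * x)"
proof -
  define P :: "complex poly" where "P = 1 - Polynomial.monom 1 p"
  define Q :: "complex poly" where "Q = (\<Prod>j<p. [:1, - (xi p ^ j):])"
  have p0: "p > 0" using p_gt_1 by simp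
  have inj: "xi p ^ i \<noteq> xi p ^ j" if "i < j" "j < p" for i j
  proof
    assume "xi p ^ i = xi p ^ j"
    moreover have "xi p ^ j = xi p ^ i * xi p ^ (j - i)" using that by (simp flip: power_add)
    moreover have "xi p \<noteq> 0" using xi_power_self[OF p0] p0 by (auto simp: power_0_left)
    ultimately have "xi p ^ (j - i) = 1" by simp
    then have "p dvd j - i" by (simp only: xi_power_eq_1_iff[OF p0])
    then show False using that by (auto dest: dvd_imp_le)
  qed
  have "P = Q"
  proof (rule poly_eqI_degree)
    let ?A = "insert 0 ((\<lambda>j. xi p ^ j) ` {..<p})"
    have nz: "xi p \<noteq> 0" using xi_power_self[OF p0] p0 by (auto simp: power_0_left)
    have "inj_on (\<lambda>j. xi p ^ j) {..<p}"
      by (rule linorder_inj_onI') (use inj in auto)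
    then have card: "card ?A = Suc p" using nz by (subst card_insert_disjoint) (auto simp: card_image)
    show "poly P z = poly Q z" if "z \<in> ?A" for z
    proof (cases "z = 0")
      case True
      then show ?thesis using p0 by (simp add: P_def Q_def poly_prod poly_monom power_0_left)
    next
      case False
      then obtain i where i: "i < p" "z = xi p ^ i" using \<open>z \<in> ?A\<close> by auto
      have "z ^ p = 1" unfolding i(2) using xi_power_self[OF p0] by (metis mult.commute power_mult power_one)
      then have "poly P z = 0" by (simp add: P_def poly_monom)
      moreover have "poly Q z = 0"
      proof -
        define j where "j = (p - i) mod p"
        have "xi p ^ j * xi p ^ i = xi p ^ (p - i + i)"
          unfolding j_def root_of_unity_power_mod[OF xi_power_self[OF p0]] by (simp add: power_add)
        then have "xi p ^ j * xi p ^ i = 1" using i xi_power_self[OF p0] by simp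
        then have "1 - z * xi p ^ j = 0" by (simp add: i(2) mult.commute)
        moreover have "j < p" unfolding j_def using p0 by simp
        ultimately show ?thesis unfolding Q_def by (auto simp: poly_prod intro!: bexI[of _ j])
      qed
      ultimately show ?thesis by simp
    qed
    have "degree P \<le> p" unfolding P_def by (intro degree_diff_le) (simp_all add: degree_monom_le)
    then show "degree P < card ?A" unfolding card by simp
    have "degree Q \<le> (\<Sum>j<p. degree [:1, - (xi p ^ j):])"
      unfolding Q_def using degree_prod_sum_le[of "{..<p}" "\<lambda>j. [:1, - (xi p ^ j):]"] by (simp add: o_def)
    also have "\<dots> \<le> (\<Sum>j<p. 1)" by (intro sum_mono) simp
    finally show "degree Q < card ?A" unfolding card by simp
  qed
  then have "poly P x = poly Q x" by simp
  then show ?thesis by (simp add: P_def Q_def poly_prod poly_monom mult.commute)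
qed

lemma principal_ideal_prod_eq:
  assumes "\<And>i. i \<in> A \<Longrightarrow> PI (g i) = PI (h i)"
  shows "PI (prod g A) = PI (prod h A)"
proof -
  have "prod g A \<in> PI (prod h A)" if "\<And>i. i \<in> A \<Longrightarrow> PI (g i) = PI (h i)" for g h
    using that
    by (induction A rule: infinite_finite_induct) (auto simp: principal_ideal_eq_iff intro!: principal_ideal_mult_mono)
  then show ?thesis using assms unfolding principal_ideal_eq_iff by metis
qed

text \<open>For \<open>s > 0\<close>, every \<open>\<xi>\<^sub>p\<^sup>j \<eta>\<close> with \<open>\<eta> = \<xi>\<^bsub>p^(s+1)\<^esub>\<close> is again a primitive root of unity, so that the
  factors of \<open>1 - \<eta>\<^sup>p\<close> are associates of \<open>1 - \<eta>\<close>.\<close>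

lemma one_minus_xi_prime_power_step:
  assumes s: "0 < s" "s < a"
  shows "PI (1 - xi (p ^ s)) = PI ((1 - xi (p ^ Suc s)) ^ p)"
proof -
  define h where "h = xi (p ^ Suc s)"
  have pos: "p ^ Suc s > 0" "p > 0" using p_gt_1 by simp_all
  have h1: "h ^ (p ^ Suc s) = 1" unfolding h_def using pos(1) by (rule xi_power_self)
  have "p ^ Suc s dvd p ^ a" using s by (intro le_imp_power_dvd) auto
  then obtain e where e: "p ^ a = p ^ Suc s * e" by auto
  have hM: "h \<in> M" using h1 e by (intro pa_root_in_M) (simp only: power_mult power_one)
  have hp: "h ^ p = xi (p ^ s)" unfolding h_def using xi_mult_power[OF pos(2), of "p ^ s"] by simp
  have hs: "h ^ (p ^ s) = xi p" unfolding h_def using xi_mult_power[of "p ^ s" p] p_gt_1 by (simp add: mult.commute)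
  have "PI (1 - xi p ^ j * h) = PI (1 - h)" for j
  proof -
    define k where "k = Suc (p ^ s * j)"
    have hk: "xi p ^ j * h = h ^ k" unfolding k_def power_Suc power_mult hs by (rule mult.commute)
    have "coprime p k"
    proof -
      have "p dvd p ^ s * j" using s by simp
      then have "\<not> p dvd k" unfolding k_def using p_gt_1
        by (metis dvd_add_right_iff nat_dvd_1_iff_1 less_irrefl plus_1_eq_Suc Suc_eq_plus1)
      then show ?thesis using p by (simp add: prime_imp_coprime)
    qed
    then have "coprime k (p ^ Suc s)" by (simp add: coprime_commute)
    then obtain k' where k': "[k * k' = 1] (mod p ^ Suc s)"
      using cong_solve_coprime_nat[of k "p ^ Suc s"] by (auto simp only: One_nat_def)
    have "(h ^ k) ^ k' = h ^ (k * k')" by (simp add: power_mult)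
    also have "\<dots> = h ^ 1" using k' h1 by (metis cong_def root_of_unity_power_mod)
    finally have "(h ^ k) ^ k' = h" by simp
    then have "1 - h \<in> PI (1 - h ^ k)" using one_minus_power_dvd[of "h ^ k" k'] hM by simp
    then show ?thesis unfolding principal_ideal_eq_iff hk using one_minus_power_dvd[OF hM] by blast
  qed
  then have "PI (\<Prod>j<p. 1 - xi p ^ j * h) = PI (\<Prod>j<p. 1 - h)"
    by (intro principal_ideal_prod_eq) auto
  then show ?thesis using one_minus_power_p_factorization[of h] unfolding hp by (simp add: h_def)
qed

lemma one_minus_xi_prime_power:
  assumes "0 < s" "s \<le> a"
  shows "PI (1 - xi (p ^ s)) = PI (lam ^ (p ^ (a - s)))"
  using assms
proof (induction "a - s" arbitrary: s)
  case 0
  then have "s = a" by simp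
  then show ?case by (simp only: lam_def diff_self_eq_0 power_0 power_one_right)
next
  case (Suc d)
  have "PI (1 - xi (p ^ Suc s)) = PI (lam ^ (p ^ (a - Suc s)))" by (rule Suc.hyps(1)) (use Suc in auto)
  then have "PI ((1 - xi (p ^ Suc s)) ^ p) = PI ((lam ^ (p ^ (a - Suc s))) ^ p)"
    unfolding principal_ideal_eq_iff by (auto intro: principal_ideal_power_mono)
  moreover have "p ^ (a - Suc s) * p = p ^ (a - s)" using Suc by (metis Suc_diff_Suc power_Suc2 zero_less_Suc zero_less_diff)
  ultimately show ?case
    using one_minus_xi_prime_power_step[of s] Suc by (simp add: power_mult[symmetric])
qed

text \<open>Otherwise \<open>m\<close> would be a multiple of \<open>1 - z\<^bsup>p^a\<^esup>\<close> and hence of \<open>q\<close>, and so would be a power of \<open>p\<close>,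
  which is prime to \<open>m\<close>.\<close>

lemma root_congruent_1_order:
  assumes q: "q \<in> M" "1 \<notin> PI q" "lam ^ K \<in> PI q" and z: "z ^ lcm 2 n = 1" "1 - z \<in> PI q"
  shows "z ^ (p ^ a) = 1"
proof (rule ccontr)
  assume neq: "z ^ (p ^ a) \<noteq> 1"
  have zM: "z \<in> M" using z(1) by (rule root_in_M)
  have "(z ^ (p ^ a)) ^ m = 1" using z(1) unfolding N by (simp add: power_mult)
  then have "of_nat m \<in> PI (1 - z ^ (p ^ a))" using neq zM by (intro one_minus_root_of_unity_dvd) auto
  moreover have "1 - z ^ (p ^ a) \<in> PI q"
    using one_minus_power_dvd[OF zM] z(2) principal_ideal_trans by blast
  ultimately have mq: "of_nat m \<in> PI q" using principal_ideal_trans by blast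
  have I: "ideal (PI q) (cyclotomic_ring n)" using q(1) by (rule ideal_principal)
  have "of_nat p ^ K \<in> PI q"
    using principal_ideal_power_mono[OF p_in_lam, of K] q(3) principal_ideal_trans by blast
  then have pq: "of_nat (p ^ K) \<in> PI q" by simp
  obtain u v where uv: "u * int (p ^ K) + v * int m = 1"
    using coprime_pa_m[of K] bezout_int[of "int (p ^ K)" "int m"] by auto
  have "of_int u * of_nat (p ^ K) + of_int v * of_nat m \<in> PI q"
    using ideal_closed(3)[OF I ideal_closed(6)[OF I pq, of "of_int u"] ideal_closed(6)[OF I mq, of "of_int v"]]
    by simp
  moreover have "of_int u * of_nat (p ^ K) + of_int v * of_nat m = (of_int (u * int (p ^ K) + v * int m) :: complex)"
    by simp
  ultimately show False using q(2) unfolding uv by simp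
qed

end

section \<open>The roots of unity congruent to 1\<close>

definition roots_congruent_1 :: "nat \<Rightarrow> complex \<Rightarrow> nat \<Rightarrow> bool" where
  "roots_congruent_1 n q k \<longleftrightarrow>
     0 < k \<and> k dvd lcm 2 n \<and> (\<forall>z. z ^ lcm 2 n = 1 \<longrightarrow> (1 - z \<in> principal_ideal n q \<longleftrightarrow> z ^ k = 1))"

text \<open>Some power of \<open>z\<close> has prime order \<open>p\<close>, and \<open>\<xi>\<^sub>p\<close> is a power of it.\<close>

lemma exists_prime_one_minus_xi:
  assumes n: "n > 0" and z: "z ^ lcm 2 n = 1" "z \<noteq> 1" "1 - z \<in> principal_ideal n q"
  shows "\<exists>p. Factorial_Ring.prime p \<and> p dvd lcm 2 n \<and> 1 - xi p \<in> principal_ideal n q"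
proof -
  have N: "lcm 2 n > 0" using n by (simp add: lcm_pos_nat)
  define d where "d = (LEAST d. d > 0 \<and> z ^ d = 1)"
  have d: "d > 0" "z ^ d = 1"
    using LeastI[of "\<lambda>d. d > 0 \<and> z ^ d = 1" "lcm 2 n"] N z(1) unfolding d_def by auto
  have least: "d \<le> e" if "e > 0" "z ^ e = 1" for e
    unfolding d_def using that by (intro Least_le) auto
  have "z ^ (lcm 2 n mod d) = 1" using z(1) root_of_unity_power_mod[OF d(2), of "lcm 2 n"] by simp
  then have dN: "d dvd lcm 2 n"
    using least[of "lcm 2 n mod d"] d(1) by (metis dvd_eq_mod_eq_0 gr0I mod_less_divisor not_le)
  have "d \<noteq> 1" using d z(2) by auto
  then obtain p where p: "Factorial_Ring.prime p" "p dvd d" using prime_factor_nat by blast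
  obtain e where e: "d = e * p" using p(2) by (metis dvdE mult.commute)
  have p1: "p > 1" using p(1) by (rule prime_gt_1_nat)
  define y where "y = z ^ e"
  have "e > 0" using d(1) e by (cases e) auto
  moreover have "e < d" unfolding e using p1 \<open>e > 0\<close> by simp
  ultimately have y1: "y \<noteq> 1" unfolding y_def using least[of e] by auto
  have yp: "y ^ p = 1" unfolding y_def using d(2) by (simp add: e power_mult)
  obtain j where j: "j < p" "y = xi p ^ j" using root_of_unity_is_power[OF _ yp] p1 by auto
  have "\<not> p dvd j" using j y1 by (auto dest: dvd_imp_le intro: gr0I)
  then have "coprime j p" using p(1) by (metis coprime_commute prime_imp_coprime)
  then obtain i where i: "[j * i = 1] (mod p)"
    using cong_solve_coprime_nat[of j p] by (auto simp only: One_nat_def)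
  have xp: "xi p ^ p = 1" using xi_power_self[of p] p1 by simp
  have "z ^ (e * i) = xi p ^ (j * i)" using j(2) unfolding y_def by (simp add: power_mult)
  also have "\<dots> = xi p ^ 1" using i xp by (metis cong_def root_of_unity_power_mod)
  finally have zi: "z ^ (e * i) = xi p" by simp
  have zM: "z \<in> cyclotomic_module n"
    using root_of_unity_is_power[OF N z(1)] module_xi[OF n dvd_refl] by (metis module_power)
  have "1 - xi p \<in> principal_ideal n (1 - z)"
    unfolding zi[symmetric] one_diff_power_eq using zM
    by (intro principal_idealI[of "\<Sum>l<e * i. z ^ l"]) (auto intro!: module_sum)
  then have "1 - xi p \<in> principal_ideal n q" using z(3) principal_ideal_trans by blast
  moreover have "p dvd lcm 2 n" using p(2) dN by (rule dvd_trans)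
  ultimately show ?thesis using p(1) by blast
qed

context prime_above
begin

lemma one_minus_xi_p: "PI (1 - xi p) = PI (lam ^ (p ^ (a - 1)))"
  using one_minus_xi_prime_power[of 1] a_pos by simp

text \<open>The \<open>p\<^sup>s\<close>-th roots of unity are powers of \<open>\<xi>\<^bsub>p^s\<^esub>\<close>. Conversely, \<open>\<xi>\<^bsub>p^t\<^esub>\<close> is a power of \<open>z\<close> if \<open>p\<^sup>t\<close> is the
  order of \<open>z\<close>.\<close>

lemma roots_congruent_1_iff:
  assumes q: "q \<in> M" "1 \<notin> PI q" "lam ^ K \<in> PI q" and s: "s \<le> a"
    and thr: "\<And>t. 0 < t \<Longrightarrow> t \<le> a \<Longrightarrow> lam ^ (p ^ (a - t)) \<in> PI q \<longleftrightarrow> t \<le> s"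
  shows "roots_congruent_1 n q (p ^ s)"
  unfolding roots_congruent_1_def
proof (intro conjI allI impI)
  show "0 < p ^ s" using p_gt_1 by simp
  show "p ^ s dvd lcm 2 n" unfolding N using s by (simp add: le_imp_power_dvd)
  fix z :: complex assume z: "z ^ lcm 2 n = 1"
  have zM: "z \<in> M" using z by (rule root_in_M)
  show "1 - z \<in> PI q \<longleftrightarrow> z ^ (p ^ s) = 1"
  proof
    assume zs: "z ^ (p ^ s) = 1"
    show "1 - z \<in> PI q"
    proof (cases "s = 0")
      case True
      then show ?thesis using zs ideal_closed(2)[OF ideal_principal[OF q(1)]] by simp
    next
      case False
      have ps: "p ^ s > 0" using p_gt_1 by simp
      obtain j where j: "z = xi (p ^ s) ^ j" using root_of_unity_is_power[OF ps zs] by blast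
      have "p ^ s dvd lcm 2 n" unfolding N using s by (simp add: le_imp_power_dvd)
      then have "1 - z \<in> PI (1 - xi (p ^ s))"
        unfolding j by (intro one_minus_power_dvd module_xi[OF n_pos])
      also have "PI (1 - xi (p ^ s)) = PI (lam ^ (p ^ (a - s)))"
        using False s by (intro one_minus_xi_prime_power) auto
      finally show ?thesis using thr[of s] False s principal_ideal_trans by blast
    qed
  next
    assume zq: "1 - z \<in> PI q"
    have za: "z ^ (p ^ a) = 1" using root_congruent_1_order[OF q z zq] .
    define t where "t = (LEAST t. z ^ (p ^ t) = 1)"
    have t: "z ^ (p ^ t) = 1" unfolding t_def using za by (rule LeastI)
    have ta: "t \<le> a" unfolding t_def using za by (rule Least_le)
    show "z ^ (p ^ s) = 1"
    proof (cases "t \<le> s")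
      case True
      then have "p ^ s = p ^ t * p ^ (s - t)" by (simp flip: power_add)
      then show ?thesis using t by (simp add: power_mult)
    next
      case False
      have pt: "p ^ t > 0" using p_gt_1 by simp
      obtain j where j: "z = xi (p ^ t) ^ j" using root_of_unity_is_power[OF pt t] by blast
      have "\<not> p dvd j"
      proof
        assume "p dvd j"
        then obtain i where i: "j = p * i" by auto
        have "p * p ^ (t - 1) = p ^ t" using False by (cases t) auto
        then have "z ^ (p ^ (t - 1)) = (xi (p ^ t) ^ (p ^ t)) ^ i"
          unfolding j i by (metis (no_types, lifting) mult.assoc mult.commute power_mult)
        then have "z ^ (p ^ (t - 1)) = 1" using xi_power_self[OF pt] by simp
        then have "t \<le> t - 1" unfolding t_def by (rule Least_le)
        then show False using False by simp
      qed
      then have "coprime p j" using p by (simp add: prime_imp_coprime)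
      then have "coprime j (p ^ t)" by (simp add: coprime_commute)
      then obtain i where i: "[j * i = 1] (mod p ^ t)"
        using cong_solve_coprime_nat[of j "p ^ t"] by (auto simp only: One_nat_def)
      have "z ^ i = xi (p ^ t) ^ (j * i)" unfolding j by (simp add: power_mult)
      also have "\<dots> = xi (p ^ t) ^ 1" using i xi_power_self[OF pt] by (metis cong_def root_of_unity_power_mod)
      finally have zi: "z ^ i = xi (p ^ t)" by simp
      have "1 - xi (p ^ t) \<in> PI q"
        using one_minus_power_dvd[OF zM, of i] zq principal_ideal_trans unfolding zi by blast
      moreover have "PI (1 - xi (p ^ t)) = PI (lam ^ (p ^ (a - t)))"
        using False ta by (intro one_minus_xi_prime_power) auto
      ultimately have "lam ^ (p ^ (a - t)) \<in> PI q"
        using principal_ideal_trans principal_ideal_refl by blast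
      then show ?thesis using thr[of t] False ta by auto
    qed
  qed
qed

text \<open>For \<open>0 < t \<le> a\<close>, \<open>1 - \<xi>\<^bsub>p^t\<^esub>\<close> is divisible by the \<open>e\<close>-th power of a prime above \<open>p\<close> just if \<open>t \<le> s\<close>.\<close>

definition critical_exponent :: "nat \<Rightarrow> nat \<Rightarrow> bool" where
  "critical_exponent e s \<longleftrightarrow> s \<le> a \<and> (s > 0 \<longrightarrow> e \<le> p ^ (a - s)) \<and> (s < a \<longrightarrow> p ^ (a - s - 1) < e)"

lemma critical_exponent_iff:
  assumes "critical_exponent e s" "0 < t" "t \<le> a"
  shows "e \<le> p ^ (a - t) \<longleftrightarrow> t \<le> s"
proof
  assume e: "e \<le> p ^ (a - t)"
  show "t \<le> s"
  proof (rule ccontr)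
    assume "\<not> t \<le> s"
    then have "p ^ (a - t) \<le> p ^ (a - s - 1)" using p_gt_1 by (intro power_increasing) auto
    moreover have "p ^ (a - s - 1) < e" using assms \<open>\<not> t \<le> s\<close> by (auto simp: critical_exponent_def)
    ultimately show False using e by simp
  qed
next
  assume "t \<le> s"
  then have "p ^ (a - s) \<le> p ^ (a - t)" using p_gt_1 by (intro power_increasing) auto
  then show "e \<le> p ^ (a - t)" using assms \<open>t \<le> s\<close> by (auto simp: critical_exponent_def)
qed

end

text \<open>The upper bound for the index of \<open>(lam)\<close> is here equal to the lower bound for that of any proper ideal
  containing it.\<close>

locale one_prime_above = prime_above +
  assumes totient_m: "totient m = f"
begin

lemma module_index_lam_eq: "module_index n (PI lam) = p ^ f"
  using module_index_lam(2) ideal_index_ge[OF ideal_principal[OF lam_in_M]] lam_not_unit totient_m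
  by simp

sublocale lam: prime_factor_above n p a m f lam
  by unfold_locales (use lam_in_M module_index_lam_eq in auto)

lemma module_index_lam_power: "module_index n (PI (lam ^ J)) = p ^ (f * J)"
  using module_index_power[OF lam_in_M lam_nonzero module_index_lam(1)]
  by (simp add: module_index_lam_eq power_mult)

lemma dvd_lam_power_cases:
  assumes "q \<in> M" "lam ^ K \<in> PI q"
  shows "\<exists>J\<le>K. PI q = PI (lam ^ J)"
proof -
  obtain J x where J: "J \<le> K" "x \<in> M" "PI q = PI (lam ^ J * x)" "1 \<in> PI x"
    using lam.dvd_r_power_mult[of q 1 K] assms by auto
  have "PI (lam ^ J * x) = PI (lam ^ J)"
    using J(2,4) principal_ideal_mult_mono[OF principal_ideal_refl[of "lam ^ J" n] J(4)]
    unfolding principal_ideal_eq_iff by (auto intro: principal_idealI)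
  then show ?thesis using J by auto
qed

lemma prime_power_index_cases:
  assumes q: "q \<in> M" and t: "module_index n (PI q) = p ^ t"
  shows "\<exists>J. PI q = PI (lam ^ J) \<and> t = f * J"
proof -
  obtain K where "lam ^ K \<in> PI q" using dvd_lam_power_of_index[OF assms] by blast
  then obtain J where J: "PI q = PI (lam ^ J)" using dvd_lam_power_cases[OF q] by blast
  then have "p ^ t = p ^ (f * J)" using t module_index_lam_power by simp
  then have "t = f * J" using p_gt_1 by (simp add: power_inject_exp)
  then show ?thesis using J by blast
qed

lemma lam_power_dvd_iff: "lam ^ e \<in> PI (lam ^ J) \<longleftrightarrow> J \<le> e"
  using lam.r_power_not_dvd[of 1 e J] lam_not_unit principal_ideal_le_power[OF lam_in_M, of J e] by auto

lemma roots_congruent_1_lam_power: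
  assumes J: "0 < J" and crit: "critical_exponent J s"
  shows "roots_congruent_1 n (lam ^ J) (p ^ s)"
proof (rule roots_congruent_1_iff)
  show "lam ^ J \<in> M" using lam_in_M by simp
  show "1 \<notin> PI (lam ^ J)" using lam_power_dvd_iff[of 0 J] J by simp
  show "s \<le> a" using crit by (simp add: critical_exponent_def)
qed (use critical_exponent_iff[OF crit] lam_power_dvd_iff in auto)

end

text \<open>The elements \<open>r\<close> and \<open>r'\<close> are merely assumed not to be units; that they are primes is proved below.\<close>

locale two_primes_above = prime_above +
  fixes r r' :: complex
  assumes totient_m2: "totient m = 2 * f" and r: "r \<in> M" "r' \<in> M" "1 \<notin> PI r" "1 \<notin> PI r'"
    and lam_eq: "PI lam = PI (r * r')"
begin

lemma lam_in_r: "lam \<in> PI r" "lam \<in> PI r'"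
proof -
  have 1: "lam \<in> PI (r * r')" using lam_eq principal_ideal_refl by blast
  have "r * r' \<in> PI r" "r * r' \<in> PI r'" using r by (auto intro: principal_idealI simp: mult.commute)
  then show "lam \<in> PI r" "lam \<in> PI r'" using 1 principal_ideal_trans by blast+
qed

text \<open>Both indices are at least \<open>p\<^sup>f\<close>, and their product is at most \<open>p\<^bsup>2f\<^esup>\<close>.\<close>

lemma module_index_factors: "module_index n (PI r) = p ^ f" "module_index n (PI r') = p ^ f"
proof -
  note pos = dvd_lam_power[OF r(1), of 1] dvd_lam_power[OF r(2), of 1]
  have "module_index n (PI r) * module_index n (PI r') = module_index n (PI lam)"
    using module_index_mult[OF r(1) _ r(2)] pos lam_in_r lam_eq by simp
  also have "\<dots> \<le> p ^ f * p ^ f"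
    using module_index_lam(2) by (simp add: totient_m2 mult_2 power_add)
  finally have le: "module_index n (PI r) * module_index n (PI r') \<le> p ^ f * p ^ f" .
  have ge: "p ^ f \<le> module_index n (PI r)" "p ^ f \<le> module_index n (PI r')"
    using r lam_in_r by (auto intro!: ideal_index_ge ideal_principal)
  have pos: "p ^ f > 0" using p_gt_1 by simp
  have "module_index n (PI r) * p ^ f \<le> p ^ f * p ^ f" using le mult_le_mono2[OF ge(2)] order_trans by blast
  then have "module_index n (PI r) \<le> p ^ f" using pos by (metis mult_le_cancel2)
  then show "module_index n (PI r) = p ^ f" using ge(1) by simp
  have "p ^ f * module_index n (PI r') \<le> p ^ f * p ^ f" using le mult_le_mono1[OF ge(1)] order_trans by blast
  then have "module_index n (PI r') \<le> p ^ f" using pos by (metis mult_le_cancel1)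
  then show "module_index n (PI r') = p ^ f" using ge(2) by simp
qed

sublocale r: prime_factor_above n p a m f r
  by unfold_locales (use r lam_in_r module_index_factors in auto)

sublocale r': prime_factor_above n p a m f r'
  by unfold_locales (use r lam_in_r module_index_factors in auto)

lemma swap: "two_primes_above n p a m f r' r"
  by unfold_locales (use r lam_eq totient_m2 in \<open>auto simp: mult.commute\<close>)

text \<open>If the two ideals were equal, \<open>r\<^sup>2\<close> would be divisible by \<open>lam\<close>, and hence \<open>r\<close> by \<open>r r'\<close>.\<close>

lemma r_neq: "PI r \<noteq> PI r'"
proof
  assume "PI r = PI r'"
  then have "r \<in> PI r'" using principal_ideal_refl by blast
  then have "r * r \<in> PI (r * r')" by (intro principal_ideal_mult_mono) auto
  then have "r \<in> PI lam" using lam_reduced[OF r(1)] lam_eq by (simp add: power2_eq_square)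
  then have "r * 1 \<in> PI (r * r')" using lam_eq by simp
  then show False using principal_ideal_cancel[OF r.r_nonzero] r(4) by blast
qed

lemma r_not_dvd: "r \<notin> PI r'" "r' \<notin> PI r"
  using r.r_maximal[OF ideal_principal[OF r(2)]] r'.r_maximal[OF ideal_principal[OF r(1)]] r(3,4) r_neq
  by blast+

lemma powers_nonzero: "r ^ i * r' ^ j \<noteq> 0" "r ^ i * r' ^ j \<in> M"
  using r.r_nonzero r'.r_nonzero r by auto

lemma module_index_powers: "module_index n (PI (r ^ i * r' ^ j)) = p ^ (f * (i + j))"
proof -
  have pos: "p ^ f > 0" using p_gt_1 by simp
  have i: "module_index n (PI (r ^ i)) = p ^ (f * i)"
    using module_index_power[OF r(1) r.r_nonzero] module_index_factors pos by (simp add: power_mult)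
  have j: "module_index n (PI (r' ^ j)) = p ^ (f * j)"
    using module_index_power[OF r(2) r'.r_nonzero] module_index_factors pos by (simp add: power_mult)
  have "module_index n (PI (r ^ i * r' ^ j)) = p ^ (f * i) * p ^ (f * j)"
    using module_index_mult[of "r ^ i" n "r' ^ j"] i j r r.r_nonzero p_gt_1 by simp
  then show ?thesis by (simp add: power_add distrib_left)
qed

lemma lam_power_eq: "PI (lam ^ e) = PI (r ^ e * r' ^ e)"
  using lam_eq unfolding principal_ideal_eq_iff power_mult_distrib[symmetric]
  by (auto intro: principal_ideal_power_mono)

lemma dvd_lam_power_cases:
  assumes q: "q \<in> M" "lam ^ K \<in> PI q"
  shows "\<exists>i\<le>K. \<exists>j\<le>K. PI q = PI (r ^ i * r' ^ j)"
proof -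
  have "r ^ K * r' ^ K \<in> PI q"
    using q(2) lam_power_eq principal_ideal_refl principal_ideal_trans by blast
  then obtain i x where i: "i \<le> K" "x \<in> M" "PI q = PI (r ^ i * x)" "r' ^ K \<in> PI x"
    using r.dvd_r_power_mult[of q "r' ^ K" K] q(1) r r'.r_nonzero by auto
  obtain j y where j: "j \<le> K" "y \<in> M" "PI x = PI (r' ^ j * y)" "1 \<in> PI y"
    using r'.dvd_r_power_mult[of x 1 K] i(2,4) by auto
  have "PI (r' ^ j * y) = PI (r' ^ j)"
    using j(2) principal_ideal_mult_mono[OF principal_ideal_refl[of "r' ^ j" n] j(4)]
    unfolding principal_ideal_eq_iff by (auto intro: principal_idealI)
  then have "PI x = PI (r' ^ j)" using j(3) by simp
  then have "PI (r ^ i * x) = PI (r ^ i * r' ^ j)"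
    unfolding principal_ideal_eq_iff by (simp add: principal_ideal_mult_mono)
  then show ?thesis using i j by blast
qed

lemma prime_power_index_cases:
  assumes q: "q \<in> M" and t: "module_index n (PI q) = p ^ t"
  shows "\<exists>i j. PI q = PI (r ^ i * r' ^ j) \<and> t = f * (i + j)"
proof -
  obtain K where "lam ^ K \<in> PI q" using dvd_lam_power_of_index[OF assms] by blast
  then obtain i j where ij: "PI q = PI (r ^ i * r' ^ j)" using dvd_lam_power_cases[OF q] by blast
  then have "p ^ t = p ^ (f * (i + j))" using t module_index_powers by simp
  then have "t = f * (i + j)" using p_gt_1 by (simp add: power_inject_exp)
  then show ?thesis using ij by blast
qed

lemma lam_power_dvd_iff: "lam ^ e \<in> PI (r ^ i * r' ^ j) \<longleftrightarrow> max i j \<le> e"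
proof
  assume "lam ^ e \<in> PI (r ^ i * r' ^ j)"
  then have 1: "r ^ e * r' ^ e \<in> PI (r ^ i * r' ^ j)"
    using lam_power_eq principal_ideal_refl principal_ideal_trans by blast
  have "r ^ i * r' ^ j \<in> PI (r ^ i)"
    using r by (intro principal_idealI[of "r' ^ j"]) simp_all
  then have 2: "r ^ e * r' ^ e \<in> PI (r ^ i)" using 1 principal_ideal_trans by blast
  have "r ^ i * r' ^ j \<in> PI (r' ^ j)"
    using r by (intro principal_idealI[of "r ^ i"]) simp_all
  then have 3: "r' ^ e * r ^ e \<in> PI (r' ^ j)"
    using 1 principal_ideal_trans by (metis mult.commute)
  \<comment> \<open>\<open>r\<close> and \<open>r'\<close> are prime to each other\<close>
  have pow: "x ^ e \<in> PI y \<Longrightarrow> 0 < e \<Longrightarrow> x \<in> PI y"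
    if "prime_factor_above n p a m f y" "x \<in> M" for x y e
  proof -
    interpret y: prime_factor_above n p a m f y by fact
    show "x ^ e \<in> PI y \<Longrightarrow> 0 < e \<Longrightarrow> x \<in> PI y"
    proof (induction e)
      case (Suc e)
      then show ?case using y.r_dvd_mult[of x "x ^ e"] that(2) y.r_not_unit by (cases e) auto
    qed simp
  qed
  have "r' ^ e \<notin> PI r"
    using pow[OF r.prime_factor_above_axioms r(2), of e] r_not_dvd(2) r(3) by (cases e) auto
  moreover have "r ^ e \<notin> PI r'"
    using pow[OF r'.prime_factor_above_axioms r(1), of e] r_not_dvd(1) r(4) by (cases e) auto
  ultimately show "max i j \<le> e"
    using r.r_power_not_dvd[OF _ _ 2] r'.r_power_not_dvd[OF _ _ 3] r by simp
next
  assume "max i j \<le> e"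
  then have "r ^ e * r' ^ e \<in> PI (r ^ i * r' ^ j)"
    using r by (intro principal_ideal_mult_mono principal_ideal_le_power) auto
  then show "lam ^ e \<in> PI (r ^ i * r' ^ j)"
    using lam_power_eq principal_ideal_refl principal_ideal_trans by blast
qed

lemma roots_congruent_1_powers:
  assumes ij: "0 < i + j" and crit: "critical_exponent (max i j) s"
  shows "roots_congruent_1 n (r ^ i * r' ^ j) (p ^ s)"
proof (rule roots_congruent_1_iff)
  show "r ^ i * r' ^ j \<in> M" by (rule powers_nonzero)
  show "1 \<notin> PI (r ^ i * r' ^ j)" using lam_power_dvd_iff[of 0 i j] ij by auto
  show "s \<le> a" using crit by (simp add: critical_exponent_def)
  show "lam ^ max i j \<in> PI (r ^ i * r' ^ j)" by (simp only: lam_power_dvd_iff)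
qed (simp only: critical_exponent_iff[OF crit] lam_power_dvd_iff)

end

section \<open>Groups of symmetries of the plane\<close>

lemma plane_carrier: "f \<in> carrier plane \<longleftrightarrow> bij f"
  by (simp add: BijGroup_def Bij_def extensional_def)

lemma plane_mult: "bij g \<Longrightarrow> bij f \<Longrightarrow> g \<otimes>\<^bsub>plane\<^esub> f = (\<lambda>x. g (f x))"
  by (simp add: BijGroup_def Bij_def extensional_def compose_def restrict_def)

lemma plane_one: "\<one>\<^bsub>plane\<^esub> = (\<lambda>x. x)"
  by (simp add: BijGroup_def restrict_def)

lemma group_plane: "group plane" by (rule group_BijGroup)

lemma plane_inv:
  assumes "\<And>x. g (f x) = x" "\<And>x. f (g x) = x"
  shows "inv\<^bsub>plane\<^esub> f = g"
proof -
  have "bij f" "bij g"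
    using assms by (metis bij_betw_def inj_on_def surjI surj_def bij_def injI)+
  then show ?thesis
    using assms by (intro group.inv_equality[OF group_plane]) (simp_all add: plane_carrier plane_mult plane_one)
qed

lemma bij_rotation: "z ^ k = 1 \<Longrightarrow> 0 < k \<Longrightarrow> bij (\<lambda>x. z * x :: complex)"
  by (rule o_bij[of "\<lambda>x. x / z"]) (auto simp: o_def fun_eq_iff power_0_left)

lemma bij_reflection: "z ^ k = 1 \<Longrightarrow> 0 < k \<Longrightarrow> bij (\<lambda>x. z * cnj x)"
  by (rule o_bij[of "\<lambda>x. cnj (x / z)"]) (auto simp: o_def fun_eq_iff power_0_left)

lemma bij_translation: "bij (\<lambda>x. x + t :: complex)"
  by (rule o_bij[of "\<lambda>x. x - t"]) (auto simp: o_def fun_eq_iff)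

lemma cyc_eq:
  assumes k: "0 < k"
  shows "cyc k = {\<lambda>x. z * x | z. z ^ k = 1}"
proof
  have xi: "xi k ^ k = 1" using k by (rule xi_power_self)
  have ubij: "bij (\<lambda>x. z * x :: complex)" if "z ^ k = 1" for z using bij_rotation[OF that k] .
  show "cyc k \<subseteq> {\<lambda>x. z * x | z. z ^ k = 1}"
  proof
    fix f assume "f \<in> cyc k"
    then have "f \<in> generate plane {rotation k}" by (simp add: cyc_def)
    then show "f \<in> {\<lambda>x. z * x | z. z ^ k = 1}"
    proof (induction rule: generate.induct)
      case one
      then show ?case unfolding plane_one by (auto intro!: exI[of _ 1])
    next
      case (incl h)
      then show ?case using xi by (auto simp: rotation_def)
    next
      case (inv h)
      have "xi k * cnj (xi k) = 1" "cnj (xi k) ^ k = 1"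
        using cnj_root_of_unity(2)[OF k xi] xi by (simp_all flip: complex_cnj_power)
      then have "inv\<^bsub>plane\<^esub> (\<lambda>x. xi k * x) = (\<lambda>x. cnj (xi k) * x)" "cnj (xi k) ^ k = 1"
        by (auto intro!: plane_inv simp: mult.assoc[symmetric] mult.commute[of "cnj _"])
      then show ?case using inv by (auto simp: rotation_def)
    next
      case (eng h1 h2)
      then obtain z w where zw: "h1 = (\<lambda>x. z * x)" "h2 = (\<lambda>x. w * x)" "z ^ k = 1" "w ^ k = 1" by blast
      then have "h1 \<otimes>\<^bsub>plane\<^esub> h2 = (\<lambda>x. (z * w) * x)" "(z * w) ^ k = 1"
        by (simp_all add: plane_mult ubij mult.assoc power_mult_distrib)
      then show ?case by blast
    qed
  qed
  have "(\<lambda>x. xi k ^ j * x) \<in> generate plane {rotation k}" for j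
  proof (induction j)
    case 0
    then show ?case using generate.one[of plane "{rotation k}"] by (simp add: plane_one)
  next
    case (Suc j)
    have "(xi k ^ j) ^ k = 1" using xi by (metis mult.commute power_mult power_one)
    then have "rotation k \<otimes>\<^bsub>plane\<^esub> (\<lambda>x. xi k ^ j * x) = (\<lambda>x. xi k ^ Suc j * x)"
      using xi by (simp add: rotation_def plane_mult ubij mult.assoc)
    then show ?case using generate.eng[OF generate.incl Suc, of "rotation k"] by simp
  qed
  then show "{\<lambda>x. z * x | z. z ^ k = 1} \<subseteq> cyc k"
    unfolding cyc_def using root_of_unity_is_power[OF k] by blast
qed

lemma dih_eq:
  assumes k: "0 < k"
  shows "dih k = {\<lambda>x. z * x | z. z ^ k = 1} \<union> {\<lambda>x. z * cnj x | z. z ^ k = 1}"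
proof
  let ?D = "{\<lambda>x. z * x | z. z ^ k = 1} \<union> {\<lambda>x. z * cnj x | z. z ^ k = 1}"
  have xi: "xi k ^ k = 1" using k by (rule xi_power_self)
  have cnj1: "cnj z ^ k = 1" if "z ^ k = 1" for z using that by (simp flip: complex_cnj_power)
  show "dih k \<subseteq> ?D"
  proof
    fix f assume "f \<in> dih k"
    then have "f \<in> generate plane {rotation k, cnj}" by (simp add: dih_def)
    then show "f \<in> ?D"
    proof (induction rule: generate.induct)
      case one
      then show ?case unfolding plane_one by (intro UnI1) (auto intro!: exI[of _ 1])
    next
      case (incl h)
      then consider "h = (\<lambda>x. xi k * x)" | "h = (\<lambda>x. 1 * cnj x)" by (auto simp: rotation_def fun_eq_iff)
      then show ?case using xi power_one[of k] by cases blast+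
    next
      case (inv h)
      then consider "h = (\<lambda>x. xi k * x)" | "h = cnj" by (auto simp: rotation_def fun_eq_iff)
      then show ?case
      proof cases
        case 1
        have "inv\<^bsub>plane\<^esub> (\<lambda>x. xi k * x) = (\<lambda>x. cnj (xi k) * x)"
          using cnj_root_of_unity(2)[OF k xi]
          by (intro plane_inv) (auto simp: mult.assoc[symmetric] mult.commute[of "cnj _"])
        then show ?thesis unfolding 1 using cnj1[OF xi] by blast
      next
        case 2
        have "inv\<^bsub>plane\<^esub> cnj = (\<lambda>x. 1 * cnj x)" by (rule plane_inv) auto
        then show ?thesis unfolding 2 using power_one[of k] by blast
      qed
    next
      case (eng h1 h2)
      have rot: "bij (\<lambda>x. z * x)" "bij (\<lambda>x. z * cnj x)" if "z ^ k = 1" for z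
        using that k by (simp_all add: bij_rotation bij_reflection)
      from eng consider z w where "h1 = (\<lambda>x. z * x)" "h2 = (\<lambda>x. w * x)" "z ^ k = 1" "w ^ k = 1"
        | z w where "h1 = (\<lambda>x. z * x)" "h2 = (\<lambda>x. w * cnj x)" "z ^ k = 1" "w ^ k = 1"
        | z w where "h1 = (\<lambda>x. z * cnj x)" "h2 = (\<lambda>x. w * x)" "z ^ k = 1" "w ^ k = 1"
        | z w where "h1 = (\<lambda>x. z * cnj x)" "h2 = (\<lambda>x. w * cnj x)" "z ^ k = 1" "w ^ k = 1" by blast
      then show ?case
      proof cases
        case 1
        then have "h1 \<otimes>\<^bsub>plane\<^esub> h2 = (\<lambda>x. (z * w) * x)" "(z * w) ^ k = 1"
          by (simp_all add: plane_mult rot mult.assoc power_mult_distrib)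
        then show ?thesis by blast
      next
        case 2
        then have "h1 \<otimes>\<^bsub>plane\<^esub> h2 = (\<lambda>x. (z * w) * cnj x)" "(z * w) ^ k = 1"
          by (simp_all add: plane_mult rot mult.assoc power_mult_distrib)
        then show ?thesis by blast
      next
        case 3
        then have "h1 \<otimes>\<^bsub>plane\<^esub> h2 = (\<lambda>x. (z * cnj w) * cnj x)" "(z * cnj w) ^ k = 1"
          by (simp_all add: plane_mult rot mult.assoc power_mult_distrib cnj1)
        then show ?thesis by blast
      next
        case 4
        then have "h1 \<otimes>\<^bsub>plane\<^esub> h2 = (\<lambda>x. (z * cnj w) * x)" "(z * cnj w) ^ k = 1"
          by (simp_all add: plane_mult rot mult.assoc power_mult_distrib cnj1)
        then show ?thesis by blast
      qed
    qed
  qed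
  have sub: "cyc k \<subseteq> dih k" unfolding cyc_def dih_def by (rule group.mono_generate[OF group_plane]) auto
  then have rot: "(\<lambda>x. z * x) \<in> dih k" if "z ^ k = 1" for z using cyc_eq[OF k] that by blast
  have "(\<lambda>x. z * cnj x) \<in> dih k" if z: "z ^ k = 1" for z
  proof -
    have "bij cnj" using bij_reflection[of 1 1] by simp
    then have "(\<lambda>x. z * x) \<otimes>\<^bsub>plane\<^esub> cnj = (\<lambda>x. z * cnj x)"
      using bij_rotation[OF z k] by (simp add: plane_mult)
    moreover have "(\<lambda>x. z * x) \<otimes>\<^bsub>plane\<^esub> cnj \<in> dih k"
      using rot[OF z] unfolding dih_def by (rule generate.eng) (auto intro: generate.incl)
    ultimately show ?thesis by simp
  qed
  then show "?D \<subseteq> dih k" using rot by blast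
qed

text \<open>A map with linear part \<open>g\<close> conjugates the translation by \<open>t\<close> to that by \<open>g t\<close>; so the translations form a
  normal subgroup if \<open>A\<close> is stable under \<open>P\<close>.\<close>

lemma internal_semidirect_affine:
  assumes P: "subgroup P plane" and add: "\<And>g x y. g \<in> P \<Longrightarrow> g (x + y) = g x + g y"
    and A: "0 \<in> A" "\<And>s t. s \<in> A \<Longrightarrow> t \<in> A \<Longrightarrow> s + t \<in> A" "\<And>t. t \<in> A \<Longrightarrow> - t \<in> A"
    and stable: "\<And>g t. g \<in> P \<Longrightarrow> t \<in> A \<Longrightarrow> g t \<in> A"
  shows "internal_semidirect plane {\<lambda>x. g x + t | g t. g \<in> P \<and> t \<in> A} (translation_group A) P"
proof -
  define K where "K = {\<lambda>x. g x + t | g t. g \<in> P \<and> t \<in> A}"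
  interpret plane: group plane by (rule group_plane)
  have bijP: "bij g" if "g \<in> P" for g using subgroup.mem_carrier[OF P that] plane_carrier by blast
  have bijK: "bij (\<lambda>x. g x + t)" if "g \<in> P" for g t
    using bij_comp[OF bijP[OF that] bij_translation[of t]] by (simp add: o_def)
  have comp: "(\<lambda>x. g (h x)) \<in> P" if "g \<in> P" "h \<in> P" for g h
    using subgroup.m_closed[OF P that] plane_mult[OF bijP bijP] that by simp
  have g0: "g 0 = 0" if "g \<in> P" for g using add[OF that, of 0 0] by simp
  have idP: "(\<lambda>x. x) \<in> P" using subgroup.one_closed[OF P] by (simp add: plane_one)
  have inv: "inv\<^bsub>plane\<^esub> g \<in> P" "(inv\<^bsub>plane\<^esub> g) (g x) = x" "g ((inv\<^bsub>plane\<^esub> g) x) = x" if "g \<in> P" for g x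
  proof -
    show i: "inv\<^bsub>plane\<^esub> g \<in> P" using subgroup.m_inv_closed[OF P that] .
    have "inv\<^bsub>plane\<^esub> g \<otimes>\<^bsub>plane\<^esub> g = \<one>\<^bsub>plane\<^esub>" "g \<otimes>\<^bsub>plane\<^esub> inv\<^bsub>plane\<^esub> g = \<one>\<^bsub>plane\<^esub>"
      using bijP[OF that] plane_carrier plane.l_inv plane.r_inv by blast+
    then show "(inv\<^bsub>plane\<^esub> g) (g x) = x" "g ((inv\<^bsub>plane\<^esub> g) x) = x"
      using bijP[OF that] bijP[OF i] by (simp_all add: plane_mult plane_one fun_eq_iff)
  qed
  have memK: "(\<lambda>x. g x + t) \<in> K" if "g \<in> P" "t \<in> A" for g t using that by (auto simp: K_def)
  have PK: "P \<subseteq> K" using memK[OF _ A(1)] by auto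
  have invK: "inv\<^bsub>plane\<^esub> (\<lambda>x. g x + t) = (\<lambda>x. (inv\<^bsub>plane\<^esub> g) x + (inv\<^bsub>plane\<^esub> g) (- t))" if g: "g \<in> P" for g t
  proof (rule plane_inv)
    fix x
    show "(inv\<^bsub>plane\<^esub> g) (g x + t) + (inv\<^bsub>plane\<^esub> g) (- t) = x"
      using add[OF inv(1)[OF g], of "g x + t" "- t"] inv(2)[OF g] by simp
    show "g ((inv\<^bsub>plane\<^esub> g) x + (inv\<^bsub>plane\<^esub> g) (- t)) + t = x"
      using add[OF g] inv(3)[OF g] by simp
  qed
  have K: "subgroup K plane"
  proof (rule plane.subgroupI)
    show "K \<subseteq> carrier plane" using bijK plane_carrier by (auto simp: K_def)
    show "K \<noteq> {}" using idP PK by auto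
    fix h assume "h \<in> K"
    then obtain g t where gt: "h = (\<lambda>x. g x + t)" "g \<in> P" "t \<in> A" by (auto simp: K_def)
    then show "inv\<^bsub>plane\<^esub> h \<in> K" unfolding gt(1) invK[OF gt(2)]
      using inv(1) stable A by (intro memK) auto
    fix h' assume "h' \<in> K"
    then obtain g' t' where gt': "h' = (\<lambda>x. g' x + t')" "g' \<in> P" "t' \<in> A" by (auto simp: K_def)
    have "h \<otimes>\<^bsub>plane\<^esub> h' = (\<lambda>x. (\<lambda>x. g (g' x)) x + (g t' + t))"
      using gt gt' bijK add by (simp add: plane_mult add_ac)
    then show "h \<otimes>\<^bsub>plane\<^esub> h' \<in> K"
      using memK[OF comp[OF gt(2) gt'(2)], of "g t' + t"] stable gt gt' A by simp
  qed
  have T_eq: "translation_group A = {\<lambda>x. x + t | t. t \<in> A}" by (simp add: translation_group_def)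
  have TK: "translation_group A \<subseteq> K" using memK[OF idP] by (auto simp: T_eq)
  have T: "subgroup (translation_group A) plane"
  proof (rule plane.subgroupI)
    show "translation_group A \<subseteq> carrier plane" using bij_translation plane_carrier by (auto simp: T_eq)
    show "translation_group A \<noteq> {}" using A(1) by (auto simp: T_eq)
    fix h assume "h \<in> translation_group A"
    then obtain t where t: "h = (\<lambda>x. x + t)" "t \<in> A" by (auto simp: T_eq)
    have "inv\<^bsub>plane\<^esub> h = (\<lambda>x. x + - t)" unfolding t(1) by (rule plane_inv) auto
    then show "inv\<^bsub>plane\<^esub> h \<in> translation_group A" using A(3)[OF t(2)] unfolding T_eq by blast
    fix h' assume "h' \<in> translation_group A"
    then obtain t' where t': "h' = (\<lambda>x. x + t')" "t' \<in> A" by (auto simp: T_eq)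
    have "h \<otimes>\<^bsub>plane\<^esub> h' = (\<lambda>x. x + (t' + t))"
      unfolding t(1) t'(1) plane_mult[OF bij_translation bij_translation] by (simp add: add_ac)
    then show "h \<otimes>\<^bsub>plane\<^esub> h' \<in> translation_group A" using A(2)[OF t'(2) t(2)] unfolding T_eq by blast
  qed
  have normal: "translation_group A \<lhd> plane\<lparr>carrier := K\<rparr>"
  proof (rule group.normalI[OF plane.subgroup_imp_group[OF K]])
    show "subgroup (translation_group A) (plane\<lparr>carrier := K\<rparr>)"
      by (rule plane.subgroup_incl[OF T K TK])
    show "\<forall>h\<in>carrier (plane\<lparr>carrier := K\<rparr>). translation_group A #>\<^bsub>plane\<lparr>carrier := K\<rparr>\<^esub> h =
            h <#\<^bsub>plane\<lparr>carrier := K\<rparr>\<^esub> translation_group A"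
    proof
      fix h assume "h \<in> carrier (plane\<lparr>carrier := K\<rparr>)"
      then obtain g t where gt: "h = (\<lambda>x. g x + t)" "g \<in> P" "t \<in> A" by (auto simp: K_def)
      have l: "(\<lambda>x. x + s) \<otimes>\<^bsub>plane\<^esub> h = (\<lambda>x. h x + s)" for s
        using bij_translation bijK[OF gt(2)] gt(1) by (simp add: plane_mult)
      have r: "h \<otimes>\<^bsub>plane\<^esub> (\<lambda>x. x + s) = (\<lambda>x. h x + g s)" for s
        unfolding gt(1) plane_mult[OF bijK[OF gt(2)] bij_translation] add[OF gt(2)] by (simp add: add_ac)
      have "translation_group A #>\<^bsub>plane\<^esub> h = {\<lambda>x. h x + s | s. s \<in> A}"
        unfolding r_coset_def T_eq using l by auto
      moreover have "h <#\<^bsub>plane\<^esub> translation_group A = {\<lambda>x. h x + g s | s. s \<in> A}"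
        unfolding l_coset_def T_eq using r by auto
      moreover have "s \<in> A \<Longrightarrow> \<exists>s'\<in>A. s = g s'" for s
        using inv[OF gt(2)] stable by metis
      then have "{\<lambda>x. h x + s | s. s \<in> A} = {\<lambda>x. h x + g s | s. s \<in> A}"
        using stable[OF gt(2)] by blast
      ultimately show "translation_group A #>\<^bsub>plane\<lparr>carrier := K\<rparr>\<^esub> h =
            h <#\<^bsub>plane\<lparr>carrier := K\<rparr>\<^esub> translation_group A"
        by (simp add: r_coset_def l_coset_def)
    qed
  qed
  have "translation_group A \<inter> P = {\<one>\<^bsub>plane\<^esub>}"
  proof
    show "translation_group A \<inter> P \<subseteq> {\<one>\<^bsub>plane\<^esub>}"
    proof
      fix h assume h: "h \<in> translation_group A \<inter> P"
      then obtain t where t: "h = (\<lambda>x. x + t)" by (auto simp: T_eq)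
      have "h 0 = 0" using h g0 by blast
      then show "h \<in> {\<one>\<^bsub>plane\<^esub>}" using t by (simp add: plane_one)
    qed
    show "{\<one>\<^bsub>plane\<^esub>} \<subseteq> translation_group A \<inter> P"
      using subgroup.one_closed[OF T] subgroup.one_closed[OF P] by blast
  qed
  moreover have "translation_group A <#>\<^bsub>plane\<^esub> P = K"
  proof -
    have "(\<lambda>x. x + t) \<otimes>\<^bsub>plane\<^esub> g = (\<lambda>x. g x + t)" if "g \<in> P" for g t
      using bij_translation bijP[OF that] by (simp add: plane_mult)
    then show ?thesis unfolding set_mult_def T_eq K_def by auto metis
  qed
  ultimately show ?thesis
    unfolding internal_semidirect_def K_def[symmetric]
    using K normal plane.subgroup_incl[OF P K PK] by blast
qed

section \<open>Colour preserving groups\<close>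

text \<open>The group \<open>P\<^sub>n\<close> of a colouring for which the \<open>k\<close>-th roots of unity are those congruent to 1.\<close>

definition point_group :: "nat \<Rightarrow> nat \<Rightarrow> (complex \<Rightarrow> complex) set" where
  "point_group n k = (if n dvd 2 * k then dih k else cyc k)"

lemma point_group_iff:
  assumes "0 < k"
  shows "g \<in> point_group n k \<longleftrightarrow>
    (\<exists>z. z ^ k = 1 \<and> (g = (\<lambda>x. z * x) \<or> n dvd 2 * k \<and> g = (\<lambda>x. z * cnj x)))"
  using assms by (auto simp: point_group_def cyc_eq dih_eq)

lemma module_symmetries_iff:
  assumes n: "n > 0"
  shows "h \<in> module_symmetries n \<longleftrightarrow>
    (\<exists>z t. z ^ lcm 2 n = 1 \<and> t \<in> cyclotomic_module n \<and>
       (h = (\<lambda>x. z * x + t) \<or> h = (\<lambda>x. z * cnj x + t)))"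
proof -
  have N: "0 < lcm 2 n" using n by (simp add: lcm_pos_nat)
  have comp: "(\<lambda>x. x + t) \<otimes>\<^bsub>plane\<^esub> (\<lambda>x. z * x) = (\<lambda>x. z * x + t)"
    "(\<lambda>x. x + t) \<otimes>\<^bsub>plane\<^esub> (\<lambda>x. z * cnj x) = (\<lambda>x. z * cnj x + t)" if "z ^ lcm 2 n = 1" for z t
    using bij_rotation[OF that N] bij_reflection[OF that N] bij_translation by (simp_all add: plane_mult)
  have "h \<in> module_symmetries n \<longleftrightarrow>
    (\<exists>t\<in>cyclotomic_module n. \<exists>g\<in>dih (lcm 2 n). h = (\<lambda>x. x + t) \<otimes>\<^bsub>plane\<^esub> g)"
    unfolding module_symmetries_def set_mult_def translation_group_def by auto
  also have "\<dots> \<longleftrightarrow> (\<exists>t\<in>cyclotomic_module n. \<exists>z. z ^ lcm 2 n = 1 \<and>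
      (h = (\<lambda>x. x + t) \<otimes>\<^bsub>plane\<^esub> (\<lambda>x. z * x) \<or> h = (\<lambda>x. x + t) \<otimes>\<^bsub>plane\<^esub> (\<lambda>x. z * cnj x)))"
    unfolding dih_eq[OF N] by blast
  also have "\<dots> \<longleftrightarrow> (\<exists>z t. z ^ lcm 2 n = 1 \<and> t \<in> cyclotomic_module n \<and>
       (h = (\<lambda>x. z * x + t) \<or> h = (\<lambda>x. z * cnj x + t)))"
    using comp by (auto 0 4)
  finally show ?thesis .
qed

lemma bravais_colouringD:
  assumes c: "bravais_colouring n q l c"
  shows "q \<in> cyclotomic_module n" "q \<noteq> 0" "l = module_index n (principal_ideal n q)" "0 < l"
    and "x \<in> cyclotomic_module n \<Longrightarrow> c x \<in> {1..l}"
    and "x \<in> cyclotomic_module n \<Longrightarrow> y \<in> cyclotomic_module n \<Longrightarrow>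
           c x = c y \<longleftrightarrow> x - y \<in> principal_ideal n q"
proof -
  let ?I = "principal_ideal n q" and ?M = "cyclotomic_module n"
  show q: "q \<in> ?M" "q \<noteq> 0" and l: "l = module_index n ?I"
    using c by (auto simp: bravais_colouring_def ideal_index_eq_module_index)
  note I = ideal_principal[OF q(1)]
  obtain t where t: "bij_betw (\<lambda>i. ?I +>\<^bsub>cyclotomic_ring n\<^esub> t i) {1..l} (a_rcosets\<^bsub>cyclotomic_ring n\<^esub> ?I)"
    "\<And>i. i \<in> {1..l} \<Longrightarrow> t i \<in> ?M"
    "\<And>i z. i \<in> {1..l} \<Longrightarrow> z \<in> ?I +>\<^bsub>cyclotomic_ring n\<^esub> t i \<Longrightarrow> c z = i"
    using c unfolding bravais_colouring_def by blast
  have t': "(\<lambda>i. residue_class n ?I (t i)) ` {1..l} = residue_class n ?I ` ?M"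
    using bij_betw_imp_surj_on[OF t(1)] t(2) a_rcosets_eq_residue_classes[OF I] a_r_coset_eq_residue_class[OF I]
    by (metis (no_types, lifting) image_cong)
  show "0 < l"
  proof (rule gr0I)
    assume "l = 0"
    then have "residue_class n ?I ` ?M = {}" using t' by simp
    then show False using module_0[of n] by blast
  qed
  have rep: "\<exists>i\<in>{1..l}. c x = i \<and> x - t i \<in> ?I" if x: "x \<in> ?M" for x
  proof -
    have "residue_class n ?I x \<in> (\<lambda>i. residue_class n ?I (t i)) ` {1..l}" using t' x by blast
    then obtain i where i: "i \<in> {1..l}" "residue_class n ?I x = residue_class n ?I (t i)" by blast
    have xt: "x - t i \<in> ?I" using i x t(2) residue_class_eq_iff[OF I] by blast
    then have "x \<in> ?I +>\<^bsub>cyclotomic_ring n\<^esub> t i"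
      using x a_r_coset_eq_residue_class[OF I t(2)[OF i(1)]] by (simp add: residue_class_def)
    then show ?thesis using t(3) i(1) xt by blast
  qed
  show "c x \<in> {1..l}" if "x \<in> ?M" using rep[OF that] by blast
  show "c x = c y \<longleftrightarrow> x - y \<in> ?I" if xy: "x \<in> ?M" "y \<in> ?M"
  proof -
    obtain i j where ij: "i \<in> {1..l}" "c x = i" "x - t i \<in> ?I" "j \<in> {1..l}" "c y = j" "y - t j \<in> ?I"
      using rep xy by blast
    show ?thesis
    proof
      assume "c x = c y"
      then show "x - y \<in> ?I" using ideal_closed(4)[OF I ij(3,6)] ij(2,5) by simp
    next
      assume "x - y \<in> ?I"
      from ideal_closed(3)[OF I this ij(6)] have "x - t j \<in> ?I" by simp
      then have "x \<in> ?I +>\<^bsub>cyclotomic_ring n\<^esub> t j"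
        using xy a_r_coset_eq_residue_class[OF I t(2)[OF ij(4)]] by (simp add: residue_class_def)
      then show "c x = c y" using t(3)[OF ij(4)] ij(5) by simp
    qed
  qed
qed

lemma exists_bravais_colouring:
  assumes q: "q \<in> cyclotomic_module n" "q \<noteq> 0" and l: "l = module_index n (principal_ideal n q)" "0 < l"
  shows "\<exists>c. bravais_colouring n q l c"
proof -
  let ?I = "principal_ideal n q" and ?M = "cyclotomic_module n" and ?R = "residue_class n (principal_ideal n q)"
  note I = ideal_principal[OF q(1)]
  have fin: "finite (?R ` ?M)" using l module_index_pos_iff by blast
  have R0: "?R 0 \<in> ?R ` ?M" by simp
  have "card {2..l} = card (?R ` ?M - {?R 0})"
    using fin R0 l by (simp add: module_index_def)
  then obtain b where b: "bij_betw b {2..l} (?R ` ?M - {?R 0})"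
    using finite_same_card_bij[of "{2..l}" "?R ` ?M - {?R 0}"] fin by auto
  \<comment> \<open>any representatives of the classes other than that of 0, whose colour has to be 1\<close>
  define t where "t i = (if i \<in> {2..l} then SOME x. x \<in> ?M \<and> ?R x = b i else 0)" for i
  have t: "t i \<in> ?M \<and> ?R (t i) = b i" if i: "i \<in> {2..l}" for i
  proof -
    have "b i \<in> ?R ` ?M" using bij_betwE[OF b] i by blast
    then have "\<exists>x. x \<in> ?M \<and> ?R x = b i" by auto
    from someI_ex[OF this] show ?thesis using i by (simp add: t_def)
  qed
  have t1: "t 1 = 0" by (simp add: t_def)
  have "bij_betw (\<lambda>i. ?R (t i)) {2..l} (?R ` ?M - {?R 0})"
    using b by (rule bij_betw_cong[THEN iffD1, rotated]) (use t in auto)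
  then have "bij_betw (\<lambda>i. ?R (t i)) ({2..l} \<union> {1}) ((?R ` ?M - {?R 0}) \<union> {?R (t 1)})"
    by (intro notIn_Un_bij_betw) (auto simp only: t1 atLeastAtMost_iff)
  moreover have "{2..l} \<union> {1} = {1..l}" using l by auto
  moreover have "(?R ` ?M - {?R 0}) \<union> {?R (t 1)} = ?R ` ?M" unfolding t1 using R0 by blast
  ultimately have bij: "bij_betw (\<lambda>i. ?R (t i)) {1..l} (?R ` ?M)" by simp
  have tM: "t i \<in> ?M" if "i \<in> {1..l}" for i
  proof (cases "i = 1")
    case True
    then show ?thesis by (simp only: t1 module_0)
  qed (use t[of i] that in auto)
  define c where "c z = (THE i. i \<in> {1..l} \<and> z \<in> ?R (t i))" for z
  have c: "c z = i" if i: "i \<in> {1..l}" and z: "z \<in> ?R (t i)" for i z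
    unfolding c_def
  proof (rule the_equality)
    show "i \<in> {1..l} \<and> z \<in> ?R (t i)" using i z by simp
    fix j assume j: "j \<in> {1..l} \<and> z \<in> ?R (t j)"
    then have "z \<in> ?M" "z - t i \<in> ?I" "z - t j \<in> ?I" using z by (auto simp: residue_class_def)
    then have "?R (t i) = ?R (t j)" using residue_class_eq_iff[OF I] tM i j by metis
    then show "j = i" using bij i j by (auto simp: bij_betw_def dest: inj_onD)
  qed
  have cos: "?I +>\<^bsub>cyclotomic_ring n\<^esub> t i = ?R (t i)" if "i \<in> {1..l}" for i
    using a_r_coset_eq_residue_class[OF I tM[OF that]] .
  have "bij_betw (\<lambda>i. ?I +>\<^bsub>cyclotomic_ring n\<^esub> t i) {1..l} (a_rcosets\<^bsub>cyclotomic_ring n\<^esub> ?I)"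
    unfolding a_rcosets_eq_residue_classes[OF I]
    using bij by (rule bij_betw_cong[THEN iffD1, rotated]) (use cos in auto)
  then have "bravais_colouring n q l c"
    unfolding bravais_colouring_def using q l t1 tM c cos
    by (auto simp: ideal_index_eq_module_index intro!: exI[of _ t])
  then show ?thesis by blast
qed

lemma colour_preserving_iff:
  assumes n: "n > 0" and c: "bravais_colouring n q l c"
  shows "h \<in> colour_preserving n l c \<longleftrightarrow>
    h \<in> module_symmetries n \<and> (\<forall>x\<in>cyclotomic_module n. h x - x \<in> principal_ideal n q)"
proof (cases "h \<in> module_symmetries n")
  case True
  have N: "lcm 2 n > 0" using n by (simp add: lcm_pos_nat)
  have hM: "h x \<in> cyclotomic_module n" if "x \<in> cyclotomic_module n" for x
  proof -
    obtain z t where zt: "z ^ lcm 2 n = 1" "t \<in> cyclotomic_module n"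
      "h = (\<lambda>x. z * x + t) \<or> h = (\<lambda>x. z * cnj x + t)" using True module_symmetries_iff[OF n] by blast
    have "z \<in> cyclotomic_module n"
      using root_of_unity_is_power[OF N zt(1)] module_xi[OF n dvd_refl] by (metis module_power)
    then show ?thesis using zt(2,3) that module_cnj[OF n that] by auto
  qed
  show ?thesis
    using True hM bravais_colouringD(6)[OF c] permutes_id[of "{1..l}"]
    unfolding colour_preserving_def colour_symmetries_def by (auto intro!: exI[of _ id])
next
  case False
  then show ?thesis by (simp add: colour_preserving_def colour_symmetries_def)
qed

text \<open>A map \<open>x \<mapsto> z x + t\<close> moves all points by multiples of \<open>q\<close> if it does so with 0 and 1. For
  \<open>x \<mapsto> z cnj x + t\<close> one also needs the point \<open>\<xi>\<^sub>n\<close>, which conjugation moves by an associate of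
  \<open>1 - \<xi>\<^sub>n\<^sup>2\<close>; the points that conjugation moves by multiples of \<open>q\<close> form a ring.\<close>

lemma colour_preserving_eq:
  assumes n: "n > 0" and c: "bravais_colouring n q l c" and k: "roots_congruent_1 n q k"
  shows "colour_preserving n l c = {\<lambda>x. g x + t | g t. g \<in> point_group n k \<and> t \<in> principal_ideal n q}"
proof -
  let ?I = "principal_ideal n q" and ?M = "cyclotomic_module n" and ?N = "lcm 2 n"
  note I = ideal_principal[OF bravais_colouringD(1)[OF c]]
  have k0: "0 < k" and kN: "k dvd ?N"
    and kiff: "z ^ ?N = 1 \<Longrightarrow> 1 - z \<in> ?I \<longleftrightarrow> z ^ k = 1" for z
    using k by (auto simp: roots_congruent_1_def)
  have N: "?N > 0" using n by (simp add: lcm_pos_nat)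
  have zM: "z \<in> ?M" if "z ^ ?N = 1" for z
    using root_of_unity_is_power[OF N that] module_xi[OF n dvd_refl] by (metis module_power)
  have zN: "z ^ ?N = 1" if "z ^ k = 1" for z :: complex
    using that kN by (metis dvdE power_mult power_one)
  have IM: "?I \<subseteq> ?M" by (rule ideal_closed(1)[OF I])
  have rot: "(\<forall>x\<in>?M. (z * x + t) - x \<in> ?I) \<longleftrightarrow> t \<in> ?I \<and> z ^ k = 1"
    if z: "z ^ ?N = 1" and t: "t \<in> ?M" for z t
  proof
    assume *: "\<forall>x\<in>?M. (z * x + t) - x \<in> ?I"
    have tI: "t \<in> ?I" using *[rule_format, of 0] by simp
    moreover have "z + t - 1 \<in> ?I" using *[rule_format, of 1] by simp
    from ideal_closed(4)[OF I tI this] have "1 - z \<in> ?I" by simp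
    ultimately show "t \<in> ?I \<and> z ^ k = 1" using kiff[OF z] by simp
  next
    assume *: "t \<in> ?I \<and> z ^ k = 1"
    then have z1: "1 - z \<in> ?I" using kiff[OF z] by simp
    show "\<forall>x\<in>?M. (z * x + t) - x \<in> ?I"
    proof
      fix x assume "x \<in> ?M"
      from ideal_closed(4)[OF I _ ideal_closed(5)[OF I z1 this], of t] *
      show "(z * x + t) - x \<in> ?I" by (simp add: algebra_simps)
    qed
  qed
  have xi2: "1 - xi n ^ 2 \<in> ?I \<longleftrightarrow> n dvd 2 * k"
  proof -
    obtain e where e: "?N = n * e" by (meson dvdE dvd_lcm2)
    have "xi n ^ ?N = 1" unfolding e power_mult xi_power_self[OF n] by simp
    then have "(xi n ^ 2) ^ ?N = 1" by (metis mult.commute power_mult power_one)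
    from kiff[OF this] show ?thesis using xi_power_eq_1_iff[OF n, of "2 * k"] by (simp add: power_mult)
  qed
  have xn: "xi n * cnj (xi n) = 1" "cnj (xi n) \<in> ?M"
    using cnj_root_of_unity(2)[OF n xi_power_self[OF n]] module_cnj[OF n] by auto
  have refl: "(\<forall>x\<in>?M. (z * cnj x + t) - x \<in> ?I) \<longleftrightarrow> t \<in> ?I \<and> z ^ k = 1 \<and> n dvd 2 * k"
    if z: "z ^ ?N = 1" and t: "t \<in> ?M" for z t
  proof
    assume *: "\<forall>x\<in>?M. (z * cnj x + t) - x \<in> ?I"
    have tI: "t \<in> ?I" using *[rule_format, of 0] by simp
    have "z + t - 1 \<in> ?I" using *[rule_format, of 1] by simp
    from ideal_closed(4)[OF I tI this] have z1: "1 - z \<in> ?I" by simp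
    have "(z * cnj (xi n) + t) - xi n \<in> ?I" using * by simp
    from ideal_closed(4)[OF I this tI] have "z * cnj (xi n) - xi n \<in> ?I" by (simp add: algebra_simps)
    from ideal_closed(3)[OF I this ideal_closed(5)[OF I z1 xn(2)]] have "cnj (xi n) - xi n \<in> ?I"
      by (simp add: algebra_simps)
    from ideal_closed(6)[OF I this module_xi_self] have "1 - xi n ^ 2 \<in> ?I"
      using xn(1) by (simp add: algebra_simps power2_eq_square)
    then show "t \<in> ?I \<and> z ^ k = 1 \<and> n dvd 2 * k" using tI kiff[OF z] z1 xi2 by simp
  next
    assume *: "t \<in> ?I \<and> z ^ k = 1 \<and> n dvd 2 * k"
    then have z1: "1 - z \<in> ?I" using kiff[OF z] by simp
    have "1 - xi n ^ 2 \<in> ?I" using * xi2 by simp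
    from ideal_closed(6)[OF I this xn(2)] have gen: "cnj (xi n) - xi n \<in> ?I"
      using xn(1) by (simp add: algebra_simps power2_eq_square)
    have cnj: "cnj x - x \<in> ?I" if "x \<in> ?M" for x
      using that
    proof (induction rule: module_induct)
      case (of_int k)
      then show ?case using ideal_closed(2)[OF I] by simp
    next
      case (add x y)
      from ideal_closed(3)[OF I add(3,4)] show ?case by (simp add: algebra_simps)
    next
      case (mult x y)
      have "(cnj x - x) * cnj y + x * (cnj y - y) \<in> ?I"
        using ideal_closed(3)[OF I ideal_closed(5)[OF I mult(3) module_cnj[OF n mult(2)]]
          ideal_closed(6)[OF I mult(4,1)]] .
      then show ?case by (simp add: algebra_simps)
    qed (rule gen)
    show "\<forall>x\<in>?M. (z * cnj x + t) - x \<in> ?I"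
    proof
      fix x assume x: "x \<in> ?M"
      have "t - (1 - z) * cnj x \<in> ?I"
        using * ideal_closed(4)[OF I _ ideal_closed(5)[OF I z1 module_cnj[OF n x]]] by blast
      from ideal_closed(3)[OF I this cnj[OF x]] show "(z * cnj x + t) - x \<in> ?I"
        by (simp add: algebra_simps)
    qed
  qed
  show ?thesis
  proof (intro Set.set_eqI iffI)
    fix h assume "h \<in> colour_preserving n l c"
    then obtain z t where zt: "z ^ ?N = 1" "t \<in> ?M" "h = (\<lambda>x. z * x + t) \<or> h = (\<lambda>x. z * cnj x + t)"
      and h: "\<forall>x\<in>?M. h x - x \<in> ?I"
      using colour_preserving_iff[OF n c] module_symmetries_iff[OF n] by auto
    from zt(3) show "h \<in> {\<lambda>x. g x + t | g t. g \<in> point_group n k \<and> t \<in> ?I}"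
    proof
      assume hz: "h = (\<lambda>x. z * x + t)"
      then have "t \<in> ?I" "z ^ k = 1" using h rot[OF zt(1,2)] by auto
      moreover from this(2) have "(\<lambda>x. z * x) \<in> point_group n k" using point_group_iff[OF k0] by blast
      ultimately show ?thesis unfolding hz by blast
    next
      assume hz: "h = (\<lambda>x. z * cnj x + t)"
      then have "t \<in> ?I" "z ^ k = 1" "n dvd 2 * k" using h refl[OF zt(1,2)] by auto
      moreover from this(2,3) have "(\<lambda>x. z * cnj x) \<in> point_group n k" using point_group_iff[OF k0] by blast
      ultimately show ?thesis unfolding hz
        by (intro CollectI exI[of _ "\<lambda>x. z * cnj x"] exI[of _ t]) auto
    qed
  next
    fix h assume "h \<in> {\<lambda>x. g x + t | g t. g \<in> point_group n k \<and> t \<in> ?I}"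
    then obtain g t where gt: "h = (\<lambda>x. g x + t)" "g \<in> point_group n k" "t \<in> ?I" by blast
    then obtain z where z: "z ^ k = 1" "g = (\<lambda>x. z * x) \<or> n dvd 2 * k \<and> g = (\<lambda>x. z * cnj x)"
      using point_group_iff[OF k0] by blast
    have tM: "t \<in> ?M" using gt(3) IM by blast
    from z(2) show "h \<in> colour_preserving n l c"
    proof
      assume "g = (\<lambda>x. z * x)"
      then have h: "h = (\<lambda>x. z * x + t)" using gt(1) by simp
      moreover from h have "h \<in> module_symmetries n"
        using zN[OF z(1)] tM module_symmetries_iff[OF n] by blast
      moreover have "\<forall>x\<in>?M. h x - x \<in> ?I" unfolding h using rot[OF zN[OF z(1)] tM] gt(3) z(1) by blast
      ultimately show ?thesis using colour_preserving_iff[OF n c] by blast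
    next
      assume g: "n dvd 2 * k \<and> g = (\<lambda>x. z * cnj x)"
      then have h: "h = (\<lambda>x. z * cnj x + t)" using gt(1) by simp
      moreover from h have "h \<in> module_symmetries n"
        using zN[OF z(1)] tM module_symmetries_iff[OF n] by blast
      moreover have "\<forall>x\<in>?M. h x - x \<in> ?I" unfolding h using refl[OF zN[OF z(1)] tM] gt(3) z(1) g by blast
      ultimately show ?thesis using colour_preserving_iff[OF n c] by blast
    qed
  qed
qed

lemma origin_fixing_eq:
  assumes n: "n > 0" and c: "bravais_colouring n q l c" and k: "roots_congruent_1 n q k"
  shows "origin_fixing n l c = point_group n k"
proof -
  have k0: "0 < k" using k by (simp add: roots_congruent_1_def)
  have g0: "g 0 = 0" if "g \<in> point_group n k" for g using that point_group_iff[OF k0] by auto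
  have I0: "0 \<in> principal_ideal n q"
    by (rule ideal_closed(2)[OF ideal_principal[OF bravais_colouringD(1)[OF c]]])
  show ?thesis
  proof (intro Set.set_eqI iffI)
    fix h assume "h \<in> origin_fixing n l c"
    then obtain g t where "h = (\<lambda>x. g x + t)" "g \<in> point_group n k" "h 0 = 0"
      unfolding origin_fixing_def colour_preserving_eq[OF assms] by blast
    moreover from this have "t = 0" using g0 by fastforce
    ultimately show "h \<in> point_group n k" by simp
  next
    fix h assume h: "h \<in> point_group n k"
    then have "(\<lambda>x. h x + 0) \<in> {\<lambda>x. g x + t | g t. g \<in> point_group n k \<and> t \<in> principal_ideal n q}"
      using I0 by blast
    then show "h \<in> origin_fixing n l c"
      unfolding origin_fixing_def colour_preserving_eq[OF assms] using g0[OF h] by simp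
  qed
qed

lemma yields_point_group:
  assumes n: "n > 0" and c: "bravais_colouring n q l c" and k: "roots_congruent_1 n q k"
  shows "yields n q l c (point_group n k)"
proof -
  let ?I = "principal_ideal n q"
  have k0: "0 < k" using k by (simp add: roots_congruent_1_def)
  note I = ideal_principal[OF bravais_colouringD(1)[OF c]]
  have "internal_semidirect plane {\<lambda>x. g x + t | g t. g \<in> point_group n k \<and> t \<in> ?I}
      (translation_group ?I) (point_group n k)"
  proof (rule internal_semidirect_affine)

    have "cnj \<in> carrier plane" "rotation k \<in> carrier plane"
      using bij_reflection[of 1 1] bij_rotation[OF xi_power_self[OF k0] k0]
      by (simp_all add: plane_carrier rotation_def)
    then show "subgroup (point_group n k) plane"
      unfolding point_group_def cyc_def dih_def
      by (auto intro!: group.generate_is_subgroup[OF group_plane])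
    show "g (x + y) = g x + g y" if "g \<in> point_group n k" for g x y
      using that point_group_iff[OF k0] by (auto simp: algebra_simps)
    show "g t \<in> ?I" if g: "g \<in> point_group n k" and t: "t \<in> ?I" for g t
    proof -
      have "(\<lambda>x. g x + 0) \<in> {\<lambda>x. g x + t | g t. g \<in> point_group n k \<and> t \<in> ?I}"
        using g ideal_closed(2)[OF I] by blast
      then have "g \<in> colour_preserving n l c" unfolding colour_preserving_eq[OF assms] by simp
      then have "g t - t \<in> ?I"
        using colour_preserving_iff[OF n c] t ideal_closed(1)[OF I] by blast
      from ideal_closed(3)[OF I this t] show ?thesis by simp
    qed
  qed (use ideal_closed(2,3,7)[OF I] in auto)
  then show ?thesis
    unfolding yields_def origin_fixing_eq[OF assms] colour_preserving_eq[OF assms] by simp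
qed

lemma trivial_K_of_roots_congruent_1:
  assumes n: "n > 2" and c: "bravais_colouring n q l c" and k: "roots_congruent_1 n q 1"
  shows "trivial_K n q l c"
proof -
  have "\<not> n dvd 2" using n by (auto dest: dvd_imp_le)
  then have "point_group n 1 = {\<lambda>x. x}" by (auto simp: point_group_def cyc_eq)
  then show ?thesis
    using colour_preserving_eq[OF _ c k] n
    by (auto simp: trivial_K_def translation_group_def)
qed

lemma roots_congruent_1_cong:
  "principal_ideal n q = principal_ideal n q' \<Longrightarrow> roots_congruent_1 n q k = roots_congruent_1 n q' k"
  by (simp add: roots_congruent_1_def)

lemma induces_group_point_group:
  assumes "n > 0" "q \<in> cyclotomic_module n" "q \<noteq> 0" "0 < module_index n (principal_ideal n q)"
    and "roots_congruent_1 n q k"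
  shows "induces_group n q (point_group n k)"
  using assms exists_bravais_colouring[OF assms(2,3) refl assms(4)] yields_point_group[OF assms(1) _ assms(5)]
  by (auto simp: induces_group_def)

lemma induces_trivial_of_roots_congruent_1:
  assumes "n > 2" "q \<in> cyclotomic_module n" "q \<noteq> 0" "0 < module_index n (principal_ideal n q)"
    and "roots_congruent_1 n q 1"
  shows "induces_trivial n q"
  using assms exists_bravais_colouring[OF assms(2,3) refl assms(4)]
    trivial_K_of_roots_congruent_1[OF assms(1) _ assms(5)]
  by (auto simp: induces_trivial_def)

section \<open>The table in terms of prime factorizations\<close>

primrec largest_exponent_below :: "nat \<Rightarrow> nat \<Rightarrow> nat \<Rightarrow> nat \<Rightarrow> nat" where
  "largest_exponent_below p a e 0 = 0"
| "largest_exponent_below p a e (Suc s) =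
     (if e \<le> p ^ (a - Suc s) then Suc s else largest_exponent_below p a e s)"

lemma largest_exponent_below_numeral:
  "largest_exponent_below p a e 1 = (if e \<le> p ^ (a - 1) then 1 else 0)"
  "largest_exponent_below p a e (numeral k) =
     (if e \<le> p ^ (a - numeral k) then numeral k else largest_exponent_below p a e (pred_numeral k))"
  by (simp_all add: numeral_eq_Suc)

text \<open>For \<open>e\<close> the largest exponent in the factorization of \<open>q\<close> and \<open>s\<close> this number, the roots of unity congruent
  to 1 are the \<open>p\<^sup>s\<close>-th ones.\<close>

definition fixing_exponent :: "nat \<Rightarrow> nat \<Rightarrow> nat \<Rightarrow> nat" where
  "fixing_exponent p a e = largest_exponent_below p a e a"

lemma largest_exponent_below:
  fixes p a e :: nat
  defines "t \<equiv> largest_exponent_below p a e"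
  shows "t s \<le> s \<and> (t s > 0 \<longrightarrow> e \<le> p ^ (a - t s)) \<and> (t s < s \<longrightarrow> p ^ (a - t s - 1) < e)"
  unfolding t_def by (induction s) (auto simp: less_Suc_eq not_le)

context prime_above
begin

lemma critical_fixing_exponent: "critical_exponent e (fixing_exponent p a e)"
  using largest_exponent_below[of p a e a] by (simp add: critical_exponent_def fixing_exponent_def)

lemma dvd_of_one_minus_xi_p: "1 - xi p \<in> PI q \<Longrightarrow> lam ^ (p ^ (a - 1)) \<in> PI q"
  using one_minus_xi_p principal_ideal_trans principal_ideal_refl by blast

end

context one_prime_above
begin

lemma exists_colouring:
  assumes "0 < J"
  shows "\<exists>q c. bravais_colouring n q (p ^ (f * J)) c"
proof -
  have "0 < p ^ (f * J)" using p_gt_1 by simp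
  then show ?thesis
    using exists_bravais_colouring[of "lam ^ J" n "p ^ (f * J)"] lam_in_M lam_nonzero
      module_index_lam_power by auto
qed

lemma colouring_yields:
  assumes J: "0 < J" and c: "bravais_colouring n q (p ^ (f * J)) c"
  shows "yields n q (p ^ (f * J)) c (point_group n (p ^ fixing_exponent p a J))"
proof -
  obtain J' where J': "PI q = PI (lam ^ J')" "f * J = f * J'"
    using prime_power_index_cases[OF bravais_colouringD(1)[OF c] bravais_colouringD(3)[OF c, symmetric]] by blast
  then have "PI q = PI (lam ^ J)" using f_pos by simp
  then have "roots_congruent_1 n q (p ^ fixing_exponent p a J)"
    using roots_congruent_1_cong roots_congruent_1_lam_power[OF J critical_fixing_exponent] by blast
  then show ?thesis by (rule yields_point_group[OF n_pos c])
qed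

lemma colours_of_nontrivial:
  assumes c: "bravais_colouring n q l c" and "1 < l" and "1 - xi p \<in> PI q"
  shows "\<exists>J\<in>{1..p ^ (a - 1)}. l = p ^ (f * J)"
proof -
  obtain J where J: "J \<le> p ^ (a - 1)" "PI q = PI (lam ^ J)"
    using dvd_lam_power_cases[OF bravais_colouringD(1)[OF c] dvd_of_one_minus_xi_p[OF assms(3)]] by blast
  then have "l = p ^ (f * J)" using bravais_colouringD(3)[OF c] module_index_lam_power by simp
  moreover from this have "J \<noteq> 0" using \<open>1 < l\<close> by (intro notI) simp
  ultimately show ?thesis using J by (intro bexI[of _ J]) auto
qed

text \<open>A prime ideal containing \<open>1 - \<xi>\<^sub>p\<close>, an associate of a power of \<open>lam\<close>, contains \<open>lam\<close> and is the maximal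
  ideal \<open>(lam)\<close>.\<close>

lemma not_splits: "\<not> splits n (1 - xi p)"
proof
  assume "splits n (1 - xi p)"
  then obtain I J where IJ: "primeideal I (cyclotomic_ring n)" "primeideal J (cyclotomic_ring n)" "I \<noteq> J"
    "1 - xi p \<in> I" "1 - xi p \<in> J" unfolding splits_def by blast
  have "I = PI lam" if I: "primeideal I (cyclotomic_ring n)" and x: "1 - xi p \<in> I" for I
  proof -
    have id: "ideal I (cyclotomic_ring n)" using I by (rule primeideal.axioms(1))
    have no1: "1 \<notin> I"
      using primeideal.I_notcarr[OF I] proper_ideal_iff[OF id] by auto
    have "lam ^ (p ^ (a - 1)) \<in> PI (1 - xi p)" by (rule dvd_of_one_minus_xi_p) simp
    then have "lam ^ (p ^ (a - 1)) \<in> I"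
      using ideal_closed(5)[OF id x] by (auto simp: in_principal_ideal_iff)
    moreover have "lam ^ e \<in> I \<Longrightarrow> lam \<in> I" for e
    proof (induction e)
      case 0
      then show ?case using no1 by simp
    next
      case (Suc e)
      then show ?case using primeideal.I_prime[OF I, of lam "lam ^ e"] lam_in_M by auto
    qed
    ultimately have "lam \<in> I" by blast
    then show ?thesis using lam.r_maximal[OF id _ no1] by blast
  qed
  then show False using IJ by blast
qed

end

context two_primes_above
begin

lemma exists_colouring:
  assumes "0 < i + j"
  shows "\<exists>c. bravais_colouring n (r ^ i * r' ^ j) (p ^ (f * (i + j))) c"
proof -
  have "0 < p ^ (f * (i + j))" using p_gt_1 by simp
  then show ?thesis
    using exists_bravais_colouring[OF powers_nonzero(2) powers_nonzero(1)] module_index_powers by metis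
qed

lemma colouring_yields:
  assumes c: "bravais_colouring n q l c" and ij: "PI q = PI (r ^ i * r' ^ j)" "0 < i + j"
  shows "yields n q l c (point_group n (p ^ fixing_exponent p a (max i j)))"
proof -
  have "roots_congruent_1 n q (p ^ fixing_exponent p a (max i j))"
    using roots_congruent_1_cong[OF ij(1)] roots_congruent_1_powers[OF ij(2) critical_fixing_exponent] by blast
  then show ?thesis by (rule yields_point_group[OF n_pos c])
qed

lemma colouring_cases:
  assumes c: "bravais_colouring n q (p ^ (f * J)) c"
  shows "\<exists>i j. PI q = PI (r ^ i * r' ^ j) \<and> i + j = J"
  using prime_power_index_cases[OF bravais_colouringD(1)[OF c] bravais_colouringD(3)[OF c, symmetric]] f_pos
  by auto

lemma colours_of_nontrivial:
  assumes c: "bravais_colouring n q l c" and "1 < l" and "1 - xi p \<in> PI q"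
  shows "\<exists>J\<in>{1..2 * p ^ (a - 1)}. l = p ^ (f * J)"
proof -
  obtain i j where ij: "i \<le> p ^ (a - 1)" "j \<le> p ^ (a - 1)" "PI q = PI (r ^ i * r' ^ j)"
    using dvd_lam_power_cases[OF bravais_colouringD(1)[OF c] dvd_of_one_minus_xi_p[OF assms(3)]] by blast
  then have "l = p ^ (f * (i + j))" using bravais_colouringD(3)[OF c] module_index_powers by simp
  moreover from this have "i + j \<noteq> 0" using \<open>1 < l\<close> by (intro notI) simp
  ultimately show ?thesis using ij by (intro bexI[of _ "i + j"]) auto
qed

lemma splits_into_lam: "splits_into n lam r r'"
  unfolding splits_into_def ideal_prod_principal[OF r(1,2)]
  using r r.primeideal_r r'.primeideal_r r_neq lam_eq by blast

lemma splits_lam: "splits n lam"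
  unfolding splits_def using r.primeideal_r r'.primeideal_r r_neq lam_in_r by blast

lemma induces_powers:
  assumes "0 < i + j" "q \<in> M" "PI q = PI (r ^ i * r' ^ j)"
  shows "induces_group n q (point_group n (p ^ fixing_exponent p a (max i j)))"
    and "ideal_index n q = p ^ (f * (i + j))"
    and "2 < n \<Longrightarrow> fixing_exponent p a (max i j) = 0 \<Longrightarrow> induces_trivial n q"
proof -
  have rc: "roots_congruent_1 n q (p ^ fixing_exponent p a (max i j))"
    using roots_congruent_1_cong[OF assms(3)] roots_congruent_1_powers[OF assms(1) critical_fixing_exponent] by blast
  have q0: "q \<noteq> 0"
  proof
    assume "q = 0"
    then have "r ^ i * r' ^ j \<in> PI 0" using assms(3) principal_ideal_refl by blast
    then show False using powers_nonzero(1)[of i j] by (simp add: in_principal_ideal_iff)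
  qed
  have ix: "module_index n (PI q) = p ^ (f * (i + j))" using assms(3) module_index_powers by simp
  then show "ideal_index n q = p ^ (f * (i + j))" using ideal_index_eq_module_index assms(2) by simp
  have pos: "0 < module_index n (PI q)" using ix p_gt_1 by simp
  show "induces_group n q (point_group n (p ^ fixing_exponent p a (max i j)))"
    by (rule induces_group_point_group[OF n_pos assms(2) q0 pos rc])
  show "induces_trivial n q" if "2 < n" "fixing_exponent p a (max i j) = 0"
    using induces_trivial_of_roots_congruent_1[OF that(1) assms(2) q0 pos] rc that(2) by simp
qed

end



text \<open>Prime ideals are proper, so that \<open>r\<close> and \<open>r'\<close> are not units.\<close>

lemma (in prime_above) two_primes_above_of_splits_into:
  assumes "totient m = 2 * f" "splits_into n lam r r'"
  shows "two_primes_above n p a m f r r'"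
proof
  show r: "r \<in> M" "r' \<in> M" using assms(2) by (auto simp: splits_into_def)
  have "primeideal (PI r) (cyclotomic_ring n)" "primeideal (PI r') (cyclotomic_ring n)"
    using assms(2) by (auto simp: splits_into_def)
  from this[THEN primeideal.I_notcarr] show "1 \<notin> PI r" "1 \<notin> PI r'"
    using proper_ideal_iff[OF ideal_principal] r by auto
  show "PI lam = PI (r * r')"
    using assms(2) ideal_prod_principal[OF r] by (simp add: splits_into_def)
qed (rule assms(1))

text \<open>A row \<open>(p, a, f, g)\<close> says that \<open>p\<^sup>a\<close> is the power of \<open>p\<close> in \<open>lcm 2 n\<close>, and that \<open>1 - \<xi>\<^bsub>p^a\<^esub>\<close> is
  the product of \<open>g\<close> primes of norm \<open>p\<^sup>f\<close>.\<close>

definition factorization_row :: "nat \<Rightarrow> nat \<times> nat \<times> nat \<times> nat \<Rightarrow> bool" where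
  "factorization_row n = (\<lambda>(p, a, f, g).
     g = 1 \<and> (\<exists>m. one_prime_above n p a m f) \<or>
     g = 2 \<and> (\<exists>m r r'. two_primes_above n p a m f r r'))"

text \<open>The \<open>J\<close>-fold products of primes above \<open>p\<close> have norm \<open>p\<^bsup>fJ\<^esup>\<close>. With two primes, the exponents are meant to be as
  equal as possible; the larger one is then \<open>(J + 1) div 2\<close>.\<close>

definition table_entry :: "nat \<Rightarrow> nat \<times> nat \<times> nat \<times> nat \<Rightarrow> nat \<Rightarrow> entry" where
  "table_entry n = (\<lambda>(p, a, f, g) J.
     (if g = 2 \<and> 2 \<le> J then Starred else Entry) (p ^ (f * J))
       (point_group n (p ^ fixing_exponent p a ((J + g - 1) div g))))"

definition table_line :: "nat \<Rightarrow> (nat \<times> nat \<times> nat \<times> nat) list \<Rightarrow> entry list" where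
  "table_line n D = concat (map (\<lambda>(p, a, f, g). map (table_entry n (p, a, f, g)) [1..<Suc (g * p ^ (a - 1))]) D)"

lemma set_table_line:
  "set (table_line n D) = (\<Union>(p, a, f, g)\<in>set D. table_entry n (p, a, f, g) ` {1..g * p ^ (a - 1)})"
  by (auto simp: table_line_def atLeastLessThanSuc_atLeastAtMost simp del: upt_Suc)

lemma prime_dvd_prod_list_powers:
  assumes "Factorial_Ring.prime (p :: nat)" "p dvd prod_list (map (\<lambda>(p, a, _). p ^ a) D)"
    "\<forall>(p', a, _) \<in> set D. Factorial_Ring.prime p'"
  shows "\<exists>a f g. (p, a, f, g) \<in> set D"
  using assms(2,3)
proof (induction D)
  case (Cons x D)
  obtain p' a f g where x: "x = (p', a, f, g)" by (cases x) auto
  then have "p dvd p' ^ a \<or> p dvd prod_list (map (\<lambda>(p, a, _). p ^ a) D)"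
    using Cons.prems(1) assms(1) by (simp add: prime_dvd_mult_iff)
  then show ?case
  proof
    assume "p dvd p' ^ a"
    then have "p dvd p'" by (rule prime_dvd_power[OF assms(1)])
    moreover have "Factorial_Ring.prime p'" using Cons.prems(2) x by simp
    ultimately have "p = p'" using assms(1) by (simp add: primes_dvd_imp_eq)
    then show ?thesis using x by auto
  next
    assume "p dvd prod_list (map (\<lambda>(p, a, _). p ^ a) D)"
    then show ?thesis using Cons.IH Cons.prems(2) by auto
  qed
qed (use assms(1) in auto)

text \<open>A root of unity other than 1 congruent to 1 makes \<open>q\<close> divide some \<open>1 - \<xi>\<^sub>p\<close>, and the norms of the divisors
  of \<open>1 - \<xi>\<^sub>p\<close> are in the table.\<close>

lemma trivial_unless_in_table:
  assumes n: "2 < n" and D: "\<forall>x\<in>set D. factorization_row n x"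
    "lcm 2 n = prod_list (map (\<lambda>(p, a, _). p ^ a) D)"
    and c: "bravais_colouring n q l c" "1 < l" "l \<notin> colours ` set (table_line n D)"
  shows "trivial_K n q l c"
proof (rule trivial_K_of_roots_congruent_1[OF n c(1)])
  have n0: "n > 0" using n by simp
  have row: "1 - xi p \<notin> principal_ideal n q" if p: "(p, a, f, g) \<in> set D" for p a f g
  proof
    assume q: "1 - xi p \<in> principal_ideal n q"
    have "factorization_row n (p, a, f, g)" using D(1) p by blast
    then have "\<exists>J\<in>{1..g * p ^ (a - 1)}. l = p ^ (f * J)"
      unfolding factorization_row_def split
    proof
      assume "g = 1 \<and> (\<exists>m. one_prime_above n p a m f)"
      then obtain m where g: "g = 1" "one_prime_above n p a m f" by blast
      show ?thesis using one_prime_above.colours_of_nontrivial[OF g(2) c(1,2) q] unfolding g(1) by simp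
    next
      assume "g = 2 \<and> (\<exists>m r r'. two_primes_above n p a m f r r')"
      then obtain m r r' where g: "g = 2" "two_primes_above n p a m f r r'" by blast
      show ?thesis using two_primes_above.colours_of_nontrivial[OF g(2) c(1,2) q] unfolding g(1) .
    qed
    then obtain J where J: "J \<in> {1..g * p ^ (a - 1)}" "l = p ^ (f * J)" by blast
    have "table_entry n (p, a, f, g) J \<in> set (table_line n D)"
      unfolding set_table_line using p J(1) by blast
    moreover have "colours (table_entry n (p, a, f, g) J) = l" using J(2) by (simp add: table_entry_def)
    ultimately show False using c(3) by blast
  qed
  have primes: "\<forall>(p', a, _) \<in> set D. Factorial_Ring.prime p'"
    using D(1) by (auto simp: factorization_row_def one_prime_above_def two_primes_above_def prime_above_def)
  have "z = 1" if z: "z ^ lcm 2 n = 1" "1 - z \<in> principal_ideal n q" for z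
  proof (rule ccontr)
    assume "z \<noteq> 1"
    then obtain p where p: "Factorial_Ring.prime p" "p dvd lcm 2 n" "1 - xi p \<in> principal_ideal n q"
      using exists_prime_one_minus_xi[OF n0 z(1) _ z(2)] by blast
    then show False using prime_dvd_prod_list_powers[OF p(1) _ primes] row D(2) by metis
  qed
  then show "roots_congruent_1 n q 1"
    unfolding roots_congruent_1_def
    using ideal_closed(2)[OF ideal_principal[OF bravais_colouringD(1)[OF c(1)]]] by auto
qed

section \<open>Factorizations of primes into two factors\<close>

text \<open>As \<open>u\<close> is a unit, \<open>q\<close> and its conjugate factor \<open>x\<close> up to associates.\<close>

definition conjugate_factor :: "nat \<Rightarrow> complex \<Rightarrow> complex \<Rightarrow> bool" where
  "conjugate_factor n x q \<longleftrightarrow> q \<in> cyclotomic_module n \<and>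
     (\<exists>u\<in>cyclotomic_module n. \<exists>v\<in>cyclotomic_module n. q * cnj q = u * x \<and> u * v = 1)"

lemma principal_ideal_unit_mult:
  assumes "u \<in> cyclotomic_module n" "v \<in> cyclotomic_module n" "u * v = 1"
  shows "principal_ideal n (u * x) = principal_ideal n x"
proof -
  have "x = (u * x) * v" using assms(3) by (simp add: mult.commute mult.left_commute)
  then show ?thesis using assms
    unfolding principal_ideal_eq_iff by (auto intro: principal_idealI[of v] principal_idealI[of u])
qed

text \<open>If \<open>q\<close> were a unit, so would be its conjugate, and hence \<open>lam\<close>.\<close>

lemma (in prime_above) two_primes_above_conjugate:
  assumes "totient m = 2 * f" and q: "conjugate_factor n lam q"
  shows "two_primes_above n p a m f q (cnj q)"
proof
  have qM: "q \<in> M" using q by (simp add: conjugate_factor_def)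
  show "q \<in> M" "cnj q \<in> M" using qM module_cnj[OF n_pos qM] by auto
  obtain u v where uv: "u \<in> M" "v \<in> M" "q * cnj q = u * lam" "u * v = 1"
    using q by (auto simp: conjugate_factor_def)
  show lam: "PI lam = PI (q * cnj q)"
    unfolding uv(3) using principal_ideal_unit_mult[OF uv(1,2,4)] by simp
  have unit: "1 \<in> PI (cnj x)" if x: "1 \<in> PI x" for x
  proof -
    obtain w where "w \<in> M" "1 = x * w" using x by (auto simp: in_principal_ideal_iff)
    then have "cnj w \<in> M" "1 = cnj x * cnj w"
      using module_cnj[OF n_pos] by (auto simp flip: complex_cnj_mult)
    then show ?thesis by (rule principal_idealI)
  qed
  have not_both: "\<not> (1 \<in> PI q \<and> 1 \<in> PI (cnj q))"
    using principal_ideal_mult_mono[of 1 n q 1 "cnj q"] lam_not_unit lam by auto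
  show "1 \<notin> PI q" using not_both unit[of q] by blast
  show "1 \<notin> PI (cnj q)" using not_both unit[of "cnj q"] by auto
qed (rule assms(1))

lemma roots_of_unity_relation:
  assumes "k > 1" "k dvd lcm 2 n" "n > 0"
  shows "xi k \<in> cyclotomic_module n" "xi k ^ k = 1" "(\<Sum>i<k. xi k ^ i) = 0" "cnj (xi k) = xi k ^ (k - 1)"
proof -
  have k: "0 < k" using assms(1) by simp
  show "xi k \<in> cyclotomic_module n" using module_xi assms by blast
  show 1: "xi k ^ k = 1" using k by (rule xi_power_self)
  have "xi k \<noteq> 1" using xi_power_eq_1_iff[OF k, of 1] assms(1) by auto
  then show "(\<Sum>i<k. xi k ^ i) = 0" using root_of_unity_sum_0[OF 1] by blast
  show "cnj (xi k) = xi k ^ (k - 1)" using cnj_root_of_unity(1)[OF k 1] .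
qed

text \<open>The quadratic irrationalities that are used, as Gaussian periods.\<close>

lemma omega:
  assumes "n > 0" "3 dvd lcm 2 n"
  shows "xi 3 \<in> cyclotomic_module n" "xi 3 * xi 3 = - xi 3 - 1" "cnj (xi 3) = - 1 - xi 3"
proof -
  note z = roots_of_unity_relation[of 3 n, OF _ assms(2,1)]
  show "xi 3 \<in> cyclotomic_module n" using z by simp
  have "1 + xi 3 + xi 3 * xi 3 = 0" using z(3) by (simp add: eval_nat_numeral)
  then show "xi 3 * xi 3 = - xi 3 - 1" by Groebner_Basis.algebra
  then show "cnj (xi 3) = - 1 - xi 3" using z(4) by (simp add: eval_nat_numeral)
qed

lemma exists_golden_ratio:
  assumes "n > 0" "5 dvd lcm 2 n"
  shows "\<exists>t\<in>cyclotomic_module n. t * t = t + 1 \<and> cnj t = t"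
proof -
  define z where "z = xi 5"
  note z = roots_of_unity_relation[of 5 n, OF _ assms(2,1), folded z_def]
  have s: "1 + z + z^2 + z^3 + z^4 = 0" and c: "cnj z = z^4"
    using z(3,4) by (simp_all add: eval_nat_numeral)
  let ?t = "- (z^2 + z^3)"
  have "z^5 = 1" using s by Groebner_Basis.algebra
  moreover have "cnj ?t = - ((z^4)^2 + (z^4)^3)" using c by simp
  ultimately have "cnj ?t = ?t" by Groebner_Basis.algebra
  moreover have "?t * ?t = ?t + 1" using s by Groebner_Basis.algebra
  moreover have "?t \<in> cyclotomic_module n" using z(1) by simp
  ultimately show ?thesis by blast
qed

lemma exists_sqrt_minus_7:
  assumes "n > 0" "7 dvd lcm 2 n"
  shows "\<exists>t\<in>cyclotomic_module n. t * t = t - 2 \<and> cnj t = 1 - t"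
proof -
  define z where "z = xi 7"
  note z = roots_of_unity_relation[of 7 n, OF _ assms(2,1), folded z_def]
  have s: "1 + z + z^2 + z^3 + z^4 + z^5 + z^6 = 0" and c: "cnj z = z^6"
    using z(3,4) by (simp_all add: eval_nat_numeral)
  let ?t = "- (z + z^2 + z^4)"
  have "z^7 = 1" using s by Groebner_Basis.algebra
  moreover have "cnj ?t = - (z^6 + (z^6)^2 + (z^6)^4)" using c by simp
  ultimately have "cnj ?t = 1 - ?t" using s by Groebner_Basis.algebra
  moreover have "?t * ?t = ?t - 2" using s by Groebner_Basis.algebra
  moreover have "?t \<in> cyclotomic_module n" using z(1) by simp
  ultimately show ?thesis by blast
qed

lemma exists_sqrt_minus_11:
  assumes "n > 0" "11 dvd lcm 2 n"
  shows "\<exists>t\<in>cyclotomic_module n. t * t = t - 3 \<and> cnj t = 1 - t"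
proof -
  define z where "z = xi 11"
  note z = roots_of_unity_relation[of 11 n, OF _ assms(2,1), folded z_def]
  have s: "1 + z + z^2 + z^3 + z^4 + z^5 + z^6 + z^7 + z^8 + z^9 + z^10 = 0" and c: "cnj z = z^10"
    using z(3,4) by (simp_all add: eval_nat_numeral)
  let ?t = "- (z + z^3 + z^4 + z^5 + z^9)"
  have "z^11 = 1" using s by Groebner_Basis.algebra
  moreover have "cnj ?t = - (z^10 + (z^10)^3 + (z^10)^4 + (z^10)^5 + (z^10)^9)" using c by simp
  ultimately have "cnj ?t = 1 - ?t" using s by Groebner_Basis.algebra
  moreover have "?t * ?t = ?t - 3" using s by Groebner_Basis.algebra
  moreover have "?t \<in> cyclotomic_module n" using z(1) by simp
  ultimately show ?thesis by blast
qed

lemma exists_sqrt_17: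
  assumes "n > 0" "17 dvd lcm 2 n"
  shows "\<exists>t\<in>cyclotomic_module n. t * t = 4 - t"
proof -
  define z where "z = xi 17"
  note z = roots_of_unity_relation[of 17 n, OF _ assms(2,1), folded z_def]
  have s: "1 + z + z^2 + z^3 + z^4 + z^5 + z^6 + z^7 + z^8 + z^9 + z^10 + z^11 + z^12 + z^13 + z^14
      + z^15 + z^16 = 0"
    using z(3) by (simp add: eval_nat_numeral)
  let ?t = "z + z^2 + z^4 + z^8 + z^16 + z^15 + z^13 + z^9"
  have "?t * ?t = 4 - ?t" using s by Groebner_Basis.algebra
  moreover have "?t \<in> cyclotomic_module n" using z(1) by simp
  ultimately show ?thesis by blast
qed

lemma exists_sqrt_minus_2:
  assumes "n > 0" "8 dvd lcm 2 n"
  shows "\<exists>t\<in>cyclotomic_module n. t * t = - 2 \<and> cnj t = - t"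
proof -
  define z where "z = xi 8"
  note z = roots_of_unity_relation[of 8 n, OF _ assms(2,1), folded z_def]
  have "z^4 = -1" using xi_mult_power[of 4 2] xi_2 by (simp add: z_def)
  moreover from this have "cnj (z + z^3) = z^7 + (z^7)^3" using z(4) by simp
  ultimately have "cnj (z + z^3) = - (z + z^3)" "(z + z^3) * (z + z^3) = -2" by Groebner_Basis.algebra+
  moreover have "z + z^3 \<in> cyclotomic_module n" using z(1) by simp
  ultimately show ?thesis by blast
qed

lemma module_i: "n > 0 \<Longrightarrow> 4 dvd lcm 2 n \<Longrightarrow> \<i> \<in> cyclotomic_module n"
  using module_xi[of n 4] xi_4 by simp

text \<open>The elements \<open>q\<close> in the following lemmas are small elements of norm \<open>p\<^sup>f\<close> in a small field that contains
  the decomposition field of \<open>p\<close>, which is quadratic, and in which the primes above \<open>p\<close> are principal. The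
  unit \<open>u\<close> is the quotient of \<open>q cnj q\<close> by \<open>1 - \<xi>\<^bsub>p^a\<^esub>\<close>, and \<open>v\<close> is its inverse.\<close>

lemma conjugate_factor_2_of_7:
  assumes "n > 0" "7 dvd lcm 2 n"
  shows "\<exists>q. conjugate_factor n 2 q"
proof -
  obtain t where t: "t \<in> cyclotomic_module n" "t * t = t - 2" "cnj t = 1 - t"
    using exists_sqrt_minus_7[OF assms] by blast
  have "t * cnj t = 1 * 2" unfolding t(3) using t(2) by Groebner_Basis.algebra
  then show ?thesis unfolding conjugate_factor_def
    using t(1) by (intro exI[of _ t] conjI bexI[of _ 1]) simp_all
qed

lemma conjugate_factor_2_of_15:
  assumes "n > 0" "3 dvd lcm 2 n" "5 dvd lcm 2 n"
  shows "\<exists>q. conjugate_factor n 2 q"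
proof -
  obtain t where t: "t \<in> cyclotomic_module n" "t * t = t + 1" "cnj t = t"
    using exists_golden_ratio[OF assms(1,3)] by blast
  note w = omega[OF assms(1,2)]
  have "(1 + xi 3 - t) * cnj (1 + xi 3 - t) = (1 + xi 3 - t) * (1 + (- 1 - xi 3) - t)"
    using t(3) w(3) by simp
  also have "\<dots> = 1 * 2" using t(2) w(2) by Groebner_Basis.algebra
  finally show ?thesis unfolding conjugate_factor_def
    using t(1) w(1) by (intro exI[of _ "1 + xi 3 - t"] conjI bexI[of _ 1]) simp_all
qed

lemma conjugate_factor_5_of_20:
  assumes "n > 0" "4 dvd lcm 2 n" "5 dvd lcm 2 n"
  shows "\<exists>q. conjugate_factor n (1 - xi 5) q"
proof -
  define z where "z = xi 5"
  note z = roots_of_unity_relation[of 5 n, OF _ assms(3,1), folded z_def]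
  have s: "1 + z + z^2 + z^3 + z^4 = 0" and c: "cnj z = z^4"
    using z(3,4) by (simp_all add: eval_nat_numeral)
  have i: "\<i> * \<i> = - 1" "\<i> \<in> cyclotomic_module n" using module_i[OF assms(1,2)] by simp_all
  let ?q = "1 + z + \<i> * z^4" and ?u = "1 + \<i> * z^4 - z^3 - \<i> * z^2 + z + \<i> - z^4" and ?v = "1 - z - \<i> * z^3"
  have "?q * cnj ?q = ?q * (1 + z^4 - \<i> * (z^4)^4)" using c by simp
  also have "\<dots> = ?u * (1 - z)" using s i(1) by Groebner_Basis.algebra
  finally have "?q * cnj ?q = ?u * (1 - z)" .
  moreover have "?u * ?v = 1" using s i(1) by Groebner_Basis.algebra
  moreover have "?q \<in> cyclotomic_module n" "?u \<in> cyclotomic_module n" "?v \<in> cyclotomic_module n"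
    using z(1) i(2) by simp_all
  ultimately show ?thesis unfolding conjugate_factor_def z_def[symmetric] by blast
qed

lemma conjugate_factor_7_of_21:
  assumes "n > 0" "3 dvd lcm 2 n" "7 dvd lcm 2 n"
  shows "\<exists>q. conjugate_factor n (1 - xi 7) q"
proof -
  define z where "z = xi 7"
  note z = roots_of_unity_relation[of 7 n, OF _ assms(3,1), folded z_def]
  have s: "1 + z + z^2 + z^3 + z^4 + z^5 + z^6 = 0" and c: "cnj z = z^6"
    using z(3,4) by (simp_all add: eval_nat_numeral)
  have z7: "z^7 = 1" using s by Groebner_Basis.algebra
  define w where "w = xi 3"
  note w = omega[OF assms(1,2), folded w_def]
  let ?q = "1 + z^2 - w * z^5" and ?u = "z^4 * (w + w * z^5 - z^2 + z^3 + z^5)"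
    and ?v = "z^3 * (1 + z^3 + z^4 - z^5 - w * z - w * z^4 - w * z^5)"
  have "cnj ?q = 1 + (z^6)^2 - (- 1 - w) * (z^6)^5" using c w(3) by simp
  also have "\<dots> = 1 + z^5 + (1 + w) * z^2" using z7 by Groebner_Basis.algebra
  finally have "?q * cnj ?q = ?q * (1 + z^5 + (1 + w) * z^2)" by simp
  also have "\<dots> = ?u * (1 - z)" using s w(2) by Groebner_Basis.algebra
  finally have "?q * cnj ?q = ?u * (1 - z)" .
  moreover have "?u * ?v = 1" using s w(2) by Groebner_Basis.algebra
  moreover have "?q \<in> cyclotomic_module n" "?u \<in> cyclotomic_module n" "?v \<in> cyclotomic_module n"
    using z(1) w(1) by simp_all
  ultimately show ?thesis unfolding conjugate_factor_def z_def[symmetric] by blast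
qed

lemma conjugate_factor_3_of_24:
  assumes "n > 0" "3 dvd lcm 2 n" "8 dvd lcm 2 n"
  shows "\<exists>q. conjugate_factor n (1 - xi 3) q"
proof -
  define w where "w = xi 3"
  note w = omega[OF assms(1,2), folded w_def]
  obtain t where t: "t \<in> cyclotomic_module n" "t * t = - 2" "cnj t = - t"
    using exists_sqrt_minus_2[OF assms(1,3)] by blast
  let ?q = "1 + w * t" and ?u = "2 + w + w * t" and ?v = "1 - w - t - w * t"
  have "?q * cnj ?q = ?q * (1 + (- 1 - w) * (- t))" using w(3) t(3) by simp
  also have "\<dots> = ?u * (1 - w)" using w(2) t(2) by Groebner_Basis.algebra
  finally have "?q * cnj ?q = ?u * (1 - w)" .
  moreover have "?u * ?v = 1" using w(2) t(2) by Groebner_Basis.algebra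
  moreover have "?q \<in> cyclotomic_module n" "?u \<in> cyclotomic_module n" "?v \<in> cyclotomic_module n"
    using w(1) t(1) by simp_all
  ultimately show ?thesis unfolding conjugate_factor_def w_def[symmetric] by blast
qed

lemma conjugate_factor_2_of_28:
  assumes "n > 0" "4 dvd lcm 2 n" "7 dvd lcm 2 n"
  shows "\<exists>q. conjugate_factor n (1 - xi 4) q"
proof -
  obtain t where t: "t \<in> cyclotomic_module n" "t * t = t - 2" "cnj t = 1 - t"
    using exists_sqrt_minus_7[OF assms(1,3)] by blast
  have i: "\<i> * \<i> = - 1" "\<i> \<in> cyclotomic_module n" using module_i[OF assms(1,2)] by simp_all
  let ?q = "1 + \<i> * t" and ?u = "2 - t + \<i> + \<i> * t" and ?v = "2 - t - \<i> - \<i> * t"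
  have "?q * cnj ?q = ?q * (1 - \<i> * (1 - t))" using t(3) by simp
  also have "\<dots> = ?u * (1 - \<i>)" using t(2) i(1) by Groebner_Basis.algebra
  finally have "?q * cnj ?q = ?u * (1 - \<i>)" .
  moreover have "?u * ?v = 1" using t(2) i(1) by Groebner_Basis.algebra
  moreover have "?q \<in> cyclotomic_module n" "?u \<in> cyclotomic_module n" "?v \<in> cyclotomic_module n"
    using t(1) i(2) by simp_all
  ultimately show ?thesis unfolding conjugate_factor_def xi_4 by blast
qed

lemma conjugate_factor_3_of_33:
  assumes "n > 0" "3 dvd lcm 2 n" "11 dvd lcm 2 n"
  shows "\<exists>q. conjugate_factor n (1 - xi 3) q"
proof -
  define w where "w = xi 3"
  note w = omega[OF assms(1,2), folded w_def]
  obtain t where t: "t \<in> cyclotomic_module n" "t * t = t - 3" "cnj t = 1 - t"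
    using exists_sqrt_minus_11[OF assms(1,3)] by blast
  let ?q = "t - 1 - 2 * w" and ?u = "4 + w + 2 * w * t" and ?v = "3 - w - 2 * t - 2 * w * t"
  have "?q * cnj ?q = ?q * (1 - t - 1 - 2 * (- 1 - w))" using w(3) t(3) by simp
  also have "\<dots> = ?u * (1 - w)" using w(2) t(2) by Groebner_Basis.algebra
  finally have "?q * cnj ?q = ?u * (1 - w)" .
  moreover have "?u * ?v = 1" using w(2) t(2) by Groebner_Basis.algebra
  moreover have "?q \<in> cyclotomic_module n" "?u \<in> cyclotomic_module n" "?v \<in> cyclotomic_module n"
    using w(1) t(1) by simp_all
  ultimately show ?thesis unfolding conjugate_factor_def w_def[symmetric] by blast
qed

lemma conjugate_factor_2_of_60:
  assumes "n > 0" "3 dvd lcm 2 n" "4 dvd lcm 2 n" "5 dvd lcm 2 n"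
  shows "\<exists>q. conjugate_factor n (1 - xi 4) q"
proof -
  define w where "w = xi 3"
  note w = omega[OF assms(1,2), folded w_def]
  obtain t where t: "t \<in> cyclotomic_module n" "t * t = t + 1" "cnj t = t"
    using exists_golden_ratio[OF assms(1,4)] by blast
  have i: "\<i> * \<i> = - 1" "\<i> \<in> cyclotomic_module n" using module_i[OF assms(1,3)] by simp_all
  let ?q = "1 + \<i> * w * t" and ?u = "1 - w * t + \<i> + \<i> * t + \<i> * w * t"
    and ?v = "2 - t + w - w * t - \<i> + \<i> * w - \<i> * w * t"
  have "?q * cnj ?q = ?q * (1 + (- \<i>) * (- 1 - w) * t)" using w(3) t(3) by simp
  also have "\<dots> = ?u * (1 - \<i>)" using w(2) t(2) i(1) by Groebner_Basis.algebra
  finally have "?q * cnj ?q = ?u * (1 - \<i>)" .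
  moreover have "?u * ?v = 1" using w(2) t(2) i(1) by Groebner_Basis.algebra
  moreover have "?q \<in> cyclotomic_module n" "?u \<in> cyclotomic_module n" "?v \<in> cyclotomic_module n"
    using w(1) t(1) i(2) by simp_all
  ultimately show ?thesis unfolding conjugate_factor_def xi_4 by blast
qed

lemma conjugate_factor_3_of_60:
  assumes "n > 0" "3 dvd lcm 2 n" "4 dvd lcm 2 n" "5 dvd lcm 2 n"
  shows "\<exists>q. conjugate_factor n (1 - xi 3) q"
proof -
  define w where "w = xi 3"
  note w = omega[OF assms(1,2), folded w_def]
  obtain t where t: "t \<in> cyclotomic_module n" "t * t = t + 1" "cnj t = t"
    using exists_golden_ratio[OF assms(1,4)] by blast
  have i: "\<i> * \<i> = - 1" "\<i> \<in> cyclotomic_module n" using module_i[OF assms(1,3)] by simp_all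
  let ?q = "1 + t + w + \<i> * w * t" and ?u = "2 + 2 * t + w + w * t + \<i> * w + 2 * \<i> * w * t"
    and ?v = "1 - w - \<i> * t - \<i> * w * t"
  have "?q * cnj ?q = ?q * (1 + t + (- 1 - w) + (- \<i>) * (- 1 - w) * t)" using w(3) t(3) by simp
  also have "\<dots> = ?u * (1 - w)" using w(2) t(2) i(1) by Groebner_Basis.algebra
  finally have "?q * cnj ?q = ?u * (1 - w)" .
  moreover have "?u * ?v = 1" using w(2) t(2) i(1) by Groebner_Basis.algebra
  moreover have "?q \<in> cyclotomic_module n" "?u \<in> cyclotomic_module n" "?v \<in> cyclotomic_module n"
    using w(1) t(1) i(2) by simp_all
  ultimately show ?thesis unfolding conjugate_factor_def w_def[symmetric] by blast
qed

text \<open>A root of \<open>x\<^sup>2 - t x + N\<close> is irrational if some prime divides the discriminant to an odd power.\<close>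

lemma irrational_quadratic_not_unit:
  fixes a :: complex and t N :: int
  assumes n: "n > 0" and a: "a * a = of_int t * a - of_int N" and N: "\<bar>N\<bar> \<noteq> 1"
    and p: "Factorial_Ring.prime p" "odd (multiplicity p (t\<^sup>2 - 4 * N))"
  shows "1 \<notin> principal_ideal n a"
proof (rule quadratic_not_unit[OF n a N])
  fix u v :: int assume uv: "of_int u + of_int v * a = 0"
  show "v = 0"
  proof (rule ccontr)
    assume v: "v \<noteq> 0"
    define w where "w = 2 * u + t * v"
    have "(of_int w :: complex) * of_int w = of_int v * of_int v * (of_int t * of_int t - 4 * of_int N)"
      unfolding w_def of_int_add of_int_mult of_int_numeral using uv a by Groebner_Basis.algebra
    then have "(of_int (w * w) :: complex) = of_int (v * v * (t\<^sup>2 - 4 * N))"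
      by (simp add: power2_eq_square)
    then have eq: "w ^ 2 = v ^ 2 * (t\<^sup>2 - 4 * N)" by (simp only: of_int_eq_iff power2_eq_square)
    have d: "t\<^sup>2 - 4 * N \<noteq> 0" using p(2) by (intro notI) simp
    then have w: "w \<noteq> 0" using eq v by auto
    have pe: "prime_elem p" using p(1) by (rule prime_imp_prime_elem)
    have "multiplicity p (w ^ 2) = 2 * multiplicity p w"
      using pe w by (simp add: prime_elem_multiplicity_power_distrib)
    moreover have "multiplicity p (v ^ 2 * (t\<^sup>2 - 4 * N)) = 2 * multiplicity p v + multiplicity p (t\<^sup>2 - 4 * N)"
      using pe v d by (simp add: prime_elem_multiplicity_mult_distrib prime_elem_multiplicity_power_distrib)
    ultimately show False using eq p(2) by (metis dvd_triv_left even_add)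
  qed
qed

text \<open>The factors \<open>(3 \<plusminus> \<surd>17) / 2\<close>, of norm \<open>-2\<close>.\<close>

lemma exists_factor_2_of_17:
  assumes "n > 0" "17 dvd lcm 2 n"
  shows "\<exists>q q'. q \<in> cyclotomic_module n \<and> q' \<in> cyclotomic_module n \<and> q * q' = - 2 \<and>
           1 \<notin> principal_ideal n q \<and> 1 \<notin> principal_ideal n q'"
proof -
  obtain t where t: "t \<in> cyclotomic_module n" "t * t = 4 - t" using exists_sqrt_17[OF assms] by blast
  have "odd (multiplicity 17 (3\<^sup>2 - 4 * (- 2) :: int))"
    by (simp add: multiplicity_self)
  then have not_unit: "1 \<notin> principal_ideal n q" if "q * q = 3 * q + 2" for q
    using irrational_quadratic_not_unit[OF assms(1), of q 3 "- 2" 17] that by simp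
  have "(2 + t) * (2 + t) = 3 * (2 + t) + 2" "(1 - t) * (1 - t) = 3 * (1 - t) + 2" "(2 + t) * (1 - t) = - 2"
    using t(2) by Groebner_Basis.algebra+
  moreover have "2 + t \<in> cyclotomic_module n" "1 - t \<in> cyclotomic_module n" using t(1) by simp_all
  ultimately show ?thesis using not_unit by blast
qed

text \<open>The factors \<open>(5 \<plusminus> \<surd>33) / 2\<close>, of norm \<open>-2\<close>; \<open>(1 + 2 w) (2 t - 1)\<close> is a square root of 33.\<close>

lemma exists_factor_2_of_33:
  assumes "n > 0" "3 dvd lcm 2 n" "11 dvd lcm 2 n"
  shows "\<exists>q q'. q \<in> cyclotomic_module n \<and> q' \<in> cyclotomic_module n \<and> q * q' = - 2 \<and>
           1 \<notin> principal_ideal n q \<and> 1 \<notin> principal_ideal n q'"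
proof -
  define w where "w = xi 3"
  note w = omega[OF assms(1,2), folded w_def]
  obtain t where t: "t \<in> cyclotomic_module n" "t * t = t - 3"
    using exists_sqrt_minus_11[OF assms(1,3)] by blast
  let ?q = "2 + t - w + 2 * w * t"
  have "multiplicity 11 (11 * 3 :: int) = multiplicity 11 (11 :: int) + multiplicity 11 (3 :: int)"
    by (rule prime_elem_multiplicity_mult_distrib) simp_all
  then have "odd (multiplicity 11 (5\<^sup>2 - 4 * (- 2) :: int))"
    by (simp add: multiplicity_self not_dvd_imp_multiplicity_0)
  then have not_unit: "1 \<notin> principal_ideal n q" if "q * q = 5 * q + 2" for q
    using irrational_quadratic_not_unit[OF assms(1), of q 5 "- 2" 11] that by simp
  have "?q * ?q = 5 * ?q + 2" "(5 - ?q) * (5 - ?q) = 5 * (5 - ?q) + 2" "?q * (5 - ?q) = - 2"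
    using t(2) w(2) by Groebner_Basis.algebra+
  moreover have "?q \<in> cyclotomic_module n" "5 - ?q \<in> cyclotomic_module n" using t(1) w(1) by simp_all
  ultimately show ?thesis using not_unit by blast
qed

text \<open>Here \<open>q q' = \<i> w (1 - w)\<close> with \<open>q = 1 + \<i> w + \<i> t\<close> and \<open>q' = 1 + \<i> w + \<i> (1 - t)\<close>; and \<open>q\<close> is not a
  unit because \<open>q \<^emph>\<open>cnj\<close> q\<close> is divisible by \<open>2 + \<i> (2 t - 1)\<close>, a root of \<open>x\<^sup>2 - 4 x - 3\<close>.\<close>

lemma exists_factor_3_of_84:
  assumes "n > 0" "3 dvd lcm 2 n" "4 dvd lcm 2 n" "7 dvd lcm 2 n"
  shows "\<exists>q q' u v. q \<in> cyclotomic_module n \<and> q' \<in> cyclotomic_module n \<and>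
           u \<in> cyclotomic_module n \<and> v \<in> cyclotomic_module n \<and> q * q' = u * (1 - xi 3) \<and> u * v = 1 \<and>
           1 \<notin> principal_ideal n q \<and> 1 \<notin> principal_ideal n q'"
proof -
  define w where "w = xi 3"
  note w = omega[OF assms(1,2), folded w_def]
  have i: "\<i> * \<i> = - 1" "\<i> \<in> cyclotomic_module n" using module_i[OF assms(1,3)] by simp_all
  have not_unit: "1 \<notin> principal_ideal n (1 + \<i> * w + \<i> * t)"
    if t: "t \<in> cyclotomic_module n" "t * t = t - 2" "cnj t = 1 - t" for t
  proof
    let ?q = "1 + \<i> * w + \<i> * t" and ?a = "2 + \<i> * (2 * t - 1)" and ?b = "\<i> * (t + w)"
    assume "1 \<in> principal_ideal n ?q"
    then obtain x where x: "x \<in> cyclotomic_module n" "1 = ?q * x" by (auto simp: in_principal_ideal_iff)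
    have "?q * cnj ?q = ?q * (1 - \<i> * (- 1 - w) - \<i> * (1 - t))" using w(3) t(3) by simp
    also have "\<dots> = ?a * ?b" using w(2) t(2) i(1) by Groebner_Basis.algebra
    finally have "?a * (?b * x * cnj x) = (?q * x) * cnj (?q * x)" by (simp add: mult_ac)
    also have "\<dots> = 1" unfolding x(2)[symmetric] by simp
    finally have "1 = ?a * (?b * x * cnj x)" by simp
    then have "1 \<in> principal_ideal n ?a"
      using x(1) module_cnj[OF assms(1) x(1)] i(2) w(1) t(1) by (intro principal_idealI[of "?b * x * cnj x"]) simp_all
    moreover have "?a * ?a = 4 * ?a + 3" using t(2) i(1) by Groebner_Basis.algebra
    then have "?a * ?a = of_int 4 * ?a - of_int (- 3)"
      by (simp only: of_int_numeral of_int_minus diff_minus_eq_add)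
    moreover have "multiplicity 7 (7 * 4 :: int) = multiplicity 7 (7 :: int) + multiplicity 7 (4 :: int)"
      by (rule prime_elem_multiplicity_mult_distrib) simp_all
    then have "odd (multiplicity 7 (4\<^sup>2 - 4 * (- 3) :: int))"
      by (simp add: multiplicity_self not_dvd_imp_multiplicity_0)
    ultimately show False using irrational_quadratic_not_unit[OF assms(1), of ?a 4 "- 3" 7] by simp
  qed
  obtain t where t: "t \<in> cyclotomic_module n" "t * t = t - 2" "cnj t = 1 - t"
    using exists_sqrt_minus_7[OF assms(1,4)] by blast
  have t': "1 - t \<in> cyclotomic_module n" "(1 - t) * (1 - t) = (1 - t) - 2" "cnj (1 - t) = 1 - (1 - t)"
    using t(1) t(3) by simp_all (use t(2) in Groebner_Basis.algebra)
  have "(1 + \<i> * w + \<i> * t) * (1 + \<i> * w + \<i> * (1 - t)) = (\<i> * w) * (1 - w)"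
    using w(2) t(2) i(1) by Groebner_Basis.algebra
  moreover have "(\<i> * w) * (- (\<i> * (- 1 - w))) = 1" using w(2) i(1) by Groebner_Basis.algebra
  moreover have "1 + \<i> * w + \<i> * t \<in> cyclotomic_module n" "1 + \<i> * w + \<i> * (1 - t) \<in> cyclotomic_module n"
    "\<i> * w \<in> cyclotomic_module n" "- (\<i> * (- 1 - w)) \<in> cyclotomic_module n"
    using i(2) w(1) t(1) by simp_all
  ultimately show ?thesis
    unfolding w_def[symmetric] using not_unit[OF t] not_unit[OF t'] by blast
qed

section \<open>The factorizations that occur\<close>

definition factorization_data :: "(nat \<times> (nat \<times> nat \<times> nat \<times> nat) list) list" where
  "factorization_data = [
    (3, [(2, 1, 2, 1), (3, 1, 1, 1)]),
    (4, [(2, 2, 1, 1)]),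
    (5, [(2, 1, 4, 1), (5, 1, 1, 1)]),
    (7, [(2, 1, 3, 2), (7, 1, 1, 1)]),
    (8, [(2, 3, 1, 1)]),
    (9, [(2, 1, 6, 1), (3, 2, 1, 1)]),
    (11, [(2, 1, 10, 1), (11, 1, 1, 1)]),
    (12, [(2, 2, 2, 1), (3, 1, 2, 1)]),
    (13, [(2, 1, 12, 1), (13, 1, 1, 1)]),
    (15, [(2, 1, 4, 2), (3, 1, 4, 1), (5, 1, 2, 1)]),
    (16, [(2, 4, 1, 1)]),
    (17, [(2, 1, 8, 2), (17, 1, 1, 1)]),
    (19, [(2, 1, 18, 1), (19, 1, 1, 1)]),
    (20, [(2, 2, 4, 1), (5, 1, 1, 2)]),
    (21, [(2, 1, 6, 2), (3, 1, 6, 1), (7, 1, 1, 2)]),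
    (24, [(2, 3, 2, 1), (3, 1, 2, 2)]),
    (25, [(2, 1, 20, 1), (5, 2, 1, 1)]),
    (27, [(2, 1, 18, 1), (3, 3, 1, 1)]),
    (28, [(2, 2, 3, 2), (7, 1, 2, 1)]),
    (32, [(2, 5, 1, 1)]),
    (33, [(2, 1, 10, 2), (3, 1, 5, 2), (11, 1, 2, 1)]),
    (35, [(2, 1, 12, 2), (5, 1, 6, 1), (7, 1, 4, 1)]),
    (36, [(2, 2, 6, 1), (3, 2, 2, 1)]),
    (40, [(2, 3, 4, 1), (5, 1, 2, 2)]),
    (44, [(2, 2, 10, 1), (11, 1, 2, 1)]),
    (45, [(2, 1, 12, 2), (3, 2, 4, 1), (5, 1, 6, 1)]),
    (48, [(2, 4, 2, 1), (3, 1, 4, 2)]),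
    (60, [(2, 2, 4, 2), (3, 1, 4, 2), (5, 1, 2, 2)]),
    (84, [(2, 2, 6, 2), (3, 1, 6, 2), (7, 1, 2, 2)])
]"

text \<open>The conditions on the powers of \<open>p\<close> modulo \<open>m\<close> say that \<open>f\<close> is the order of \<open>p\<close> modulo \<open>m\<close>.\<close>

definition numerical_row :: "nat \<Rightarrow> nat \<times> nat \<times> nat \<times> nat \<Rightarrow> bool" where
  "numerical_row n = (\<lambda>(p, a, f, g). let m = lcm 2 n div p ^ a in
     Factorial_Ring.prime p \<and> 0 < a \<and> 0 < f \<and> (g = 1 \<or> g = 2) \<and> lcm 2 n = p ^ a * m \<and> \<not> p dvd m \<and>
     p ^ f mod m = 1 mod m \<and> list_all (\<lambda>k. p ^ k mod m \<noteq> 1 mod m) [1..<f] \<and> totient m = g * f)"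

lemma totient_values:
  "totient 3 = 2"
  "totient 4 = 2"
  "totient 5 = 4"
  "totient 6 = 2"
  "totient 7 = 6"
  "totient 8 = 4"
  "totient 9 = 6"
  "totient 10 = 4"
  "totient 11 = 10"
  "totient 12 = 4"
  "totient 13 = 12"
  "totient 14 = 6"
  "totient 15 = 8"
  "totient 16 = 8"
  "totient 17 = 16"
  "totient 18 = 6"
  "totient 19 = 18"
  "totient 20 = 8"
  "totient 21 = 12"
  "totient 22 = 10"
  "totient 25 = 20"
  "totient 27 = 18"
  "totient 28 = 12"
  "totient 33 = 20"
  "totient 35 = 24"
  "totient 45 = 24"
  by code_simp+

lemma lcm_2_nat: "lcm 2 (n :: nat) = (if even n then n else 2 * n)"
  by (simp add: lcm_proj2_if_dvd lcm_coprime)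

lemma numerical_rows:
  "list_all (\<lambda>(n, D). 2 < n \<and> list_all (numerical_row n) D \<and>
     lcm 2 n = prod_list (map (\<lambda>(p, a, _). p ^ a) D)) factorization_data"
  by (simp add: factorization_data_def numerical_row_def Let_def lcm_2_nat totient_values upt_conv_Cons del: upt_Suc)

lemma split_rows:
  "list_all (\<lambda>(n, D). list_all (\<lambda>(p, a, f, g). g = 2 \<longrightarrow> \<not> n dvd 2 * p ^ a \<and>
     (a = 1 \<and> (if p = 2 then n \<in> {7, 15, 17, 21, 33, 35, 45} else p \<in> {3, 5, 7} \<and> p dvd n) \<or>
      a = 2 \<and> p = 2 \<and> n \<in> {28, 60, 84} \<and> totient n = 4 * f)) D) factorization_data"
  by code_simp

lemma factorization_dataD:
  assumes "(n, D) \<in> set factorization_data"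
  shows "2 < n" "lcm 2 n = prod_list (map (\<lambda>(p, a, _). p ^ a) D)"
    and "x \<in> set D \<Longrightarrow> numerical_row n x"
  using numerical_rows assms by (auto simp: list_all_iff)

lemma prime_above_of_numerical_row:
  assumes "numerical_row n (p, a, f, g)" "2 < n"
  shows "prime_above n p a (lcm 2 n div p ^ a) f" "totient (lcm 2 n div p ^ a) = g * f" "g = 1 \<or> g = 2"
proof -
  define m where "m = lcm 2 n div p ^ a"
  have row: "Factorial_Ring.prime p" "0 < a" "0 < f" "g = 1 \<or> g = 2" "lcm 2 n = p ^ a * m" "\<not> p dvd m"
    "p ^ f mod m = 1 mod m" "list_all (\<lambda>k. p ^ k mod m \<noteq> 1 mod m) [1..<f]" "totient m = g * f"
    using assms(1) unfolding numerical_row_def Let_def m_def split by blast+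
  have "prime_above n p a m f"
  proof
    fix k assume k: "0 < k" "[p ^ k = 1] (mod m)"
    show "f \<le> k"
    proof (rule ccontr)
      assume "\<not> f \<le> k"
      then have "k \<in> set [1..<f]" using k(1) by (simp del: upt_Suc)
      then have "p ^ k mod m \<noteq> 1 mod m" using row(8) unfolding list_all_iff by blast
      then show False using k(2) by (simp add: cong_def)
    qed
  qed (use row assms(2) in \<open>simp_all add: cong_def\<close>)
  then show "prime_above n p a (lcm 2 n div p ^ a) f" unfolding m_def .
  show "totient (lcm 2 n div p ^ a) = g * f" using row(9) unfolding m_def .
  show "g = 1 \<or> g = 2" by (rule row(4))
qed

lemma one_prime_above_of_data:
  assumes "(n, D) \<in> set factorization_data" "(p, a, f, 1) \<in> set D"
  shows "one_prime_above n p a (lcm 2 n div p ^ a) f"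
proof -
  note row = prime_above_of_numerical_row[OF factorization_dataD(3)[OF assms] factorization_dataD(1)[OF assms(1)]]
  show ?thesis
    using row(2) by (intro one_prime_above.intro[OF row(1)] one_prime_above_axioms.intro) (simp only: mult_1)
qed

text \<open>The \<open>(n, p, a)\<close> for which there are two primes above \<open>p\<close>, generated by complex conjugates. In the three
  cases left out, the decomposition field is real.\<close>

definition conjugate_rows :: "(nat \<times> nat \<times> nat) list" where
  "conjugate_rows = [(7, 2, 1), (15, 2, 1), (20, 5, 1), (21, 2, 1), (21, 7, 1), (24, 3, 1), (28, 2, 2), (33, 3, 1),
     (35, 2, 1), (40, 5, 1), (45, 2, 1), (48, 3, 1), (60, 2, 2), (60, 3, 1), (60, 5, 1), (84, 2, 2), (84, 7, 1)]"

lemma conjugate_rows_of_data: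
  "list_all (\<lambda>(n, D). list_all (\<lambda>(p, a, f, g). g = 2 \<and> (n, p) \<notin> {(17, 2), (33, 2), (84, 3)} \<longrightarrow>
     (n, p, a) \<in> set conjugate_rows) D) factorization_data"
  by code_simp

lemma conjugate_factors:
  "list_all (\<lambda>(n, p, a). \<exists>q. conjugate_factor n (1 - xi (p ^ a)) q) conjugate_rows"
  by (simp add: conjugate_rows_def xi_2 dvd_lcmI2 conjugate_factor_2_of_7 conjugate_factor_2_of_15
      conjugate_factor_5_of_20 conjugate_factor_7_of_21 conjugate_factor_3_of_24 conjugate_factor_2_of_28
      conjugate_factor_3_of_33 conjugate_factor_2_of_60 conjugate_factor_3_of_60)

lemma conjugate_factor_of_data:
  assumes "(n, D) \<in> set factorization_data" "(p, a, f, 2) \<in> set D" "(n, p) \<notin> {(17, 2), (33, 2), (84, 3)}"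
  shows "\<exists>q. conjugate_factor n (1 - xi (p ^ a)) q"
proof -
  have "(n, p, a) \<in> set conjugate_rows"
    using conjugate_rows_of_data assms unfolding list_all_iff by fastforce
  then show ?thesis using conjugate_factors unfolding list_all_iff by fastforce
qed

lemma two_primes_above_of_data:
  assumes D: "(n, D) \<in> set factorization_data" "(p, a, f, 2) \<in> set D"
  shows "\<exists>r r'. two_primes_above n p a (lcm 2 n div p ^ a) f r r' \<and>
           ((n, p) \<notin> {(17, 2), (33, 2), (84, 3)} \<longrightarrow> r' = cnj r)"
proof -
  note row = prime_above_of_numerical_row[OF factorization_dataD(3)[OF D] factorization_dataD(1)[OF D(1)]]
  interpret prime_above n p a "lcm 2 n div p ^ a" f by (rule row(1))
  show ?thesis
  proof (cases "(n, p) \<in> {(17, 2), (33, 2), (84, 3)}")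
    case False
    then obtain q where "conjugate_factor n lam q" using conjugate_factor_of_data[OF D] unfolding lam_def by blast
    then have "two_primes_above n p a (lcm 2 n div p ^ a) f q (cnj q)"
      using row(2) by (intro two_primes_above_conjugate)
    then show ?thesis by blast
  next
    case True
    have "list_all (\<lambda>(n, D). list_all (\<lambda>(p, a, f, g). g = 2 \<and> (n, p) \<in> {(17, 2), (33, 2), (84, 3)} \<longrightarrow>
        a = 1) D) factorization_data" by code_simp
    then have "a = 1" using True D unfolding list_all_iff by fastforce
    then have lam_p: "lam = 1 - xi p" using lam_def by (metis power_one_right)
    have "\<exists>q q' u v. q \<in> M \<and> q' \<in> M \<and> u \<in> M \<and> v \<in> M \<and> q * q' = u * lam \<and> u * v = 1 \<and>
        1 \<notin> PI q \<and> 1 \<notin> PI q'"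
    proof (cases "p = 2")
      case True
      then have "lam = 2" unfolding lam_p by (simp add: xi_2)
      have "n = 17 \<or> n = 33" using \<open>(n, p) \<in> _\<close> True by auto
      then have "\<exists>q q'. q \<in> M \<and> q' \<in> M \<and> q * q' = - 2 \<and> 1 \<notin> PI q \<and> 1 \<notin> PI q'"
        using exists_factor_2_of_17[of 17] exists_factor_2_of_33[of 33] by (auto intro: dvd_lcmI2)
      then obtain q q' where "q \<in> M" "q' \<in> M" "q * q' = - 1 * lam" "1 \<notin> PI q" "1 \<notin> PI q'"
        using \<open>lam = 2\<close> by auto
      moreover have "- 1 \<in> M" "- 1 * - 1 = (1 :: complex)" by simp_all
      ultimately show ?thesis by blast
    next
      case False
      then have np: "n = 84" "p = 3" using \<open>(n, p) \<in> _\<close> by auto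
      have "0 < n" "3 dvd lcm 2 n" "4 dvd lcm 2 n" "7 dvd lcm 2 n" unfolding np(1) by (simp_all add: dvd_lcmI2)
      moreover have "1 - xi p = 1 - xi 3" using np(2) by simp
      ultimately show ?thesis unfolding lam_p by (simp only: exists_factor_3_of_84)
    qed
    then obtain q q' u v where q: "q \<in> M" "q' \<in> M" "u \<in> M" "v \<in> M" "q * q' = u * lam" "u * v = 1"
        "1 \<notin> PI q" "1 \<notin> PI q'" by blast
    have "two_primes_above n p a (lcm 2 n div p ^ a) f q q'"
    proof
      show "PI lam = PI (q * q')" unfolding q(5) using principal_ideal_unit_mult[OF q(3,4,6)] by simp
    qed (use q row in auto)
    then show ?thesis using True by blast
  qed
qed

lemma factorization_row_of_data:
  assumes D: "(n, D) \<in> set factorization_data" "x \<in> set D"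
  shows "factorization_row n x"
proof -
  obtain p a f g where x: "x = (p, a, f, g)" by (cases x) auto
  have g: "g = 1 \<or> g = 2"
    using prime_above_of_numerical_row(3)[OF factorization_dataD(3)[OF D, unfolded x] factorization_dataD(1)[OF D(1)]] .
  then show ?thesis
  proof
    assume "g = 1"
    then show ?thesis using one_prime_above_of_data[OF D(1), of p a f] D(2) x
      unfolding factorization_row_def by auto
  next
    assume "g = 2"
    then show ?thesis using two_primes_above_of_data[OF D(1), of p a f] D(2) x
      unfolding factorization_row_def by auto
  qed
qed

text \<open>The table lists just the norms of the divisors of the \<open>1 - \<xi>\<^sub>p\<close>, units excepted.\<close>

lemma entries_eq_table_line:
  assumes "(n, D) \<in> set factorization_data"
  shows "entries n = set (table_line n D)"
proof -
  have "list_all (\<lambda>(n, D). entries n = set (table_line n D)) factorization_data"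
    unfolding factorization_data_def list.pred_inject split
    by (intro conjI; auto simp: entries_def exception_table_def table_line_def table_entry_def fixing_exponent_def
        largest_exponent_below_numeral point_group_def upt_conv_Cons simp del: upt_Suc)
  then show ?thesis using assms by (auto simp: list_all_iff)
qed

lemma split_rowD:
  assumes "(n, D) \<in> set factorization_data" "(p, a, f, 2) \<in> set D"
  shows "\<not> n dvd 2 * p ^ a"
    and "a = 1 \<and> (if p = 2 then n \<in> {7, 15, 17, 21, 33, 35, 45} else p \<in> {3, 5, 7} \<and> p dvd n) \<or>
         a = 2 \<and> p = 2 \<and> n \<in> {28, 60, 84} \<and> totient n = 4 * f"
  using split_rows assms unfolding list_all_iff by fastforce+

lemma data_cases:
  assumes "n \<in> {3,4,5,7,8,9,11,12,13,15,16,17,19,20,21,24,25,27,28,32,33,35,36,40,44,45,48,60,84}"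
  obtains D where "(n, D) \<in> set factorization_data"
proof -
  have "list_all (\<lambda>n. n \<in> fst ` set factorization_data)
      [3,4,5,7,8,9,11,12,13,15,16,17,19,20,21,24,25,27,28,32,33,35,36,40,44,45,48,60,84]"
    by code_simp
  then have "n \<in> fst ` set factorization_data" using assms unfolding list_all_iff by (simp only: list.set)
  then show ?thesis using that by auto
qed

context two_primes_above
begin

lemma principal_ideal_r_lam: "PI (r ^ i * lam ^ j) = PI (r ^ (i + j) * r' ^ j)"
proof -
  have "PI (r ^ i * lam ^ j) = PI (r ^ i * (r ^ j * r' ^ j))"
    using lam_power_eq[of j] unfolding principal_ideal_eq_iff by (auto intro: principal_ideal_mult_mono)
  then show ?thesis by (simp add: power_add mult.assoc)
qed

lemma induces_factors:
  assumes n: "2 < n" and a: "a = 1" and np: "\<not> n dvd 2 * p"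
  shows "x \<in> {lam, r, r'} \<Longrightarrow> induces_group n x (cyc p)"
    and "x \<in> {r ^ 2, r' ^ 2} \<Longrightarrow> induces_trivial n x"
proof -
  have e: "fixing_exponent p a 1 = 1" "fixing_exponent p a 2 = 0"
    using p_gt_1 unfolding a fixing_exponent_def by simp_all
  have pg: "point_group n (p ^ 1) = cyc p" using np by (simp add: point_group_def)
  have "PI lam = PI (r ^ 1 * r' ^ 1)" "PI r = PI (r ^ 1 * r' ^ 0)" "PI r' = PI (r ^ 0 * r' ^ 1)"
    using lam_eq by simp_all
  from induces_powers(1)[OF _ lam_in_M this(1)] induces_powers(1)[OF _ r(1) this(2)]
    induces_powers(1)[OF _ r(2) this(3)]
  have "induces_group n lam (cyc p)" "induces_group n r (cyc p)" "induces_group n r' (cyc p)"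
    using e(1) pg by simp_all
  then show "x \<in> {lam, r, r'} \<Longrightarrow> induces_group n x (cyc p)" by blast
  have "PI (r ^ 2) = PI (r ^ 2 * r' ^ 0)" "PI (r' ^ 2) = PI (r ^ 0 * r' ^ 2)" by simp_all
  from induces_powers(3)[OF _ _ this(1) n] induces_powers(3)[OF _ _ this(2) n]
  have "induces_trivial n (r ^ 2)" "induces_trivial n (r' ^ 2)"
    using e(2) r by simp_all
  then show "x \<in> {r ^ 2, r' ^ 2} \<Longrightarrow> induces_trivial n x" by blast
qed

text \<open>The assumption on \<open>i\<close> says that \<open>r\<^sup>i r'\<^sup>j\<close> is less balanced than other elements of the same norm. As
  \<open>r\<^sup>i r'\<^sup>j\<close> is an associate of \<open>r\<^bsup>i-j\<^esup> lam\<^sup>j\<close>, it is one of the listed deviations.\<close>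

lemma specified_deviation_of_unbalanced:
  assumes row: "a = 1 \<and> (if p = 2 then n \<in> {7, 15, 17, 21, 33, 35, 45} else p \<in> {3, 5, 7} \<and> p dvd n) \<or>
         a = 2 \<and> p = 2 \<and> n \<in> {28, 60, 84}"
    and J: "i + j \<le> 2 * p ^ (a - 1)" and q: "PI q = PI (r ^ i * r' ^ j)"
    and ij: "(i + j + 1) div 2 < i"
  shows "specified_deviation n q"
  using row
proof
  assume 1: "a = 1 \<and> (if p = 2 then n \<in> {7, 15, 17, 21, 33, 35, 45} else p \<in> {3, 5, 7} \<and> p dvd n)"
  then have "i + j \<le> 2" using J by simp
  then have "i = 2" "j = 0" using ij by linarith+
  then have qr: "PI q = PI (r ^ 2)" using q by simp
  show ?thesis
  proof (cases "p = 2")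
    case True
    have "lam = 1 - xi (p ^ a)" by (rule lam_def)
    also have "\<dots> = 2" using 1 True by (simp add: xi_2)
    finally have "splits_into n 2 r r'" using splits_into_lam by simp
    then show ?thesis unfolding specified_deviation_def using 1 True qr by auto
  next
    case False
    have "lam = 1 - xi (p ^ a)" by (rule lam_def)
    also have "\<dots> = 1 - xi p" using 1 by simp
    finally have "splits_into n (1 - xi p) r r'" using splits_into_lam by simp
    then show ?thesis unfolding specified_deviation_def using 1 False qr by auto
  qed
next
  assume 2: "a = 2 \<and> p = 2 \<and> n \<in> {28, 60, 84}"
  then have "i + j \<le> 4" using J by simp
  then have "(i, j) \<in> {(2, 0), (3, 0), (3, 1), (4, 0)}" using ij by auto
  then have "\<exists>(i', j') \<in> {(2,0), (4,0), (2,1), (3,0)}. i = i' + j' \<and> j = j'" by auto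
  then obtain i' j' where i': "(i', j') \<in> {(2,0), (4,0), (2,1), (3 :: nat,0 :: nat)}" "i = i' + j'" "j = j'" by blast
  have "lam = 1 - xi (p ^ a)" by (rule lam_def)
  also have "\<dots> = 1 - xi 4" using 2 by simp
  finally have lam4: "lam = 1 - xi 4" .
  then have "PI q = PI (r ^ i' * (1 - xi 4) ^ j')" using q i' principal_ideal_r_lam by simp
  moreover have "splits_into n (1 - xi 4) r r'" using splits_into_lam lam4 by simp
  ultimately show ?thesis unfolding specified_deviation_def using 2 i'(1) by blast
qed

lemma yields_or_deviation:
  assumes row: "a = 1 \<and> (if p = 2 then n \<in> {7, 15, 17, 21, 33, 35, 45} else p \<in> {3, 5, 7} \<and> p dvd n) \<or>
         a = 2 \<and> p = 2 \<and> n \<in> {28, 60, 84}"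
    and J: "0 < J" "J \<le> 2 * p ^ (a - 1)" and c: "bravais_colouring n q (p ^ (f * J)) c"
  shows "yields n q (p ^ (f * J)) c (point_group n (p ^ fixing_exponent p a ((J + 1) div 2))) \<or>
         2 \<le> J \<and> specified_deviation n q"
proof -
  obtain i j where ij: "PI q = PI (r ^ i * r' ^ j)" "i + j = J" using colouring_cases[OF c] by blast
  interpret swap: two_primes_above n p a m f r' r by (rule swap)
  consider "max i j = (J + 1) div 2" | "(J + 1) div 2 < i" | "(J + 1) div 2 < j" using ij(2) by linarith
  then show ?thesis
  proof cases
    case 1
    then show ?thesis using colouring_yields[OF c ij(1)] ij(2) J(1) by simp
  next
    case 2
    then show ?thesis using specified_deviation_of_unbalanced[OF row _ ij(1)] ij(2) J(2) by auto
  next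
    case 3
    have "PI q = PI (r' ^ j * r ^ i)" using ij(1) by (simp add: mult.commute)
    from swap.specified_deviation_of_unbalanced[OF row _ this] show ?thesis
      using 3 ij(2) J(2) by (auto simp: add.commute)
  qed
qed

end

section \<open>The theorem\<close>

lemma entry_in_table_lineD:
  assumes "e \<in> entries n" "(n, D) \<in> set factorization_data"
  obtains p a f g J where "(p, a, f, g) \<in> set D" "1 \<le> J" "J \<le> g * p ^ (a - 1)"
    "e = table_entry n (p, a, f, g) J" "g = 1 \<or> g = 2"
proof -
  obtain p a f g J where *: "(p, a, f, g) \<in> set D" "J \<in> {1..g * p ^ (a - 1)}" "e = table_entry n (p, a, f, g) J"
    using assms(1) unfolding entries_eq_table_line[OF assms(2)] set_table_line by blast
  have g: "g = 1 \<or> g = 2"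
    using prime_above_of_numerical_row(3)[OF factorization_dataD(3)[OF assms(2) *(1)] factorization_dataD(1)[OF assms(2)]] .
  show ?thesis using *(2) by (intro that[OF *(1) _ _ *(3) g]) simp_all
qed

lemma unstarred_entries:
  assumes e: "(l \<rhd> P) \<in> entries n" and D: "(n, D) \<in> set factorization_data"
  shows "(\<exists>q c. bravais_colouring n q l c) \<and> (\<forall>q c. bravais_colouring n q l c \<longrightarrow> yields n q l c P)"
proof -
  obtain p a f g J where row: "(p, a, f, g) \<in> set D" and J: "1 \<le> J" "J \<le> g * p ^ (a - 1)"
    and e: "(l \<rhd> P) = table_entry n (p, a, f, g) J" and g: "g = 1 \<or> g = 2"
    using entry_in_table_lineD[OF e D] .
  have l: "l = p ^ (f * J)" and P: "P = point_group n (p ^ fixing_exponent p a ((J + g - 1) div g))"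
    and gJ: "g = 1 \<or> J = 1"
    using e J(1) g by (auto simp: table_entry_def split: if_splits)
  show ?thesis
  proof (cases "g = 1")
    case True
    interpret one_prime_above n p a "lcm 2 n div p ^ a" f
      using one_prime_above_of_data[OF D] row True by simp
    show ?thesis unfolding l P
      using exists_colouring[of J] colouring_yields[of J] J True by auto
  next
    case False
    then have g2: "g = 2" and J1: "J = 1" using g gJ by auto
    obtain r r' where "two_primes_above n p a (lcm 2 n div p ^ a) f r r'"
      using two_primes_above_of_data[OF D] row g2 by blast
    then interpret two_primes_above n p a "lcm 2 n div p ^ a" f r r' .
    have "\<exists>c. bravais_colouring n (r ^ 1 * r' ^ 0) (p ^ (f * (1 + 0))) c" by (rule exists_colouring) simp
    moreover have "yields n q l c P" if "bravais_colouring n q l c" for q c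
    proof -
      obtain i j where ij: "PI q = PI (r ^ i * r' ^ j)" "i + j = 1"
        using colouring_cases \<open>bravais_colouring n q l c\<close> l J1 by blast
      then have "max i j = 1" by linarith
      then show ?thesis using colouring_yields[OF \<open>bravais_colouring n q l c\<close> ij(1)] ij(2) P g2 J1 by simp
    qed
    ultimately show ?thesis using l J1 by auto
  qed
qed

lemma starred_entries:
  assumes e: "(l \<rhd>\<^sup>* P) \<in> entries n" and D: "(n, D) \<in> set factorization_data"
  shows "(\<exists>q c. bravais_colouring n q l c \<and> yields n q l c P) \<and>
         (\<forall>q c. bravais_colouring n q l c \<longrightarrow> yields n q l c P \<or> specified_deviation n q)"
proof -
  obtain p a f g J where row: "(p, a, f, g) \<in> set D" and J: "1 \<le> J" "J \<le> g * p ^ (a - 1)"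
    and e: "(l \<rhd>\<^sup>* P) = table_entry n (p, a, f, g) J" and g: "g = 1 \<or> g = 2"
    using entry_in_table_lineD[OF e D] .
  have l: "l = p ^ (f * J)" and g2: "g = 2"
    and P: "P = point_group n (p ^ fixing_exponent p a ((J + 1) div 2))"
    using e J(1) g by (auto simp: table_entry_def split: if_splits)
  obtain r r' where "two_primes_above n p a (lcm 2 n div p ^ a) f r r'"
    using two_primes_above_of_data[OF D] row g2 by blast
  then interpret two_primes_above n p a "lcm 2 n div p ^ a" f r r' .
  define i where "i = (J + 1) div 2"
  define j where "j = J - i"
  have ij: "i + j = J" "max i j = (J + 1) div 2" "0 < i + j" using J(1) unfolding i_def j_def by auto
  obtain c where c: "bravais_colouring n (r ^ i * r' ^ j) l c"
    using exists_colouring[OF ij(3)] ij(1) l by auto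
  have "yields n (r ^ i * r' ^ j) l c P"
    using colouring_yields[OF c refl ij(3)] ij(2) P by simp
  moreover have "yields n q l c P \<or> specified_deviation n q" if c: "bravais_colouring n q l c" for q c
    using yields_or_deviation[of J q c] split_rowD(2)[OF D, of p a f] row g2 J c l P by auto
  ultimately show ?thesis using c by blast
qed

lemma row_of_prime:
  assumes D: "(n, D) \<in> set factorization_data" and p: "Factorial_Ring.prime p" "p dvd n"
  obtains a f g where "(p, a, f, g) \<in> set D" "g = 1 \<or> g = 2"
proof -
  have "\<forall>(p', a, _) \<in> set D. Factorial_Ring.prime p'"
    using factorization_dataD(3)[OF D] by (auto simp: numerical_row_def Let_def)
  moreover have "p dvd prod_list (map (\<lambda>(p, a, _). p ^ a) D)"
    using p(2) factorization_dataD(2)[OF D] dvd_lcmI2[of p n 2] by simp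
  ultimately obtain a f g where *: "(p, a, f, g) \<in> set D"
    using prime_dvd_prod_list_powers[OF p(1)] by blast
  then show ?thesis
    using that prime_above_of_numerical_row(3)[OF factorization_dataD(3)[OF D *] factorization_dataD(1)[OF D]]
    by blast
qed

lemma splitting_of_2:
  assumes n: "n \<in> {7, 15, 17, 21, 33, 35, 45}" and D: "(n, D) \<in> set factorization_data"
  shows "(\<exists>q q'. splits_into n 2 q q' \<and> (n \<notin> {17, 33} \<longrightarrow> q' = cnj q)) \<and>
     (\<forall>q q'. splits_into n 2 q q' \<longrightarrow>
        (\<forall>r \<in> {2, q, q'}. induces_group n r (cyc 2)) \<and> (\<forall>r \<in> {q ^ 2, q' ^ 2}. induces_trivial n r))"
proof -
  have "list_all (\<lambda>(n, D). n \<in> {7, 15, 17, 21, 33, 35, 45} \<longrightarrow>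
      list_ex (\<lambda>(p, a, f, g). (p, a, g) = (2, 1, 2)) D) factorization_data" by code_simp
  then obtain f where row: "(2, 1, f, 2) \<in> set D"
    using n D unfolding list_all_iff list_ex_iff by fastforce
  note num = prime_above_of_numerical_row[OF factorization_dataD(3)[OF D row] factorization_dataD(1)[OF D]]
  interpret prime_above n 2 1 "lcm 2 n div 2 ^ 1" f by (rule num(1))
  have lam2: "lam = 2" using lam_def xi_2 by simp
  obtain r r' where r: "two_primes_above n 2 1 (lcm 2 n div 2 ^ 1) f r r'" "n \<notin> {17, 33} \<longrightarrow> r' = cnj r"
    using two_primes_above_of_data[OF D row] by auto
  have "splits_into n 2 r r'" using two_primes_above.splits_into_lam[OF r(1)] lam2 by simp
  moreover have "(\<forall>x \<in> {2, q, q'}. induces_group n x (cyc 2)) \<and> (\<forall>x \<in> {q ^ 2, q' ^ 2}. induces_trivial n x)"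
    if q: "splits_into n 2 q q'" for q q'
  proof -
    interpret q: two_primes_above n 2 1 "lcm 2 n div 2 ^ 1" f q q'
      using two_primes_above_of_splits_into[OF num(2)] q lam2 by simp
    have "\<not> n dvd 2 * 2" using split_rowD(1)[OF D row] by simp
    then show ?thesis using q.induces_factors[OF factorization_dataD(1)[OF D] refl] lam2 by metis
  qed
  ultimately show ?thesis using r(2) by blast
qed

lemma splitting_of_odd_prime:
  assumes odd: "p \<in> {3, 5, 7}" "p dvd n" "splits n (1 - xi p)" and D: "(n, D) \<in> set factorization_data"
  shows "(\<exists>q q'. splits_into n (1 - xi p) q q' \<and> ((n, p) \<noteq> (84, 3) \<longrightarrow> q' = cnj q)) \<and>
     (\<forall>q q'. splits_into n (1 - xi p) q q' \<longrightarrow>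
        (\<forall>r \<in> {1 - xi p, q, q'}. induces_group n r (cyc p)) \<and> (\<forall>r \<in> {q ^ 2, q' ^ 2}. induces_trivial n r))"
proof -
  have prime: "Factorial_Ring.prime p" using odd(1) by auto
  obtain a f g where row: "(p, a, f, g) \<in> set D" "g = 1 \<or> g = 2" using row_of_prime[OF D prime odd(2)] .
  have "g \<noteq> 1" using one_prime_above.not_splits[OF one_prime_above_of_data[OF D]] row(1) odd(3) by blast
  then have row: "(p, a, f, 2) \<in> set D" using row by auto
  have a: "a = 1" using split_rowD(2)[OF D row] odd(1) by auto
  note num = prime_above_of_numerical_row[OF factorization_dataD(3)[OF D row] factorization_dataD(1)[OF D]]
  interpret prime_above n p a "lcm 2 n div p ^ a" f by (rule num(1))
  have lam_p: "lam = 1 - xi p" using lam_def a by (metis power_one_right)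
  obtain r r' where r: "two_primes_above n p a (lcm 2 n div p ^ a) f r r'"
      "(n, p) \<notin> {(17, 2), (33, 2), (84, 3)} \<longrightarrow> r' = cnj r"
    using two_primes_above_of_data[OF D row] by blast
  have "splits_into n (1 - xi p) r r'" using two_primes_above.splits_into_lam[OF r(1)] lam_p by simp
  moreover have "(\<forall>x \<in> {1 - xi p, q, q'}. induces_group n x (cyc p)) \<and> (\<forall>x \<in> {q ^ 2, q' ^ 2}. induces_trivial n x)"
    if q: "splits_into n (1 - xi p) q q'" for q q'
  proof -
    interpret q: two_primes_above n p a "lcm 2 n div p ^ a" f q q'
      using two_primes_above_of_splits_into[OF num(2)] q lam_p by simp
    have "\<not> n dvd 2 * p" using split_rowD(1)[OF D row] a by simp
    then show ?thesis using q.induces_factors[OF factorization_dataD(1)[OF D] a] lam_p by metis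
  qed
  moreover have "p \<noteq> 2" using odd(1) by auto
  then have "(n, p) \<noteq> (84, 3) \<longrightarrow> r' = cnj r" using r(2) by auto
  ultimately show ?thesis by blast
qed

lemma splits_odd_prime:
  assumes row: "(p, 1, f, 2) \<in> set D" and D: "(n, D) \<in> set factorization_data"
  shows "splits n (1 - xi p)"
proof -
  obtain r r' where "two_primes_above n p 1 (lcm 2 n div p ^ 1) f r r'"
    using two_primes_above_of_data[OF D row] by blast
  then interpret two_primes_above n p 1 "lcm 2 n div p ^ 1" f r r' .
  have "lam = 1 - xi p" using lam_def by simp
  then show ?thesis using splits_lam by simp
qed

lemma (in two_primes_above) triples:
  assumes pa: "p = 2" "a = 2" and n: "2 < n" "\<not> n dvd 8" and tot: "totient n = 4 * f"
  shows "\<forall>(i, j, l) \<in> triples_C4 n. ideal_index n (r ^ i * lam ^ j) = l \<and> induces_group n (r ^ i * lam ^ j) (cyc 4)"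
    and "\<forall>(i, j, l) \<in> triples_C2 n. ideal_index n (r ^ i * lam ^ j) = l \<and> induces_group n (r ^ i * lam ^ j) (cyc 2)"
    and "\<forall>(i, j, l) \<in> triples_trivial n. ideal_index n (r ^ i * lam ^ j) = l \<and> induces_trivial n (r ^ i * lam ^ j)"
proof -
  have e: "fixing_exponent p a 1 = 2" "fixing_exponent p a 2 = 1" "fixing_exponent p a 3 = 0" "fixing_exponent p a 4 = 0"
    "fixing_exponent p a (Suc (Suc 0)) = 1"
    unfolding pa fixing_exponent_def by (simp_all add: numeral_2_eq_2)
  have mx: "max (i + j) j = i + j" for i j :: nat by simp
  have n4: "\<not> n dvd 4" using n(2) dvd_trans[of n 4 8] by auto
  have pg: "point_group n 4 = cyc 4" "point_group n 2 = cyc 2" using n(2) n4 by (simp_all add: point_group_def)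
  have M: "r ^ i * lam ^ j \<in> M" for i j using r(1) lam_in_M by simp
  have ix: "ideal_index n (r ^ i * lam ^ j) = 2 ^ (f * (i + j + j))" if "0 < i + j" for i j
    using induces_powers(2)[OF _ M principal_ideal_r_lam[of i j]] that pa by simp
  have grp: "induces_group n (r ^ i * lam ^ j) (point_group n (2 ^ fixing_exponent p a (i + j)))" if "0 < i + j" for i j
    using induces_powers(1)[OF _ M principal_ideal_r_lam[of i j]] that unfolding mx pa by simp
  have triv: "induces_trivial n (r ^ i * lam ^ j)" if "0 < i + j" "fixing_exponent p a (i + j) = 0" for i j
    using induces_powers(3)[OF _ M principal_ideal_r_lam[of i j] n(1)] that unfolding mx by simp
  have four: "(2 :: nat) ^ 2 = 4" by simp
  show "\<forall>(i, j, l) \<in> triples_C4 n. ideal_index n (r ^ i * lam ^ j) = l \<and> induces_group n (r ^ i * lam ^ j) (cyc 4)"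
    using ix[of 0 1] ix[of 1 0] grp[of 0 1] grp[of 1 0] unfolding triples_C4_def tot
    by (simp add: e[simplified] four pg mult.commute)
  show "\<forall>(i, j, l) \<in> triples_C2 n. ideal_index n (r ^ i * lam ^ j) = l \<and> induces_group n (r ^ i * lam ^ j) (cyc 2)"
    using ix[of 0 2] ix[of 2 0] ix[of 1 1] grp[of 0 2] grp[of 2 0] grp[of 1 1] unfolding triples_C2_def tot
    by (simp add: e pg mult.commute)
  show "\<forall>(i, j, l) \<in> triples_trivial n. ideal_index n (r ^ i * lam ^ j) = l \<and> induces_trivial n (r ^ i * lam ^ j)"
    using ix[of 4 0] ix[of 2 1] ix[of 3 0] triv[of 4 0] triv[of 2 1] triv[of 3 0] unfolding triples_trivial_def tot
    by (simp add: e mult.commute)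
qed

lemma splitting_of_one_minus_i:
  assumes n: "n \<in> {28, 60, 84}" and D: "(n, D) \<in> set factorization_data"
  shows "principal_ideal n 2 =
         principal_ideal n (1 - xi 4) \<cdot>\<^bsub>cyclotomic_ring n\<^esub> principal_ideal n (1 - xi 4) \<and>
       (\<exists>q. splits_into n (1 - xi 4) q (cnj q)) \<and>
       (\<forall>q. splits_into n (1 - xi 4) q (cnj q) \<longrightarrow>
          principal_ideal n 2 =
            principal_ideal n q \<cdot>\<^bsub>cyclotomic_ring n\<^esub> principal_ideal n (cnj q)
              \<cdot>\<^bsub>cyclotomic_ring n\<^esub> principal_ideal n q \<cdot>\<^bsub>cyclotomic_ring n\<^esub> principal_ideal n (cnj q) \<and>
          (\<forall>s \<in> {q, cnj q}.
             (\<forall>(i, j, l) \<in> triples_C4 n. ideal_index n (s ^ i * (1 - xi 4) ^ j) = l \<and>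
                induces_group n (s ^ i * (1 - xi 4) ^ j) (cyc 4)) \<and>
             (\<forall>(i, j, l) \<in> triples_C2 n. ideal_index n (s ^ i * (1 - xi 4) ^ j) = l \<and>
                induces_group n (s ^ i * (1 - xi 4) ^ j) (cyc 2)) \<and>
             (\<forall>(i, j, l) \<in> triples_trivial n. ideal_index n (s ^ i * (1 - xi 4) ^ j) = l \<and>
                induces_trivial n (s ^ i * (1 - xi 4) ^ j))))"
    (is "?square \<and> ?splits \<and> ?triples")
proof -
  have "list_all (\<lambda>(n, D). n \<in> {28, 60, 84} \<longrightarrow>
      list_ex (\<lambda>(p, a, f, g). (p, a, g) = (2, 2, 2)) D) factorization_data" by code_simp
  then obtain f where row: "(2, 2, f, 2) \<in> set D"
    using n D unfolding list_all_iff list_ex_iff by fastforce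
  note num = prime_above_of_numerical_row[OF factorization_dataD(3)[OF D row] factorization_dataD(1)[OF D]]
  interpret prime_above n 2 2 "lcm 2 n div 2 ^ 2" f by (rule num(1))
  have lam4: "lam = 1 - xi 4" using lam_def by simp
  have tot: "totient n = 4 * f" using split_rowD(2)[OF D row] by auto
  have n8: "\<not> n dvd 8" using split_rowD(1)[OF D row] by simp
  have iM: "\<i> \<in> M" using n by (intro module_i) (auto intro: dvd_lcmI2)
  have "lam * lam = (- \<i>) * 2" unfolding lam4 xi_4 by (simp add: algebra_simps)
  then have "PI (lam * lam) = PI 2"
    using principal_ideal_unit_mult[of "- \<i>" n \<i> 2] iM by simp
  then have two: "PI 2 = PI lam \<cdot>\<^bsub>cyclotomic_ring n\<^esub> PI lam"
    using ideal_prod_principal[OF lam_in_M lam_in_M] by simp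
  have "(n, 2) \<notin> {(17, 2), (33, 2), (84, 3 :: nat)}" using n by auto
  then obtain r where r: "two_primes_above n 2 2 (lcm 2 n div 2 ^ 2) f r (cnj r)"
    using two_primes_above_of_data[OF D row] by auto
  have split: "splits_into n lam r (cnj r)" using two_primes_above.splits_into_lam[OF r] .
  have triples: "PI 2 = PI q \<cdot>\<^bsub>cyclotomic_ring n\<^esub> PI (cnj q) \<cdot>\<^bsub>cyclotomic_ring n\<^esub> PI q \<cdot>\<^bsub>cyclotomic_ring n\<^esub> PI (cnj q) \<and>
      (\<forall>s \<in> {q, cnj q}.
         (\<forall>(i, j, l) \<in> triples_C4 n. ideal_index n (s ^ i * lam ^ j) = l \<and> induces_group n (s ^ i * lam ^ j) (cyc 4)) \<and>
         (\<forall>(i, j, l) \<in> triples_C2 n. ideal_index n (s ^ i * lam ^ j) = l \<and> induces_group n (s ^ i * lam ^ j) (cyc 2)) \<and>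
         (\<forall>(i, j, l) \<in> triples_trivial n. ideal_index n (s ^ i * lam ^ j) = l \<and> induces_trivial n (s ^ i * lam ^ j)))"
    if q: "splits_into n lam q (cnj q)" for q
  proof -
    interpret q: two_primes_above n 2 2 "lcm 2 n div 2 ^ 2" f q "cnj q"
      using two_primes_above_of_splits_into[OF num(2) q] .
    interpret swap: two_primes_above n 2 2 "lcm 2 n div 2 ^ 2" f "cnj q" q by (rule q.swap)
    have "PI (lam * lam) = PI ((q * cnj q) * (q * cnj q))"
      using q.lam_eq unfolding principal_ideal_eq_iff by (auto intro: principal_ideal_mult_mono)
    then have "PI 2 = PI (q * cnj q * q * cnj q)"
      using \<open>PI (lam * lam) = PI 2\<close> by (simp add: mult.assoc)
    then have "PI 2 = PI q \<cdot>\<^bsub>cyclotomic_ring n\<^esub> PI (cnj q) \<cdot>\<^bsub>cyclotomic_ring n\<^esub> PI q \<cdot>\<^bsub>cyclotomic_ring n\<^esub> PI (cnj q)"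
      using q.r by (simp add: ideal_prod_principal)
    moreover have
      "(\<forall>(i, j, l) \<in> triples_C4 n. ideal_index n (s ^ i * lam ^ j) = l \<and> induces_group n (s ^ i * lam ^ j) (cyc 4)) \<and>
       (\<forall>(i, j, l) \<in> triples_C2 n. ideal_index n (s ^ i * lam ^ j) = l \<and> induces_group n (s ^ i * lam ^ j) (cyc 2)) \<and>
       (\<forall>(i, j, l) \<in> triples_trivial n. ideal_index n (s ^ i * lam ^ j) = l \<and> induces_trivial n (s ^ i * lam ^ j))"
      if s: "s \<in> {q, cnj q}" for s
    proof -
      from s consider "s = q" | "s = cnj q" by blast
      then show ?thesis
        using q.triples[OF refl refl factorization_dataD(1)[OF D] n8 tot]
          swap.triples[OF refl refl factorization_dataD(1)[OF D] n8 tot] by cases (simp_all only:)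
    qed
    ultimately show ?thesis by (intro conjI ballI) simp_all
  qed
  show ?thesis
  proof (intro conjI)
    show ?square using two unfolding lam4 .
    show ?splits using split unfolding lam4 by blast
    show ?triples using triples unfolding lam4 by (intro allI impI)
  qed
qed

theorem theorem3p5:
  fixes n :: nat
  assumes "n \<in> {3,4,5,7,8,9,11,12,13,15,16,17,19,20,21,24,25,27,28,32,33,35,36,40,44,45,48,60,84}"
  shows "
     \<comment> \<open>the table; the one-coloured module (\<open>l = 1\<close>, \<open>q\<close> a unit) is not considered\<close>
     (\<forall>q l c. bravais_colouring n q l c \<and> l > 1 \<and> l \<notin> colours ` entries n
       \<longrightarrow> trivial_K n q l c) \<and>
     (\<forall>l P. (l \<rhd> P) \<in> entries n \<longrightarrow>
       (\<exists>q c. bravais_colouring n q l c) \<and>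
       (\<forall>q c. bravais_colouring n q l c \<longrightarrow> yields n q l c P)) \<and>
     (\<forall>l P. (l \<rhd>\<^sup>* P) \<in> entries n \<longrightarrow>
       (\<exists>q c. bravais_colouring n q l c \<and> yields n q l c P) \<and>
       (\<forall>q c. bravais_colouring n q l c \<longrightarrow> yields n q l c P \<or> specified_deviation n q)) \<and>
     \<comment> \<open>(i); for \<open>n = 17\<close> and \<open>n = 33\<close> the two primes are not complex conjugates\<close>
     (n \<in> {7,15,17,21,33,35,45} \<longrightarrow>
       (\<exists>q q'. splits_into n 2 q q' \<and> (n \<notin> {17,33} \<longrightarrow> q' = cnj q)) \<and>
       (\<forall>q q'. splits_into n 2 q q' \<longrightarrow>
          (\<forall>r \<in> {2, q, q'}. induces_group n r (cyc 2)) \<and>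
          (\<forall>r \<in> {q ^ 2, q' ^ 2}. induces_trivial n r))) \<and>
     \<comment> \<open>(ii); for \<open>n = 84\<close> and \<open>p = 3\<close> the two primes are not complex conjugates\<close>
     (\<forall>p \<in> {3,5,7}. p dvd n \<and> splits n (1 - xi p) \<longrightarrow>
       (\<exists>q q'. splits_into n (1 - xi p) q q' \<and> ((n, p) \<noteq> (84, 3) \<longrightarrow> q' = cnj q)) \<and>
       (\<forall>q q'. splits_into n (1 - xi p) q q' \<longrightarrow>
          (\<forall>r \<in> {1 - xi p, q, q'}. induces_group n r (cyc p)) \<and>
          (\<forall>r \<in> {q ^ 2, q' ^ 2}. induces_trivial n r))) \<and>
     (n \<in> {48,60,84} \<longrightarrow> splits n (1 - xi 3)) \<and>
     (n \<in> {40,60} \<longrightarrow> splits n (1 - xi 5)) \<and>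
     (n \<in> {21,84} \<longrightarrow> splits n (1 - xi 7)) \<and>
     \<comment> \<open>(iii)\<close>
     (n \<in> {28,60,84} \<longrightarrow>
       principal_ideal n 2 =
         principal_ideal n (1 - xi 4) \<cdot>\<^bsub>cyclotomic_ring n\<^esub> principal_ideal n (1 - xi 4) \<and>
       (\<exists>q. splits_into n (1 - xi 4) q (cnj q)) \<and>
       (\<forall>q. splits_into n (1 - xi 4) q (cnj q) \<longrightarrow>
          principal_ideal n 2 =
            principal_ideal n q \<cdot>\<^bsub>cyclotomic_ring n\<^esub> principal_ideal n (cnj q)
              \<cdot>\<^bsub>cyclotomic_ring n\<^esub> principal_ideal n q \<cdot>\<^bsub>cyclotomic_ring n\<^esub> principal_ideal n (cnj q) \<and>
          (\<forall>s \<in> {q, cnj q}.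
             (\<forall>(i, j, l) \<in> triples_C4 n. ideal_index n (s ^ i * (1 - xi 4) ^ j) = l \<and>
                induces_group n (s ^ i * (1 - xi 4) ^ j) (cyc 4)) \<and>
             (\<forall>(i, j, l) \<in> triples_C2 n. ideal_index n (s ^ i * (1 - xi 4) ^ j) = l \<and>
                induces_group n (s ^ i * (1 - xi 4) ^ j) (cyc 2)) \<and>
             (\<forall>(i, j, l) \<in> triples_trivial n. ideal_index n (s ^ i * (1 - xi 4) ^ j) = l \<and>
                induces_trivial n (s ^ i * (1 - xi 4) ^ j)))))"
proof -
  obtain D where D: "(n, D) \<in> set factorization_data" using data_cases[OF assms] .
  note rows = factorization_row_of_data[OF D]
  have row_ex: "\<exists>f. (p, 1, f, 2) \<in> set D"
    if "(n, p) \<in> {48, 60, 84} \<times> {3} \<union> {40, 60} \<times> {5} \<union> {21, 84} \<times> {7}" for p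
  proof -
    have "list_all (\<lambda>(n, D). list_all (\<lambda>p. (n, p) \<in> set [(48, 3), (60, 3), (84, 3), (40, 5), (60, 5), (21, 7), (84, 7)] \<longrightarrow>
        list_ex (\<lambda>(p', a, f, g). (p', a, g) = (p, 1, 2)) D) [3, 5, 7]) factorization_data" by code_simp
    moreover have "(n, p) \<in> set [(48, 3), (60, 3), (84, 3), (40, 5), (60, 5), (21, 7), (84, 7)]" "p \<in> set [3, 5, 7]"
      using that by auto
    ultimately have "list_ex (\<lambda>(p', a, f, g). (p', a, g) = (p, 1, 2)) D"
      using D unfolding list_all_iff by blast
    then show ?thesis unfolding list_ex_iff by auto
  qed
  show ?thesis
  proof (intro conjI)
    show "\<forall>q l c. bravais_colouring n q l c \<and> l > 1 \<and> l \<notin> colours ` entries n \<longrightarrow> trivial_K n q l c"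
      using trivial_unless_in_table[OF factorization_dataD(1)[OF D] _ factorization_dataD(2)[OF D]] rows
      unfolding entries_eq_table_line[OF D] by blast
    show "\<forall>l P. (l \<rhd> P) \<in> entries n \<longrightarrow>
        (\<exists>q c. bravais_colouring n q l c) \<and> (\<forall>q c. bravais_colouring n q l c \<longrightarrow> yields n q l c P)"
      using unstarred_entries[OF _ D] by blast
    show "\<forall>l P. (l \<rhd>\<^sup>* P) \<in> entries n \<longrightarrow>
        (\<exists>q c. bravais_colouring n q l c \<and> yields n q l c P) \<and>
        (\<forall>q c. bravais_colouring n q l c \<longrightarrow> yields n q l c P \<or> specified_deviation n q)"
      using starred_entries[OF _ D] by blast
  next
    show "n \<in> {7,15,17,21,33,35,45} \<longrightarrow>
       (\<exists>q q'. splits_into n 2 q q' \<and> (n \<notin> {17,33} \<longrightarrow> q' = cnj q)) \<and>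
       (\<forall>q q'. splits_into n 2 q q' \<longrightarrow>
          (\<forall>r \<in> {2, q, q'}. induces_group n r (cyc 2)) \<and>
          (\<forall>r \<in> {q ^ 2, q' ^ 2}. induces_trivial n r))"
      using splitting_of_2[OF _ D] by (rule impI)
  next
    show "\<forall>p \<in> {3,5,7}. p dvd n \<and> splits n (1 - xi p) \<longrightarrow>
       (\<exists>q q'. splits_into n (1 - xi p) q q' \<and> ((n, p) \<noteq> (84, 3) \<longrightarrow> q' = cnj q)) \<and>
       (\<forall>q q'. splits_into n (1 - xi p) q q' \<longrightarrow>
          (\<forall>r \<in> {1 - xi p, q, q'}. induces_group n r (cyc p)) \<and>
          (\<forall>r \<in> {q ^ 2, q' ^ 2}. induces_trivial n r))"
    proof (intro ballI impI)
      fix p :: nat assume "p \<in> {3,5,7}" "p dvd n \<and> splits n (1 - xi p)"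
      then show "(\<exists>q q'. splits_into n (1 - xi p) q q' \<and> ((n, p) \<noteq> (84, 3) \<longrightarrow> q' = cnj q)) \<and>
       (\<forall>q q'. splits_into n (1 - xi p) q q' \<longrightarrow>
          (\<forall>r \<in> {1 - xi p, q, q'}. induces_group n r (cyc p)) \<and>
          (\<forall>r \<in> {q ^ 2, q' ^ 2}. induces_trivial n r))"
        by (intro splitting_of_odd_prime[OF _ _ _ D]) simp_all
    qed
  next
    show "n \<in> {48,60,84} \<longrightarrow> splits n (1 - xi 3)" using row_ex[of 3] splits_odd_prime[OF _ D] by blast
    show "n \<in> {40,60} \<longrightarrow> splits n (1 - xi 5)" using row_ex[of 5] splits_odd_prime[OF _ D] by blast
    show "n \<in> {21,84} \<longrightarrow> splits n (1 - xi 7)" using row_ex[of 7] splits_odd_prime[OF _ D] by blast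
  qed (rule impI, rule splitting_of_one_minus_i[OF _ D], assumption)
qed

end
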